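(* Let $(\mathcal Q,d)$ be a Hadamard space, $\tau\in\mathcal S_0^+$ with $\lim_{x\to\infty}\tau'(x)=\infty$, $Y$ a $\mathcal Q$-valued random variable concentrated on a separable set with $\mathbf E[\tau'(d(Y,o))]<\infty$, $m$ a $\tau$-Fréchet mean of $Y$, and $m_n$ an empirical $\tau$-Fréchet mean of $n$ independent copies $Y_1,\dots,Y_n$ of $Y$. Let $g,h,\sigma_f,\hat\sigma_f,S_{n,1}$ be as defined in the context, let $\chi$ be a median of $d(Y,m)$, and set $r_0:=\max\big(\chi,\,2(\tau')^{-1}(16\,\sigma_{\tau'})\big)$. (i) Assume $\mathbf E\big[\tau'(d(Y,m))^2\,h(\tau'(d(Y,m)))\big]<\infty$ and $\lim_{x\searrow0}\tau'^{\oplus}(x)=\infty$. Then, as $n\to\infty$, $$\mathbf E\big[d(m,m_n)^2\,\tau'^{\oplus}(\chi+d(m,m_n))\big]\le\frac{256}{n}\big(\sigma_{(\tau')^2}\,S_{n,1}+o(1)\big).$$ (ii) Let $\epsilon>0$. Assume $\mathbf E\big[\tau'(d(Y,m))^{2(1+\epsilon)}\,h(\tau'(d(Y,m)))^{1+\epsilon}\big]<\infty$, $\sup_{n\in\mathbb N}\mathbf E\big[h(2\hat\sigma_{\tau'})^{1+\epsilon}\big]<\infty$, and $\sigma_{g^{1+\epsilon}}<\infty$. Then, as $n\to\infty$, $$\mathbf E\big[d(m,m_n)^2\,\tau'^{\oplus}(\chi+d(m,m_n))\big]\le\frac{256}{n}\big(\sigma_{(\tau')^2}\,\tau'^{\oplus}(4r_0)^{-1}+o(1)\big).$$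 (iii) Assume that either the conditions of (i) together with $\sup_{n\in\mathbb N}\mathbf E[h(2\hat\sigma_{\tau'})]<\infty$ hold, or the conditions of (ii) hold for some $\epsilon>0$. Then, as $n\to\infty$, $$\tau^{-1}\big(\mathbf E[\tau(d(m,m_n))]\big)=O(n^{-\frac12})\quad\text{and, in particular,}\quad\mathbf E[d(m,m_n)]=O(n^{-\frac12}).$$
   Context: A Hadamard space is a nonempty complete metric space $(\mathcal Q,d)$ such that for all $y_0,y_1\in\mathcal Q$ there is $p\in\mathcal Q$ with $\frac12 d(y_0,q)^2+\frac12 d(y_1,q)^2-\frac14 d(y_0,y_1)^2\ge d(q,p)^2$ for all $q\in\mathcal Q$; it carries its Borel $\sigma$-algebra. "Concentrated on a separable set" means $\mathbf P(Y\in\mathcal Y)=1$ for some separable $\mathcal Y\subset\mathcal Q$. $o\in\mathcal Q$ is an arbitrary reference point. $\mathcal S_0^+$ is the set of nondecreasing convex functions $\tau\colon[0,\infty)\to\mathbb R$ with $\tau(0)=0$ that are differentiable on $(0,\infty)$ with concave derivative $\tau'$ satisfying $\tau'(x)>0$ for all $x>0$; one sets $\tau'(0):=\lim_{x\searrow0}\tau'(x)$. $\tau'^{\oplus}$ denotes the right derivative of $\tau'$: it is nonincreasing, finite on $(0,\infty)$, and $\tau'^{\oplus}(0)=\lim_{x\searrow0}\tau'^{\oplus}(x)\in[0,\infty]$. If $\lim_{x\to\infty}\tau'(x)=\infty$, then $\tau'^\oplus>0$ and $\tau'$ is strictly increasing; $(\tau')^{-1}\colon[\tau'(0),\infty)\to[0,\infty)$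 is its inverse, extended by $(\tau')^{-1}(x)=0$ for $x\in[0,\tau'(0))$. A $\tau$-Fréchet mean of $Y$ is any $m\in\arg\min_{q\in\mathcal Q}\mathbf E[\tau(d(Y,q))-\tau(d(Y,o))]$ (independent of $o$); $m_n\in\arg\min_{q\in\mathcal Q}\sum_{j=1}^n\tau(d(Y_j,q))$ is a measurable function of $(Y_1,\dots,Y_n)$. For measurable $f\colon[0,\infty)\to[0,\infty)$ set $\sigma_f:=\mathbf E[f(d(Y,m))]$ and $\hat\sigma_f:=\frac1n\sum_{j=1}^n f(d(Y_j,m))$ (so $\sigma_{(\tau')^2}=\mathbf E[\tau'(d(Y,m))^2]$, $\sigma_{g^{p}}=\mathbf E[g(d(Y,m))^p]$). Further $g(x):=\tau'^{\oplus}(7x)^{-1}$ (with $\infty^{-1}:=0$), $h(x):=g\big((\tau')^{-1}(12x)\big)$, and $S_{n,1}:=\max\big(\sigma_g,\,2h(\sigma_{\tau'}),\,\mathbf E[h(2\hat\sigma_{\tau'})]\big)$. *)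

theory Defs
  imports "HOL-Probability.Probability" "HOL-Library.Landau_Symbols"
begin

class hadamard_space = complete_space +
  assumes hadamard: "\<exists>p. \<forall>q. (dist y0 q)\<^sup>2 / 2 + (dist y1 q)\<^sup>2 / 2 - (dist y0 y1)\<^sup>2 / 4 \<ge> (dist q p)\<^sup>2"

text \<open>
  Functions on \<open>[0,\<infinity>)\<close> are represented by functions on all reals; values at negative
  arguments are never used.
\<close>

definition S0_plus :: "(real \<Rightarrow> real) set" where
  "S0_plus = {\<tau>. mono_on {0..} \<tau> \<and> convex_on {0..} \<tau> \<and> \<tau> 0 = 0 \<and>
     (\<forall>x>0. \<tau> field_differentiable at x) \<and> concave_on {0<..} (deriv \<tau>) \<and> (\<forall>x>0. deriv \<tau> x > 0)}"

text \<open>The derivative \<open>\<tau>'\<close>, extended to \<open>0\<close> by its right limit.\<close>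

definition dtau :: "(real \<Rightarrow> real) \<Rightarrow> real \<Rightarrow> real" where
  "dtau \<tau> x = (if x > 0 then deriv \<tau> x else Lim (at_right 0) (deriv \<tau>))"

text \<open>
  The right derivative of \<open>\<tau>'\<close>, extended to \<open>0\<close> by its right limit, which may be infinite.
  It is nonnegative, so that the coercion to \<^typ>\<open>ennreal\<close> truncates nothing.
\<close>

definition rdtau :: "(real \<Rightarrow> real) \<Rightarrow> real \<Rightarrow> ennreal" where
  "rdtau \<tau> x = (if x > 0 then ennreal (vector_derivative (dtau \<tau>) (at_right x))
     else Lim (at_right 0) (\<lambda>s. ennreal (vector_derivative (dtau \<tau>) (at_right s))))"

definition inv_dtau :: "(real \<Rightarrow> real) \<Rightarrow> real \<Rightarrow> real" where
  "inv_dtau \<tau> x = (if x < dtau \<tau> 0 then 0 else the_inv_into {0..} (dtau \<tau>) x)"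

text \<open>
  \<open>inverse \<infinity> = 0\<close> holds in \<^typ>\<open>ennreal\<close>. The inverse is finite because \<open>rdtau \<tau> > 0\<close>
  whenever \<open>\<tau>'\<close> is unbounded.
\<close>

definition g_fun :: "(real \<Rightarrow> real) \<Rightarrow> real \<Rightarrow> real" where
  "g_fun \<tau> x = enn2real (inverse (rdtau \<tau> (7 * x)))"

definition h_fun :: "(real \<Rightarrow> real) \<Rightarrow> real \<Rightarrow> real" where
  "h_fun \<tau> x = g_fun \<tau> (inv_dtau \<tau> (12 * x))"

definition frechet_mean ::
  "'w measure \<Rightarrow> (real \<Rightarrow> real) \<Rightarrow> ('w \<Rightarrow> 'a::metric_space) \<Rightarrow> 'a \<Rightarrow> 'a \<Rightarrow> bool" where
  "frechet_mean M \<tau> Y ref m \<longleftrightarrow>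
     is_arg_min (\<lambda>q. \<integral>\<omega>. \<tau> (dist (Y \<omega>) q) - \<tau> (dist (Y \<omega>) ref) \<partial>M) (\<lambda>_. True) m"

definition empirical_frechet_mean ::
  "'w measure \<Rightarrow> (real \<Rightarrow> real) \<Rightarrow> (nat \<Rightarrow> 'w \<Rightarrow> 'a::metric_space) \<Rightarrow> nat \<Rightarrow> ('w \<Rightarrow> 'a) \<Rightarrow> bool" where
  "empirical_frechet_mean M \<tau> X n mn \<longleftrightarrow>
     (\<exists>F \<in> measurable (PiM {1..n} (\<lambda>_. borel)) borel.
        \<forall>\<omega>\<in>space M. mn \<omega> = F (\<lambda>j\<in>{1..n}. X j \<omega>)) \<and>
     (AE \<omega> in M. is_arg_min (\<lambda>q. \<Sum>j=1..n. \<tau> (dist (X j \<omega>) q)) (\<lambda>_. True) (mn \<omega>))"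

definition is_median :: "'w measure \<Rightarrow> ('w \<Rightarrow> real) \<Rightarrow> real \<Rightarrow> bool" where
  "is_median M Z c \<longleftrightarrow>
     measure M {\<omega>\<in>space M. Z \<omega> \<le> c} \<ge> 1/2 \<and> measure M {\<omega>\<in>space M. Z \<omega> \<ge> c} \<ge> 1/2"

definition sigma_f :: "'w measure \<Rightarrow> ('w \<Rightarrow> 'a::metric_space) \<Rightarrow> 'a \<Rightarrow> (real \<Rightarrow> real) \<Rightarrow> ennreal" where
  "sigma_f M Y m f = (\<integral>\<^sup>+\<omega>. ennreal (f (dist (Y \<omega>) m)) \<partial>M)"

definition sigma_hat ::
  "(nat \<Rightarrow> 'w \<Rightarrow> 'a::metric_space) \<Rightarrow> 'a \<Rightarrow> (real \<Rightarrow> real) \<Rightarrow> nat \<Rightarrow> 'w \<Rightarrow> real" where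
  "sigma_hat X m f n \<omega> = (1 / real n) * (\<Sum>j=1..n. f (dist (X j \<omega>) m))"

text \<open>
  Below, \<open>enn2real\<close> is only applied to \<open>\<sigma>\<close> of \<open>\<tau>'\<close>, which is finite as soon as
  \<open>\<tau>'(d(Y,o))\<close> has finite expectation for some reference point \<open>o\<close>.
\<close>

definition S_n1 ::
  "'w measure \<Rightarrow> (real \<Rightarrow> real) \<Rightarrow> ('w \<Rightarrow> 'a::metric_space) \<Rightarrow> (nat \<Rightarrow> 'w \<Rightarrow> 'a) \<Rightarrow> 'a \<Rightarrow> nat \<Rightarrow> ennreal" where
  "S_n1 M \<tau> Y X m n =
     max (sigma_f M Y m (g_fun \<tau>))
       (max (ennreal (2 * h_fun \<tau> (enn2real (sigma_f M Y m (dtau \<tau>)))))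
         (\<integral>\<^sup>+\<omega>. ennreal (h_fun \<tau> (2 * sigma_hat X m (dtau \<tau>) n \<omega>)) \<partial>M))"

definition r_zero ::
  "'w measure \<Rightarrow> (real \<Rightarrow> real) \<Rightarrow> ('w \<Rightarrow> 'a::metric_space) \<Rightarrow> 'a \<Rightarrow> real \<Rightarrow> real" where
  "r_zero M \<tau> Y m c = max c (2 * inv_dtau \<tau> (16 * enn2real (sigma_f M Y m (dtau \<tau>))))"

definition cond_i ::
  "'w measure \<Rightarrow> (real \<Rightarrow> real) \<Rightarrow> ('w \<Rightarrow> 'a::metric_space) \<Rightarrow> 'a \<Rightarrow> bool" where
  "cond_i M \<tau> Y m \<longleftrightarrow>
     (\<integral>\<^sup>+\<omega>. ennreal ((dtau \<tau> (dist (Y \<omega>) m))\<^sup>2 * h_fun \<tau> (dtau \<tau> (dist (Y \<omega>) m))) \<partial>M) < \<infinity> \<and>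
     (rdtau \<tau> \<longlongrightarrow> \<infinity>) (at_right 0)"

definition cond_ii ::
  "'w measure \<Rightarrow> (real \<Rightarrow> real) \<Rightarrow> ('w \<Rightarrow> 'a::metric_space) \<Rightarrow> (nat \<Rightarrow> 'w \<Rightarrow> 'a) \<Rightarrow> 'a \<Rightarrow> real \<Rightarrow> bool" where
  "cond_ii M \<tau> Y X m \<epsilon> \<longleftrightarrow>
     (\<integral>\<^sup>+\<omega>. ennreal (dtau \<tau> (dist (Y \<omega>) m) powr (2 * (1 + \<epsilon>)) *
                   h_fun \<tau> (dtau \<tau> (dist (Y \<omega>) m)) powr (1 + \<epsilon>)) \<partial>M) < \<infinity> \<and>
     (SUP n\<in>{1..}. \<integral>\<^sup>+\<omega>. ennreal (h_fun \<tau> (2 * sigma_hat X m (dtau \<tau>) n \<omega>) powr (1 + \<epsilon>)) \<partial>M) < \<infinity> \<and>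
     sigma_f M Y m (\<lambda>x. g_fun \<tau> x powr (1 + \<epsilon>)) < \<infinity>"

text \<open>
  The expectation of \<open>d(m,m\<^sub>n)\<^sup>2 \<tau>'\<^sup>\<oplus>(\<chi> + d(m,m\<^sub>n))\<close>. If \<open>\<chi> = 0\<close> and \<open>\<tau>'\<^sup>\<oplus>(0) = \<infinity>\<close>, the convention
  \<open>0 * \<infinity> = 0\<close> of \<^typ>\<open>ennreal\<close> applies where \<open>d(m,m\<^sub>n) = 0\<close>.
\<close>

definition frechet_risk ::
  "'w measure \<Rightarrow> (real \<Rightarrow> real) \<Rightarrow> 'a::metric_space \<Rightarrow> real \<Rightarrow> ('w \<Rightarrow> 'a) \<Rightarrow> ennreal" where
  "frechet_risk M \<tau> m c mn =
     (\<integral>\<^sup>+\<omega>. ennreal ((dist m (mn \<omega>))\<^sup>2) * rdtau \<tau> (c + dist m (mn \<omega>)) \<partial>M)"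

end

theory Submission
  imports Defs
begin

text \<open>
  The proof is a leave-one-out stability argument. Let \<open>p\<close> minimize the empirical risk of \<open>n + 1\<close>
  points and \<open>q\<^sub>i\<close> that of the points other than \<open>i\<close>. Comparing with midpoints shows that both risks
  grow quadratically around their minimizers, and adding the two growth inequalities yields
  \<open>\<tau>(d(Y\<^sub>i,q\<^sub>i)) - \<tau>(d(Y\<^sub>i,p)) \<le> (\<tau>'(d(Y\<^sub>i,m)) + \<tau>'(d(m,q\<^sub>i)))\<^sup>2 / \<Sum>\<^sub>j w\<^sub>j\<close>, where \<open>w\<^sub>j\<close> is the right derivative
  of \<open>\<tau>'\<close> at the sum of \<open>d(Y\<^sub>j,m)\<close> and the distances of \<open>m\<close> to the minimizers, and \<open>j \<noteq> i\<close>. Since \<open>p\<close>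
  minimizes the risk of all points, averaging over \<open>i\<close> bounds the expected excess risk of \<open>m\<^sub>n\<close>.

  Minimality also gives \<open>\<tau>'(d(m,q\<^sub>i)) \<le> 4/n \<Sum>\<^sub>j \<tau>'(d(Y\<^sub>j,m))\<close>, so that the bound only involves distances
  to \<open>m\<close> and its expectation factorizes up to terms of lower order. The excess risk at distance \<open>r\<close>
  from \<open>m\<close> is at least \<open>r\<^sup>2/4\<close> times the right derivative of \<open>\<tau>'\<close> at \<open>\<chi> + r\<close>. The constants obtained
  are \<open>4 * 25 * 2 = 200\<close> in (i) and \<open>4 * 25 * 5/2 = 250\<close> in (ii).
\<close>

section \<open>Transformations\<close>

text \<open>The minimizers depend on every observation, so independence helps only with distances to
  the fixed point m. Hence \<open>g D\<close>, with \<open>D\<close> the larger distance from m to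
  the two minimizers, is bounded anew in each summand: beside a factor of observation k, the average
  controlling \<open>D\<close> is split into the average over the others, independent of k, and the
  share of k alone. That share is of lower order in (i) because an infinite right derivative at 0
  forces g to vanish there. In (ii) no such limit is available; instead, outside an event of
  probability O(1/n), at least 2n/5 points other than i lie within \<chi> of m and \<open>D\<close>
  is bounded, so the weights have a constant lower bound. The additional moments pay for the
  exceptional event, by truncation at the square root of n.

  Constants: 4 comes from half of the probability mass and the factor 1/2 in quadratic growth, 25
  from the weights, 2 from two moments that are both at most \<open>S_n1\<close>, 5/2 from the
  proportion 2/5.

  A separate obstacle is that the space may be nonseparable: neither the metric nor the event of
  being a minimizer is evidently measurable.\<close>

locale transform =
  fixes \<tau> :: "real \<Rightarrow> real"
  assumes S0: "\<tau> \<in> S0_plus"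
    and unbounded: "filterlim (dtau \<tau>) at_top at_top"
begin

abbreviation a :: "real \<Rightarrow> real" where "a \<equiv> dtau \<tau>"

text \<open>The real-valued form of \<open>rdtau\<close> at positive arguments. At 0 the right
  derivative can be infinite, which is why vanishing distances are often treated separately
  below.\<close>

definition \<kappa> :: "real \<Rightarrow> real" where "\<kappa> x = vector_derivative a (at_right x)"

lemma tau_mono: "0 \<le> x \<Longrightarrow> x \<le> y \<Longrightarrow> \<tau> x \<le> \<tau> y"
  using S0 by (auto simp: S0_plus_def mono_on_def)

lemma tau_0 [simp]: "\<tau> 0 = 0"
  using S0 by (auto simp: S0_plus_def)

lemma tau_nonneg: "0 \<le> x \<Longrightarrow> 0 \<le> \<tau> x"
  using tau_mono[of 0 x] by simp

lemma tau_deriv: "0 < x \<Longrightarrow> (\<tau> has_real_derivative a x) (at x)"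
  using S0 by (auto simp: S0_plus_def dtau_def DERIV_deriv_iff_field_differentiable)

lemma a_pos: "0 < x \<Longrightarrow> 0 < a x"
  using S0 by (auto simp: S0_plus_def dtau_def)

lemma tau_tangent:
  assumes "0 < x" "0 \<le> y" shows "a x * (y - x) \<le> \<tau> y - \<tau> x"
proof -
  have "convex_on {0..} \<tau>" using S0 by (auto simp: S0_plus_def)
  moreover have "x \<in> interior {0..}" using assms by simp
  moreover have "(\<tau> has_real_derivative a x) (at x within {0..})"
    using tau_deriv[OF assms(1)] by (rule has_field_derivative_at_within)
  ultimately show ?thesis
    using assms convex_on_imp_above_tangent[of "{0..}" \<tau> x y "a x"] by (simp add: connected_Ici)
qed

lemma a_mono_pos:
  assumes "0 < x" "x \<le> y" shows "a x \<le> a y"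
proof (cases "x = y")
  case False
  have "0 \<le> (a y - a x) * (y - x)"
    using tau_tangent[of x y] tau_tangent[of y x] assms by (simp add: algebra_simps)
  with False assms show ?thesis by (simp add: zero_le_mult_iff)
qed simp

text \<open>A nondecreasing function that is bounded below has its infimum as right limit, so the
  \<open>Lim\<close> in \<open>dtau\<close> denotes a genuine limit.\<close>

lemma a_lim: "(a \<longlongrightarrow> a 0) (at_right 0)" and a_zero_le: "0 < x \<Longrightarrow> a 0 \<le> a x" and a_zero_nonneg: "0 \<le> a 0"
proof -
  define l where "l = Inf (a ` {0<..})"
  have bdd: "bdd_below (a ` {0<..})"
    by (rule bdd_belowI[of _ 0]) (auto intro: less_imp_le[OF a_pos])
  have le: "l \<le> a x" if "0 < x" for x
    unfolding l_def using that bdd by (intro cInf_lower) auto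
  have l0: "0 \<le> l" unfolding l_def by (rule cInf_greatest) (auto intro: less_imp_le[OF a_pos])
  have lim: "(a \<longlongrightarrow> l) (at_right 0)"
  proof (rule order_tendstoI)
    fix u assume "u < l"
    then show "\<forall>\<^sub>F x in at_right 0. u < a x"
      unfolding eventually_at_right_field using le by (intro exI[of _ 1]) (auto intro: less_le_trans)
  next
    fix u assume "l < u"
    then obtain x0 where x0: "0 < x0" "a x0 < u"
      unfolding l_def using cInf_lessD[of "a ` {0<..}" u] by auto
    then show "\<forall>\<^sub>F x in at_right 0. a x < u"
      unfolding eventually_at_right_field
      by (intro exI[of _ x0]) (auto intro: le_less_trans[OF a_mono_pos[OF _ less_imp_le]])
  qed
  moreover have "\<forall>\<^sub>F x in at_right 0. a x = deriv \<tau> x"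
    unfolding eventually_at_right_field by (intro exI[of _ 1]) (auto simp: dtau_def)
  ultimately have "(deriv \<tau> \<longlongrightarrow> l) (at_right 0)" by (blast dest: tendsto_cong[THEN iffD1])
  then have "a 0 = l" by (simp add: dtau_def tendsto_Lim)
  then show "(a \<longlongrightarrow> a 0) (at_right 0)" "0 < x \<Longrightarrow> a 0 \<le> a x" "0 \<le> a 0"
    using lim le l0 by auto
qed

lemma a_nonpos: "x \<le> 0 \<Longrightarrow> a x = a 0"
  by (simp add: dtau_def)

text \<open>\<open>dtau\<close> is constant on the nonpositive reals, so monotonicity extends to the
  whole line and measurability follows.\<close>

lemma a_mono: "x \<le> y \<Longrightarrow> a x \<le> a y"
  using a_mono_pos[of x y] a_nonpos[of x] a_nonpos[of y] a_zero_le[of y]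
  by (cases "0 < x"; cases "0 < y") auto

lemma mono_a: "mono a"
  by (rule monoI) (rule a_mono)

lemma a_nonneg: "0 \<le> a x"
  using a_zero_nonneg a_mono[of 0 x] a_nonpos[of x] by (cases "0 \<le> x") auto

lemma measurable_a [measurable]: "a \<in> borel_measurable borel"
  by (rule borel_measurable_mono) (rule mono_a)

section \<open>Concavity of the derivative, its difference quotients and its right
  derivative\<close>

lemma a_concave:
  assumes "0 < x" "x < y" "y < z"
  shows "(a z - a y) * (y - x) \<le> (a y - a x) * (z - y)"
proof -
  have "concave_on {0<..} (deriv \<tau>)" using S0 by (auto simp: S0_plus_def)
  then have c: "convex_on {0<..} (\<lambda>x. - deriv \<tau> x)" by (simp add: concave_on_def)
  define t where "t = (y - x) / (z - x)"
  have t: "0 \<le> t" "t \<le> 1" using assms by (auto simp: t_def divide_simps)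
  have "t * (z - x) = y - x" using assms by (simp add: t_def)
  then have yt: "y = (1 - t) * x + t * z" by (simp add: algebra_simps)
  have "- deriv \<tau> y \<le> (1 - t) * (- deriv \<tau> x) + t * (- deriv \<tau> z)"
    using convex_onD[OF c t, of x z] assms yt by simp
  then have "(1 - t) * a x + t * a z \<le> a y" using assms by (simp add: dtau_def)
  then have "(z - x) * ((1 - t) * a x + t * a z) \<le> (z - x) * a y"
    using assms by (intro mult_left_mono) auto
  moreover have "(z - x) * t = y - x" using assms by (simp add: t_def)
  moreover have "(z - x) * (1 - t) = z - y" using assms by (simp add: t_def field_simps)
  ultimately have "(z - y) * a x + (y - x) * a z \<le> (z - x) * a y"
    by (metis (no_types, lifting) distrib_left mult.assoc)
  then show ?thesis by (simp add: algebra_simps)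
qed

definition slope :: "real \<Rightarrow> real \<Rightarrow> real" where "slope x y = (a y - a x) / (y - x)"

text \<open>The outer slope is the mediant (u + v) / (p + q) of the inner slopes u / p and v / q,
  hence lies between them.\<close>

lemma slope_antimono:
  assumes "0 < x" "x < y" "y < z"
  shows "slope y z \<le> slope x z" "slope x z \<le> slope x y" "slope y z \<le> slope x y"
proof -
  define p q u v where "p = y - x" and "q = z - y" and "u = a y - a x" and "v = a z - a y"
  have pq: "0 < p" "0 < q" and *: "v * p \<le> u * q"
    using assms a_concave[OF assms] by (auto simp: p_def q_def u_def v_def)
  have s: "slope x y = u / p" "slope y z = v / q" "slope x z = (u + v) / (p + q)"
    by (auto simp: slope_def p_def q_def u_def v_def)
  show "slope y z \<le> slope x z" "slope x z \<le> slope x y" "slope y z \<le> slope x y"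
    unfolding s using pq * by (auto simp: divide_simps algebra_simps)
qed

lemma slope_bdd: assumes "0 < x" shows "bdd_above (slope x ` {x<..})"
  using slope_antimono(3)[of "x/2" x] assms by (intro bdd_aboveI[of _ "slope (x/2) x"]) auto

text \<open>The slopes to the right of x grow as their endpoint decreases to x and are bounded by
  the slope from x / 2 to x. So the right derivative exists and is their supremum.\<close>

lemma kappa_eq: assumes "0 < x" shows "\<kappa> x = Sup (slope x ` {x<..})"
proof -
  define l where "l = Sup (slope x ` {x<..})"
  have le: "slope x y \<le> l" if "x < y" for y
    unfolding l_def using that slope_bdd[OF assms] by (intro cSup_upper) auto
  have "(slope x \<longlongrightarrow> l) (at_right x)"
  proof (rule order_tendstoI)
    fix u assume "l < u"
    then show "\<forall>\<^sub>F y in at_right x. slope x y < u"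
      unfolding eventually_at_right_field using le by (intro exI[of _ "x+1"]) (auto intro: le_less_trans)
  next
    fix u assume "u < l"
    then obtain y0 where y0: "x < y0" "u < slope x y0"
      unfolding l_def using less_cSupD[of "slope x ` {x<..}" u] by auto
    then show "\<forall>\<^sub>F y in at_right x. u < slope x y"
      unfolding eventually_at_right_field using slope_antimono(2)[OF assms, of _ y0]
      by (intro exI[of _ y0]) (auto intro: less_le_trans)
  qed
  then have "(a has_real_derivative l) (at_right x)"
    by (simp add: has_field_derivative_iff slope_def[abs_def])
  then show ?thesis
    unfolding \<kappa>_def l_def[symmetric]
    by (intro vector_derivative_within) (auto simp: has_real_derivative_iff_has_vector_derivative trivial_limit_at_right_real)
qed

lemma slope_le_kappa: "0 < x \<Longrightarrow> x < y \<Longrightarrow> slope x y \<le> \<kappa> x"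
  using slope_bdd[of x] by (auto simp: kappa_eq intro!: cSup_upper)

lemma kappa_le_slope: assumes "0 < x" "x < y" shows "\<kappa> y \<le> slope x y"
proof -
  have "0 < y" using assms by simp
  show ?thesis unfolding kappa_eq[OF \<open>0 < y\<close>]
    using assms slope_antimono(3)[of x y] by (intro cSup_least) auto
qed

lemma kappa_antimono: "0 < x \<Longrightarrow> x \<le> y \<Longrightarrow> \<kappa> y \<le> \<kappa> x"
  using slope_le_kappa[of x y] kappa_le_slope[of x y] by (cases "x = y") auto

text \<open>Unboundedness provides some y with a y > a x, and the positive slope from x to y is a
  lower bound for \<kappa> x.\<close>

lemma kappa_pos: assumes "0 < x" shows "0 < \<kappa> x"
proof -
  have "\<forall>\<^sub>F y in at_top. a x < a y"
    using unbounded by (simp add: filterlim_at_top_dense)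
  then obtain y where "a x < a y" by (auto simp: eventually_at_top_linorder)
  then have "x < y" using a_mono[of y x] by (meson leD leI)
  with \<open>a x < a y\<close> have "0 < slope x y" by (simp add: slope_def)
  with slope_le_kappa[OF assms \<open>x < y\<close>] show ?thesis by simp
qed

lemma kappa_increment_pos:
  assumes "0 < x" "x \<le> y" "y \<le> R" shows "\<kappa> R * (y - x) \<le> a y - a x"
proof (cases "x = y")
  case False
  then have "x < y" using assms by simp
  have "\<kappa> R \<le> \<kappa> y" using assms by (intro kappa_antimono) auto
  also have "... \<le> slope x y" using kappa_le_slope assms \<open>x < y\<close> by simp
  finally show ?thesis using \<open>x < y\<close> by (simp add: slope_def field_simps)
qed simp

lemma kappa_increment:
  assumes "0 \<le> x" "x \<le> y" "y \<le> R" "0 < R" shows "\<kappa> R * (y - x) \<le> a y - a x"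
proof (cases "x = 0 \<and> 0 < y")
  case True
  have "\<forall>\<^sub>F s in at_right 0. \<kappa> R * (y - s) \<le> a y - a s"
    unfolding eventually_at_right_field using True assms
    by (intro exI[of _ y]) (auto intro: kappa_increment_pos)
  moreover have "((\<lambda>s. \<kappa> R * (y - s)) \<longlongrightarrow> \<kappa> R * (y - 0)) (at_right 0)"
    by (intro tendsto_intros)
  moreover have "((\<lambda>s. a y - a s) \<longlongrightarrow> a y - a 0) (at_right 0)"
    by (intro tendsto_intros a_lim)
  ultimately have "\<kappa> R * (y - 0) \<le> a y - a 0"
    by (intro tendsto_le[of "at_right (0::real)"]) (auto simp: trivial_limit_at_right_real)
  then show ?thesis using True by simp
next
  case False
  then show ?thesis using assms kappa_increment_pos[of x y R] by (cases "x = 0") auto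
qed

lemma a_strict: assumes "0 \<le> x" "x < y" shows "a x < a y"
proof -
  have "0 < \<kappa> y * (y - x)" using assms kappa_pos[of y] by simp
  then show ?thesis using kappa_increment[of x y y] assms by simp
qed

lemma kappa_le_quotient: "0 < x \<Longrightarrow> \<kappa> x * x \<le> a x"
  using kappa_increment[of 0 x x] a_zero_nonneg by simp

text \<open>a x / x is nonincreasing because \<open>a\<close> is concave with a 0 \<ge> 0; the form
  without division also covers x = 0.\<close>

lemma a_quotient:
  assumes "0 \<le> x" "x \<le> y" shows "x * a y \<le> y * a x"
proof (cases "x = 0 \<or> x = y")
  case False
  then have "0 < x" "x < y" using assms by auto
  have "a y - a x \<le> \<kappa> x * (y - x)"
    using slope_le_kappa[OF \<open>0 < x\<close> \<open>x < y\<close>] \<open>x < y\<close> by (simp add: slope_def field_simps)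
  then have "x * (a y - a x) \<le> (\<kappa> x * x) * (y - x)"
    using mult_left_mono[of "a y - a x" "\<kappa> x * (y - x)" x] assms by (simp add: mult_ac)
  also have "... \<le> a x * (y - x)"
    using kappa_le_quotient[OF \<open>0 < x\<close>] \<open>x < y\<close> by (intro mult_right_mono) auto
  finally show ?thesis by (simp add: algebra_simps)
qed (use assms a_nonneg in auto)

lemma a_subadd: assumes "0 \<le> x" "0 \<le> y" shows "a (x + y) \<le> a x + a y"
proof (cases "x + y = 0")
  case False
  then have "0 < x + y" using assms by simp
  have "(x + y) * a (x + y) \<le> (x + y) * (a x + a y)"
    using a_quotient[of x "x+y"] a_quotient[of y "x+y"] assms by (simp add: algebra_simps)
  with \<open>0 < x + y\<close> show ?thesis by simp
next
  case True
  then have "x = 0" "y = 0" using assms by auto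
  then show ?thesis using a_zero_nonneg by simp
qed

section \<open>Growth of \<tau> and comparison with squares\<close>

lemma tau_upper: assumes "0 \<le> x" "0 \<le> y" shows "\<tau> y - \<tau> x \<le> a y * (y - x)"
proof (cases "y = 0")
  case True
  \<comment> \<open>At 0 no two-sided derivative is available; the tangents at s > 0 are evaluated
    at x, and s tends to 0.\<close>
  have "a 0 * x \<le> \<tau> x" 
  proof (cases "x = 0")
    case False
    then have "0 < x" using assms by simp
    have "\<forall>\<^sub>F s in at_right 0. a s * (x - s) \<le> \<tau> x"
      unfolding eventually_at_right_field
    proof (intro exI[of _ x] conjI allI impI)
      fix s assume "0 < s" "s < x"
      then show "a s * (x - s) \<le> \<tau> x" using tau_tangent[of s x] tau_nonneg[of s] by simp
    qed (rule \<open>0 < x\<close>)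
    moreover have "((\<lambda>s. a s * (x - s)) \<longlongrightarrow> a 0 * (x - 0)) (at_right 0)"
      by (intro tendsto_intros a_lim)
    ultimately have "a 0 * (x - 0) \<le> \<tau> x"
      by (intro tendsto_le[of "at_right (0::real)" "\<lambda>_. \<tau> x"]) (auto simp: trivial_limit_at_right_real)
    then show ?thesis by simp
  qed simp
  then show ?thesis using True by simp
qed (use tau_tangent[of y x] assms in \<open>auto simp: algebra_simps\<close>)

lemma tau_continuous: "continuous_on {0..} \<tau>"
  unfolding continuous_on_eq_continuous_within
proof (rule ballI)
  fix x :: real assume "x \<in> {0..}"
  show "continuous (at x within {0..}) \<tau>"
  proof (cases "x = 0")
    case False
    then have "isCont \<tau> x" using \<open>x \<in> {0..}\<close> tau_deriv[of x] by (intro DERIV_isCont[of _ "a x"]) auto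
    then show ?thesis by (rule continuous_at_imp_continuous_at_within)
  next
    case True
    have "((\<lambda>s. a 1 * s) \<longlongrightarrow> a 1 * 0) (at 0 within {0..})" by (intro tendsto_intros)
    then have l: "((\<lambda>s. a 1 * s) \<longlongrightarrow> 0) (at 0 within {0..})" by simp
    have "(\<tau> \<longlongrightarrow> 0) (at 0 within {0..})"
    proof (rule tendsto_sandwich[OF _ _ tendsto_const l])
      show "\<forall>\<^sub>F s in at 0 within {0..}. 0 \<le> \<tau> s"
        unfolding eventually_at by (intro exI[of _ 1]) (auto intro: tau_nonneg)
      show "\<forall>\<^sub>F s in at 0 within {0..}. \<tau> s \<le> a 1 * s"
        unfolding eventually_at
      proof (intro exI[of _ 1] conjI ballI impI)
        fix s :: real assume s: "s \<in> {0..}" "s \<noteq> 0 \<and> dist s 0 < 1"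
        have "\<tau> s \<le> a s * s" using tau_upper[of 0 s] s by simp
        also have "... \<le> a 1 * s" using s by (intro mult_right_mono a_mono) (auto simp: dist_real_def)
        finally show "\<tau> s \<le> a 1 * s" .
      qed simp
    qed
    then show ?thesis using True by (simp add: continuous_within)
  qed
qed

text \<open>On [0, x] the derivative lies above the chord c * s with c = a x / x, so \<tau> s - c
  s^2 / 2 is nondecreasing there.\<close>

lemma tau_a_half: assumes "0 \<le> x" shows "x * a x \<le> 2 * \<tau> x"
proof (cases "x = 0")
  case False
  then have "0 < x" using assms by simp
  define c where "c = a x / x"
  have "\<tau> 0 - c * 0\<^sup>2 / 2 \<le> \<tau> x - c * x\<^sup>2 / 2"
  proof (rule DERIV_nonneg_imp_increasing_open[where f = "\<lambda>s. \<tau> s - c * s\<^sup>2 / 2"])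
    fix s assume s: "0 < s" "s < x"
    have "c * s \<le> a s" using a_quotient[of s x] s by (simp add: c_def field_simps)
    then show "\<exists>y. ((\<lambda>s. \<tau> s - c * s\<^sup>2 / 2) has_real_derivative y) (at s) \<and> 0 \<le> y"
      by (intro exI[of _ "a s - c * s"]) (auto intro!: derivative_eq_intros tau_deriv s)
  qed (use assms in \<open>auto intro!: continuous_intros continuous_on_subset[OF tau_continuous]\<close>)
  then show ?thesis using \<open>0 < x\<close> by (simp add: c_def power2_eq_square mult.commute)
qed simp

lemma tau_pos: "0 < x \<Longrightarrow> 0 < \<tau> x"
  using tau_a_half[of x] a_pos[of x] mult_pos_pos[of x "a x"] by linarith

lemma tau_strict: assumes "0 \<le> x" "x < y" shows "\<tau> x < \<tau> y"
proof (cases "x = 0")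
  case True then show ?thesis using assms tau_pos[of y] by simp
next
  case False
  then have "0 < a x * (y - x)" using assms a_pos[of x] by simp
  then show ?thesis using tau_tangent[of x y] False assms by simp
qed

text \<open>The derivative of \<tau> y / y^2 has the sign of y a y - 2 \<tau> y, which
  \<open>tau_a_half\<close> controls. Beyond a small s this bounds \<tau> by a multiple of the
  square, which later converts quadratic growth of the excess risk into a rate for \<tau>.\<close>

lemma tau_square_quotient:
  assumes "0 < s" "s \<le> x" shows "s\<^sup>2 * \<tau> x \<le> x\<^sup>2 * \<tau> s"
proof -
  have "\<tau> x / x\<^sup>2 \<le> \<tau> s / s\<^sup>2"
  proof (rule DERIV_nonpos_imp_nonincreasing[where f = "\<lambda>y. \<tau> y / y\<^sup>2", OF assms(2)])
    fix y assume y: "s \<le> y" "y \<le> x"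
    then have y0: "0 < y" using assms by simp
    have "((\<lambda>y. \<tau> y / y\<^sup>2) has_real_derivative (a y * y\<^sup>2 - \<tau> y * (2 * y)) / (y\<^sup>2 * y\<^sup>2)) (at y)"
      using y0 by (auto intro!: derivative_eq_intros tau_deriv)
    moreover have "a y * y\<^sup>2 - \<tau> y * (2 * y) = y * (y * a y - 2 * \<tau> y)"
      by (simp add: algebra_simps power2_eq_square)
    then have "a y * y\<^sup>2 - \<tau> y * (2 * y) \<le> 0"
      using tau_a_half[of y] y0 by (simp add: mult_nonneg_nonpos)
    ultimately show "\<exists>z. ((\<lambda>y. \<tau> y / y\<^sup>2) has_real_derivative z) (at y) \<and> z \<le> 0"
      using y0 by (intro exI[of _ "(a y * y\<^sup>2 - \<tau> y * (2 * y)) / (y\<^sup>2 * y\<^sup>2)"]) (simp add: divide_nonpos_pos)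
  qed
  then show ?thesis using assms by (simp add: field_simps)
qed

text \<open>Convexity and \<tau> 0 = 0. It moves a constant factor inside \<tau>, so that a bound on
  the expectation of \<tau> survives the application of the inverse of \<tau>.\<close>

lemma tau_scale: assumes "0 \<le> x" "1 \<le> c" shows "c * \<tau> x \<le> \<tau> (c * x)"
proof (cases "x = 0")
  case False
  then have x: "0 < x" using assms by simp
  have "a x * (c * x - x) \<le> \<tau> (c * x) - \<tau> x" using x assms by (intro tau_tangent) auto
  moreover have "(c - 1) * \<tau> x \<le> (c - 1) * (a x * x)"
    using tau_upper[of 0 x] assms x by (intro mult_left_mono) auto
  ultimately show ?thesis by (simp add: algebra_simps)
qed simp

text \<open>The second difference vanishes at s = 0, and its derivative a (v + t) - a (v - t) is at
  least 2 c t by the hypothesis on increments.\<close>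

lemma tau_half_sum:
  assumes "0 \<le> v - s" "0 \<le> s" "v + s \<le> R" "0 \<le> c"
    and c: "\<And>x y. 0 < x \<Longrightarrow> x \<le> y \<Longrightarrow> y \<le> R \<Longrightarrow> c * (y - x) \<le> a y - a x"
  shows "c * s\<^sup>2 \<le> \<tau> (v + s) + \<tau> (v - s) - 2 * \<tau> v"
proof -
  have "\<tau> (v + 0) + \<tau> (v - 0) - 2 * \<tau> v - c * 0\<^sup>2 \<le> \<tau> (v + s) + \<tau> (v - s) - 2 * \<tau> v - c * s\<^sup>2"
  proof (rule DERIV_nonneg_imp_increasing_open
      [where f = "\<lambda>t. \<tau> (v + t) + \<tau> (v - t) - 2 * \<tau> v - c * t\<^sup>2", OF assms(2)])
    fix t assume t: "0 < t" "t < s"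
    have d1: "((\<lambda>t. \<tau> (v + t)) has_real_derivative a (v + t) * (0 + 1)) (at t)"
      by (rule DERIV_chain2[OF tau_deriv]) (use t assms in \<open>auto intro!: derivative_eq_intros\<close>)
    have d2: "((\<lambda>t. \<tau> (v - t)) has_real_derivative a (v - t) * (0 - 1)) (at t)"
      by (rule DERIV_chain2[OF tau_deriv]) (use t assms in \<open>auto intro!: derivative_eq_intros\<close>)
    have d3: "((\<lambda>t. c * t\<^sup>2) has_real_derivative c * (2 * t)) (at t)"
      by (auto intro!: derivative_eq_intros)
    have "((\<lambda>t. \<tau> (v + t) + \<tau> (v - t) - 2 * \<tau> v - c * t\<^sup>2) has_real_derivative
        a (v + t) * (0 + 1) + a (v - t) * (0 - 1) - 0 - c * (2 * t)) (at t)"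
      by (rule DERIV_diff[OF DERIV_diff[OF DERIV_add[OF d1 d2] DERIV_const] d3])
    then have "((\<lambda>t. \<tau> (v + t) + \<tau> (v - t) - 2 * \<tau> v - c * t\<^sup>2) has_real_derivative
        a (v + t) - a (v - t) - c * (2 * t)) (at t)"
      by simp
    moreover have "c * (2 * t) \<le> a (v + t) - a (v - t)"
    proof -
      have "v + t - (v - t) = 2 * t" by simp
      moreover have "0 < v - t" "v - t \<le> v + t" "v + t \<le> R" using t assms by auto
      ultimately show ?thesis using c[of "v - t" "v + t"] by simp
    qed
    ultimately show "\<exists>y. ((\<lambda>t. \<tau> (v + t) + \<tau> (v - t) - 2 * \<tau> v - c * t\<^sup>2) has_real_derivative y) (at t) \<and> 0 \<le> y"
      by (intro exI[of _ "a (v + t) - a (v - t) - c * (2 * t)"]) simp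
  qed (use assms in \<open>auto intro!: continuous_intros continuous_on_compose2[OF tau_continuous]\<close>)
  then show ?thesis by simp
qed

lemma tau_diff_lower:
  assumes "0 \<le> u" "u \<le> v" "v \<le> R" 
    and c: "\<And>x. 0 < x \<Longrightarrow> x \<le> R \<Longrightarrow> c * x \<le> a x"
  shows "c * (v\<^sup>2 - u\<^sup>2) / 2 \<le> \<tau> v - \<tau> u"
proof -
  have "\<tau> u - c * u\<^sup>2 / 2 \<le> \<tau> v - c * v\<^sup>2 / 2"
  proof (rule DERIV_nonneg_imp_increasing_open[where f = "\<lambda>s. \<tau> s - c * s\<^sup>2 / 2", OF assms(2)])
    fix s assume s: "u < s" "s < v"
    then have s0: "0 < s" using assms by simp
    show "\<exists>y. ((\<lambda>s. \<tau> s - c * s\<^sup>2 / 2) has_real_derivative y) (at s) \<and> 0 \<le> y"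
      using c[OF s0] s assms
      by (intro exI[of _ "a s - c * s"]) (auto intro!: derivative_eq_intros tau_deriv s0)
  qed (use assms in \<open>auto intro!: continuous_intros continuous_on_subset[OF tau_continuous]\<close>)
  then show ?thesis by (simp add: algebra_simps diff_divide_distrib)
qed

text \<open>A modulus of strong monotonicity of \<open>a\<close> on [0, R]. As a predicate it admits
  the weight 0 for every R, which stands for an observation whose modulus is not exploited.\<close>

definition lower_slope :: "real \<Rightarrow> real \<Rightarrow> bool" where
  "lower_slope R c \<longleftrightarrow> 0 \<le> c \<and> (\<forall>x y. 0 \<le> x \<longrightarrow> x \<le> y \<longrightarrow> y \<le> R \<longrightarrow> c * (y - x) \<le> a y - a x)"

lemma lower_slope_0: "lower_slope R 0"
  by (simp add: lower_slope_def a_mono)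

lemma lower_slope_kappa: "0 < R \<Longrightarrow> lower_slope R (\<kappa> R)"
  using kappa_pos[of R] by (auto simp: lower_slope_def intro: kappa_increment)

text \<open>
  On \<open>[0,R]\<close> the function \<open>\<tau> x - c x\<^sup>2 / 2\<close> is convex and nondecreasing, and for the remaining
  quadratic part the claim is the defining inequality of a Hadamard space.
\<close>

lemma tau_midpoint:
  assumes "0 \<le> u" "0 \<le> x" "0 \<le> y" "x \<le> R" "y \<le> R" "lower_slope R c"
    and u: "u\<^sup>2 \<le> x\<^sup>2 / 2 + y\<^sup>2 / 2 - \<delta>\<^sup>2 / 4" and "\<bar>x - y\<bar> \<le> \<delta>"
  shows "\<tau> u \<le> \<tau> x / 2 + \<tau> y / 2 - c * \<delta>\<^sup>2 / 8" and "u \<le> (x + y) / 2"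
proof -
  define v s where "v = (x + y) / 2" and "s = \<bar>x - y\<bar> / 2"
  have c: "0 \<le> c" "\<And>x y. 0 \<le> x \<Longrightarrow> x \<le> y \<Longrightarrow> y \<le> R \<Longrightarrow> c * (y - x) \<le> a y - a x"
    using assms by (auto simp: lower_slope_def)
  have "\<bar>x - y\<bar>\<^sup>2 \<le> \<delta>\<^sup>2" using assms by (intro power_mono) auto
  then have s2: "s\<^sup>2 \<le> \<delta>\<^sup>2 / 4" by (simp add: s_def power_divide)
  have vs: "v\<^sup>2 + s\<^sup>2 = x\<^sup>2 / 2 + y\<^sup>2 / 2"
    by (simp add: v_def s_def power_divide power2_eq_square field_simps)
  have "u\<^sup>2 \<le> v\<^sup>2" using u vs s2 by simp
  then have uv: "u \<le> v" using assms by (intro power2_le_imp_le[of u v]) (auto simp: v_def)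
  then show "u \<le> (x + y) / 2" by (simp add: v_def)
  have "c * s\<^sup>2 \<le> \<tau> (v + s) + \<tau> (v - s) - 2 * \<tau> v"
    by (rule tau_half_sum[where R = R]) (use assms c in \<open>auto simp: v_def s_def abs_real_def field_simps\<close>)
  moreover have "\<tau> (v + s) + \<tau> (v - s) = \<tau> x + \<tau> y"
    by (cases "x \<le> y") (auto simp: v_def s_def field_simps)
  moreover have "c * (v\<^sup>2 - u\<^sup>2) / 2 \<le> \<tau> v - \<tau> u"
  proof (rule tau_diff_lower[where R = R])
    fix x :: real assume "0 < x" "x \<le> R"
    then show "c * x \<le> a x" using c(2)[of 0 x] a_zero_nonneg by simp
  qed (use assms uv in \<open>auto simp: v_def\<close>)
  \<comment> \<open>The gains c s^2 / 2 and c (v^2 - u^2) / 2 of the two comparisons add up to at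
    least c \<delta>^2 / 8, since u^2 \<le> v^2 + s^2 - \<delta>^2 / 4.\<close>
  moreover have "c * \<delta>\<^sup>2 / 4 \<le> c * (v\<^sup>2 - u\<^sup>2 + s\<^sup>2)"
    using c(1) u vs mult_left_mono[of "\<delta>\<^sup>2 / 4" "v\<^sup>2 - u\<^sup>2 + s\<^sup>2" c] by simp
  ultimately show "\<tau> u \<le> \<tau> x / 2 + \<tau> y / 2 - c * \<delta>\<^sup>2 / 8"
    by (simp add: algebra_simps diff_divide_distrib add_divide_distrib)
qed

end

section \<open>Geometry of transformed distances\<close>

lemma hadamard_midpoint:
  fixes p q :: "'a::hadamard_space"
  obtains u where "\<And>z. (dist z u)\<^sup>2 \<le> (dist z p)\<^sup>2 / 2 + (dist z q)\<^sup>2 / 2 - (dist p q)\<^sup>2 / 4"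
  using hadamard[of p q] by (metis dist_commute)

lemma ennreal_inverse_antimono: "x \<le> y \<Longrightarrow> inverse y \<le> inverse (x::ennreal)"
proof (cases "x = 0 \<or> y = top")
  case False
  assume "x \<le> y"
  with False show ?thesis
    by (cases x; cases y) (auto simp: inverse_ennreal top_unique intro!: ennreal_leI le_imp_inverse_le)
qed auto

context transform
begin

section \<open>The functions g and h and the inverse of \<tau>'\<close>

lemma rdtau_pos: "0 < x \<Longrightarrow> rdtau \<tau> x = ennreal (\<kappa> x)"
  by (simp add: rdtau_def \<kappa>_def)

text \<open>\<kappa> is nonincreasing on the positive reals, so the \<open>Lim\<close> in
  \<open>rdtau\<close> is a genuine limit in [0, \<infinity>], namely a supremum.\<close>

lemma rdtau_nonpos: assumes "x \<le> 0" shows "rdtau \<tau> x = (SUP s\<in>{0<..}. ennreal (\<kappa> s))"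
proof -
  define l where "l = (SUP s\<in>{0<..}. ennreal (\<kappa> s))"
  have le: "ennreal (\<kappa> s) \<le> l" if "0 < s" for s
    unfolding l_def using that by (intro SUP_upper) auto
  have "((\<lambda>s. ennreal (\<kappa> s)) \<longlongrightarrow> l) (at_right 0)"
  proof (rule order_tendstoI)
    fix u assume "l < u"
    then show "\<forall>\<^sub>F s in at_right 0. ennreal (\<kappa> s) < u"
      unfolding eventually_at_right_field using le by (intro exI[of _ 1]) (auto intro: le_less_trans)
  next
    fix u assume "u < l"
    then obtain s0 where s0: "0 < s0" "u < ennreal (\<kappa> s0)"
      unfolding l_def by (auto simp: less_SUP_iff)
    then show "\<forall>\<^sub>F s in at_right 0. u < ennreal (\<kappa> s)"
      unfolding eventually_at_right_field
      by (intro exI[of _ s0]) (auto intro!: less_le_trans[OF s0(2)] ennreal_leI kappa_antimono)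
  qed
  then have "Lim (at_right 0) (\<lambda>s. ennreal (\<kappa> s)) = l"
    by (intro tendsto_Lim) (auto simp: trivial_limit_at_right_real)
  then show ?thesis using assms by (simp add: rdtau_def \<kappa>_def l_def)
qed

lemma rdtau_antimono: "x \<le> y \<Longrightarrow> rdtau \<tau> y \<le> rdtau \<tau> x"
  by (cases "0 < x"; cases "0 < y")
     (auto simp: rdtau_pos rdtau_nonpos intro!: ennreal_leI kappa_antimono SUP_upper)

lemma rdtau_gt_0: "0 < rdtau \<tau> x"
proof -
  have "0 < rdtau \<tau> (max x 1)" using kappa_pos[of "max x 1"] by (simp add: rdtau_pos)
  also have "... \<le> rdtau \<tau> x" by (rule rdtau_antimono) simp
  finally show ?thesis .
qed

abbreviation g :: "real \<Rightarrow> real" where "g \<equiv> g_fun \<tau>"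
abbreviation h :: "real \<Rightarrow> real" where "h \<equiv> h_fun \<tau>"
abbreviation inv_a :: "real \<Rightarrow> real" where "inv_a \<equiv> inv_dtau \<tau>"

lemma g_eq: "0 < x \<Longrightarrow> g x = 1 / \<kappa> (7 * x)"
  using kappa_pos[of "7 * x"] by (simp add: g_fun_def rdtau_pos inverse_ennreal divide_inverse)

lemma g_nonneg: "0 \<le> g x"
  by (simp add: g_fun_def)

lemma g_pos: "0 < x \<Longrightarrow> 0 < g x"
  using kappa_pos[of "7 * x"] by (simp add: g_eq)

lemma g_mono: assumes "x \<le> y" shows "g x \<le> g y"
proof -
  have "inverse (rdtau \<tau> (7 * x)) \<le> inverse (rdtau \<tau> (7 * y))"
    using assms by (intro ennreal_inverse_antimono rdtau_antimono) auto
  moreover have "inverse (rdtau \<tau> (7 * y)) < top"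
    using rdtau_gt_0[of "7 * y"] by (simp add: less_top[symmetric] ennreal_inverse_eq_top_iff)
  ultimately show ?thesis unfolding g_fun_def by (rule enn2real_mono)
qed

lemma measurable_g [measurable]: "g \<in> borel_measurable borel"
  by (intro borel_measurable_mono monoI g_mono)

lemma measurable_tau [measurable]: "(\<lambda>x. \<tau> \<bar>x\<bar>) \<in> borel_measurable borel"
  by (intro borel_measurable_continuous_onI continuous_on_compose2[OF tau_continuous] continuous_intros) auto

text \<open>Intermediate values: concavity makes \<open>a\<close> continuous on the open half line,
  and \<open>a_lim\<close> gives continuity at 0.\<close>

lemma a_surj: assumes "a 0 \<le> y" shows "\<exists>x\<ge>0. a x = y"
proof -
  have "\<forall>\<^sub>F x in at_top. y < a x" using unbounded by (simp add: filterlim_at_top_dense)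
  then obtain B where B: "0 < B" "y < a B"
    by (metis eventually_at_top_linorder less_le_trans max.cobounded1 max.cobounded2 zero_less_one)
  have "concave_on {0<..} (deriv \<tau>)" using S0 by (auto simp: S0_plus_def)
  then have "continuous_on {0<..} (\<lambda>x. - deriv \<tau> x)"
    by (intro convex_on_continuous) (auto simp: concave_on_def)
  then have "continuous_on {0<..} (\<lambda>x. - (- deriv \<tau> x))" by (rule continuous_on_minus)
  then have c: "continuous_on {0<..} a"
    by (rule continuous_on_eq) (auto simp: dtau_def)
  have "continuous_on {0..B} a"
    unfolding continuous_on_eq_continuous_within
  proof
    fix x assume x: "x \<in> {0..B}"
    show "continuous (at x within {0..B}) a"
    proof (cases "x = 0")
      case True
      have "at 0 within {0..B} = at_right 0" using B(1) by (rule at_within_Icc_at_right)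
      then show ?thesis using a_lim True by (simp add: continuous_within)
    next
      case False
      then have "isCont a x" using c x by (intro continuous_on_interior[OF c]) (auto simp: interior_open)
      then show ?thesis by (rule continuous_at_imp_continuous_at_within)
    qed
  qed
  then show ?thesis using IVT'[of a 0 y B] assms B by auto
qed

lemma inj_a: "inj_on a {0..}"
proof (rule linorder_inj_onI)
  fix x y :: real assume "x < y" "x \<in> {0..}" "y \<in> {0..}"
  then have "a x < a y" by (intro a_strict) auto
  then show "a x \<noteq> a y" by simp
qed auto

lemma inv_a_a: "0 \<le> x \<Longrightarrow> inv_a (a x) = x"
  using a_mono[of 0 x] the_inv_into_f_f[OF inj_a, of x] by (simp add: inv_dtau_def)

lemma a_inv_a: "a 0 \<le> y \<Longrightarrow> a (inv_a y) = y"
  using a_surj[of y] inv_a_a by auto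

lemma inv_a_nonneg: "0 \<le> inv_a y"
proof (cases "y < a 0")
  case False
  then obtain x where "0 \<le> x" "a x = y" using a_surj[of y] by auto
  then show ?thesis using inv_a_a by auto
qed (simp add: inv_dtau_def)

text \<open>Together with \<open>inv_a_le\<close> this is the Galois connection between
  \<open>a\<close> and its inverse; the value 0 of the inverse below a 0 makes the other half hold
  for all y.\<close>

lemma le_inv_a: assumes "a x \<le> y" "0 \<le> x" shows "x \<le> inv_a y"
proof (rule ccontr)
  assume "\<not> x \<le> inv_a y"
  then have "a (inv_a y) < a x" using a_strict inv_a_nonneg by simp
  moreover have "a 0 \<le> y" using assms a_mono[of 0 x] by simp
  ultimately show False using a_inv_a[of y] assms by simp
qed

lemma inv_a_le: assumes "y \<le> a x" "0 \<le> x" shows "inv_a y \<le> x"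
proof (cases "y < a 0")
  case False
  then have "a (inv_a y) = y" by (simp add: a_inv_a)
  show ?thesis
  proof (rule ccontr)
    assume "\<not> inv_a y \<le> x"
    then have "a x < a (inv_a y)" using a_strict assms by simp
    then show False using \<open>a (inv_a y) = y\<close> assms by simp
  qed
qed (use assms in \<open>simp add: inv_dtau_def\<close>)

lemma inv_a_mono: assumes "x \<le> y" shows "inv_a x \<le> inv_a y"
proof (cases "y < a 0")
  case False
  then have "a (inv_a y) = y" by (simp add: a_inv_a)
  then show ?thesis using assms inv_a_nonneg[of y] by (intro inv_a_le) auto
qed (use assms in \<open>simp add: inv_dtau_def\<close>)

lemma h_nonneg: "0 \<le> h x"
  by (simp add: h_fun_def g_nonneg)

lemma h_mono: "x \<le> y \<Longrightarrow> h x \<le> h y"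
  unfolding h_fun_def by (intro g_mono inv_a_mono) auto

lemma measurable_h [measurable]: "h \<in> borel_measurable borel"
  by (intro borel_measurable_mono monoI h_mono)

lemma g_le_h: "0 \<le> x \<Longrightarrow> a x \<le> 12 * y \<Longrightarrow> g x \<le> h y"
  unfolding h_fun_def by (intro g_mono le_inv_a)

lemma g_le_h_a: "0 \<le> x \<Longrightarrow> g x \<le> h (a x)"
  using a_nonneg[of x] by (intro g_le_h) auto

text \<open>The larger of s and t absorbs the other: 4 (s + t) is at most 8 t or 8 s, within the
  range 12 t or 24 s allowed by the factor 12 in \<open>h\<close>. This separates an average s from
  the contribution t of one observation.\<close>

lemma g_le_h_sum:
  assumes "0 \<le> x" "a x \<le> 4 * (s + t)" "0 \<le> s" "0 \<le> t" shows "g x \<le> h (2 * s) + h t"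
proof (cases "s \<le> t")
  case True
  then have "g x \<le> h t" using assms by (intro g_le_h) auto
  then show ?thesis using h_nonneg[of "2 * s"] by simp
next
  case False
  then have "g x \<le> h (2 * s)" using assms by (intro g_le_h) auto
  then show ?thesis using h_nonneg[of t] by simp
qed

text \<open>An infinite right derivative at 0 makes g s small for some s > 0. Eventually 12 c / n <
  a s, so the inverse at 12 c / n is at most s, also when a 0 > 0.\<close>

lemma h_tendsto_0:
  assumes "(rdtau \<tau> \<longlongrightarrow> \<infinity>) (at_right 0)" "0 \<le> c"
  shows "(\<lambda>n. h (c / real n)) \<longlonglongrightarrow> 0"
proof (rule order_tendstoI)
  fix e :: real assume "e < 0"
  then show "\<forall>\<^sub>F n in sequentially. e < h (c / real n)"
    by (intro always_eventually) (auto intro: less_le_trans[OF _ h_nonneg])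
next
  fix e :: real assume "0 < e"
  have "\<forall>\<^sub>F s in at_right 0. ennreal (1 / e) < rdtau \<tau> s"
    using assms(1) by (intro order_tendstoD) auto
  then obtain b where b: "0 < b" "\<And>s. 0 < s \<Longrightarrow> s < b \<Longrightarrow> ennreal (1 / e) < rdtau \<tau> s"
    unfolding eventually_at_right_field by auto
  define s where "s = b / 14"
  have s: "0 < s" "7 * s < b" using b by (auto simp: s_def)
  then have "ennreal (1 / e) < ennreal (\<kappa> (7 * s))" using b(2)[of "7 * s"] by (simp add: rdtau_pos)
  then have "1 / e < \<kappa> (7 * s)" using \<open>0 < e\<close> by (simp add: ennreal_less_iff)
  then have gs: "g s < e" using s \<open>0 < e\<close> kappa_pos[of "7 * s"] by (simp add: g_eq field_simps)
  have "(\<lambda>n. 12 * (c / real n)) \<longlonglongrightarrow> 12 * 0"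
    by (intro tendsto_intros lim_const_over_n)
  then have "\<forall>\<^sub>F n in sequentially. 12 * (c / real n) < a s"
    using a_pos[OF s(1)] by (intro order_tendstoD) auto
  then show "\<forall>\<^sub>F n in sequentially. h (c / real n) < e"
  proof eventually_elim
    case (elim n)
    then have "inv_a (12 * (c / real n)) \<le> s" using s by (intro inv_a_le) auto
    then have "h (c / real n) \<le> g s" unfolding h_fun_def by (rule g_mono)
    with gs show ?case by simp
  qed
qed

text \<open>The distance from y to q is at least |D - d|, and returning from there to D or d costs
  first-order terms. If d \<le> D, a cost a D * d arises, which \<open>a_quotient\<close> turns into
  D * a d. So the loss is linear in the integrable quantity a (dist y m).\<close>

lemma tau_triangle_lower:
  fixes y m q :: "'b::metric_space"
  shows "\<tau> (dist m q) - 2 * dist m q * a (dist y m) \<le> \<tau> (dist y q) - \<tau> (dist y m)"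
proof -
  define d D where "d = dist y m" and "D = dist m q"
  have nn: "0 \<le> d" "0 \<le> D" by (auto simp: d_def D_def)
  have tri: "D - d \<le> dist y q" "d - D \<le> dist y q"
    unfolding d_def D_def
    using dist_triangle[of m q y] dist_triangle[of y m q] by (auto simp: dist_commute)
  show ?thesis
  proof (cases "d \<le> D")
    case True
    have "\<tau> D - \<tau> (D - d) \<le> a D * d" using tau_upper[of "D - d" D] True nn by simp
    also have "... \<le> D * a d" using a_quotient[of d D] True nn by (simp add: mult.commute)
    finally have "\<tau> D - \<tau> (D - d) \<le> D * a d" .
    moreover have "\<tau> d \<le> a d * d" using tau_upper[of 0 d] nn by simp
    moreover have "a d * d \<le> D * a d" using True a_nonneg[of d] by (simp add: mult.commute mult_right_mono)
    moreover have "\<tau> (D - d) \<le> \<tau> (dist y q)" using tri True by (intro tau_mono) auto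
    ultimately show ?thesis by (simp add: d_def D_def)
  next
    case False
    have "\<tau> d - \<tau> (d - D) \<le> a d * D" using tau_upper[of "d - D" d] False nn by simp
    moreover have "\<tau> D \<le> a D * D" using tau_upper[of 0 D] nn by simp
    moreover have "a D * D \<le> a d * D" using False nn by (intro mult_right_mono a_mono) auto
    moreover have "\<tau> (d - D) \<le> \<tau> (dist y q)" using tri False by (intro tau_mono) auto
    ultimately show ?thesis unfolding d_def D_def by (simp add: algebra_simps)
  qed
qed

lemma tau_dist_diff:
  fixes y p q m :: "'b::metric_space"
  shows "\<tau> (dist y q) - \<tau> (dist y p) \<le> dist p q * (a (dist y m) + a (dist m q))"
proof -
  have "\<tau> (dist y q) - \<tau> (dist y p) \<le> a (dist y q) * (dist y q - dist y p)"
    by (rule tau_upper) auto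
  also have "... \<le> a (dist y q) * dist p q"
    using dist_triangle[of y q p] by (intro mult_left_mono a_nonneg) simp
  also have "... \<le> (a (dist y m) + a (dist m q)) * dist p q"
  proof (intro mult_right_mono)
    have "a (dist y q) \<le> a (dist y m + dist m q)" by (rule a_mono) (rule dist_triangle)
    also have "... \<le> a (dist y m) + a (dist m q)" by (rule a_subadd) auto
    finally show "a (dist y q) \<le> a (dist y m) + a (dist m q)" .
  qed simp
  finally show ?thesis by (simp add: mult.commute)
qed

lemma tau_dist_diff_abs:
  fixes y q m :: "'b::metric_space"
  shows "\<bar>\<tau> (dist y q) - \<tau> (dist y m)\<bar> \<le> dist m q * (a (dist y m) + a (dist m q))"
proof -
  have "\<tau> (dist y m) - \<tau> (dist y q) \<le> dist q m * (a (dist y m) + a (dist m m))"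
    by (rule tau_dist_diff)
  moreover have "... \<le> dist m q * (a (dist y m) + a (dist m q))"
    by (simp add: dist_commute mult_left_mono a_mono)
  ultimately have "\<tau> (dist y m) - \<tau> (dist y q) \<le> dist m q * (a (dist y m) + a (dist m q))"
    by linarith
  then show ?thesis using tau_dist_diff[of y q m m] by linarith
qed

text \<open>Halving the distance to the minimizer repeatedly turns the midpoint gain into the full constant.\<close>

lemma argmin_growth:
  fixes L :: "'b::hadamard_space \<Rightarrow> real"
  assumes min: "\<And>q. L p \<le> L q" and "P q"
    and step: "\<And>q u. P q \<Longrightarrow> (\<And>z. (dist z u)\<^sup>2 \<le> (dist z p)\<^sup>2 / 2 + (dist z q)\<^sup>2 / 2 - (dist p q)\<^sup>2 / 4) \<Longrightarrow>
       P u \<and> L u \<le> L p / 2 + L q / 2 - W * (dist p q)\<^sup>2 / 8"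
    and "0 \<le> W"
  shows "W * (dist p q)\<^sup>2 / 2 \<le> L q - L p"
proof -
  have *: "(1 - (1 / 2) ^ k) * (W * (dist p q)\<^sup>2 / 2) \<le> L q - L p" if "P q" for k q
    using that
  proof (induction k arbitrary: q)
    case 0
    then show ?case using min by simp
  next
    case (Suc k)
    obtain u where u: "\<And>z. (dist z u)\<^sup>2 \<le> (dist z p)\<^sup>2 / 2 + (dist z q)\<^sup>2 / 2 - (dist p q)\<^sup>2 / 4"
      by (rule hadamard_midpoint[of p q]) blast
    have "P u" and Lu: "L u \<le> L p / 2 + L q / 2 - W * (dist p q)\<^sup>2 / 8"
      using step[OF \<open>P q\<close> u] by auto
    \<comment> \<open>The midpoint inequality at z = q puts u at most half way from q, hence at
      least half way from p.\<close>
    have "(dist q u)\<^sup>2 \<le> (dist p q / 2)\<^sup>2"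
      using u[of q] by (simp add: dist_commute power_divide)
    then have "dist q u \<le> dist p q / 2" by (rule power2_le_imp_le) simp
    then have "dist p q / 2 \<le> dist p u" using dist_triangle[of p q u] by (simp add: dist_commute)
    then have "(dist p q / 2)\<^sup>2 \<le> (dist p u)\<^sup>2" by (intro power_mono) auto
    then have du: "(dist p q)\<^sup>2 / 4 \<le> (dist p u)\<^sup>2" by (simp add: power_divide)
    define t :: real where "t = (1 / 2) ^ k"
    have t: "t \<le> 1" by (simp add: t_def power_le_one)
    have "(1 - t) * (W * ((dist p q)\<^sup>2 / 4) / 2) \<le> (1 - t) * (W * (dist p u)\<^sup>2 / 2)"
      using du t \<open>0 \<le> W\<close> by (intro mult_left_mono divide_right_mono) auto
    also have "... \<le> L u - L p" using Suc.IH[OF \<open>P u\<close>] by (simp add: t_def)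
    finally have "(1 - t) * (W * ((dist p q)\<^sup>2 / 4) / 2) \<le> L u - L p" .
    moreover define c where "c = W * (dist p q)\<^sup>2"
    ultimately have "(1 - t) * (c / 8) \<le> L u - L p" by (simp add: mult_ac)
    \<comment> \<open>The midpoint bound reads L q - L p \<ge> 2 (L u - L p) + c / 4, so the defect
      t from the full constant is halved.\<close>
    with Lu have "(1 - t / 2) * (c / 2) \<le> L q - L p"
      unfolding c_def[symmetric] by (simp add: field_simps)
    then show ?case by (simp add: t_def c_def)
  qed
  have "(\<lambda>k. (1 - (1 / 2) ^ k) * (W * (dist p q)\<^sup>2 / 2)) \<longlonglongrightarrow> (1 - 0) * (W * (dist p q)\<^sup>2 / 2)"
    by (intro tendsto_intros LIMSEQ_realpow_zero) auto
  then have "(1 - 0) * (W * (dist p q)\<^sup>2 / 2) \<le> L q - L p"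
    using *[OF \<open>P q\<close>] by (intro LIMSEQ_le_const2) auto
  then show ?thesis by simp
qed

lemma tau_dist_midpoint:
  fixes p q u y :: "'b::hadamard_space"
  assumes u: "\<And>z. (dist z u)\<^sup>2 \<le> (dist z p)\<^sup>2 / 2 + (dist z q)\<^sup>2 / 2 - (dist p q)\<^sup>2 / 4"
    and "dist y p \<le> R" "dist y q \<le> R" "lower_slope R c"
  shows "\<tau> (dist y u) \<le> \<tau> (dist y p) / 2 + \<tau> (dist y q) / 2 - c * (dist p q)\<^sup>2 / 8"
    and "dist y u \<le> R"
proof -
  have "\<bar>dist y p - dist y q\<bar> \<le> dist p q" by (metis abs_dist_diff_le dist_commute)
  then show "\<tau> (dist y u) \<le> \<tau> (dist y p) / 2 + \<tau> (dist y q) / 2 - c * (dist p q)\<^sup>2 / 8"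
    using assms by (intro tau_midpoint(1)[where R = R]) auto
  have "dist y u \<le> (dist y p + dist y q) / 2"
    by (rule tau_midpoint(2)[where R = R and c = c and \<delta> = "dist p q"])
       (use assms u[of y] \<open>\<bar>dist y p - dist y q\<bar> \<le> dist p q\<close> in auto)
  then show "dist y u \<le> R" using assms by simp
qed

text \<open>Each point keeps its own radius R j and weight w j. The set of q within all radii is
  closed under midpoints with p, so the halving never leaves the range where the weights are
  valid.\<close>

lemma sum_argmin_growth:
  fixes x :: "'i \<Rightarrow> 'b::hadamard_space"
  assumes "\<And>q. (\<Sum>j\<in>J. \<tau> (dist (x j) p)) \<le> (\<Sum>j\<in>J. \<tau> (dist (x j) q))"
    and "\<And>j. j \<in> J \<Longrightarrow> dist (x j) p \<le> R j" "\<And>j. j \<in> J \<Longrightarrow> dist (x j) q \<le> R j"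
    and "\<And>j. j \<in> J \<Longrightarrow> lower_slope (R j) (w j)"
  shows "(\<Sum>j\<in>J. w j) * (dist p q)\<^sup>2 / 2 \<le> (\<Sum>j\<in>J. \<tau> (dist (x j) q)) - (\<Sum>j\<in>J. \<tau> (dist (x j) p))"
proof (rule argmin_growth[where P = "\<lambda>q. \<forall>j\<in>J. dist (x j) q \<le> R j"])
  fix q u
  assume q: "\<forall>j\<in>J. dist (x j) q \<le> R j"
    and u: "\<And>z. (dist z u)\<^sup>2 \<le> (dist z p)\<^sup>2 / 2 + (dist z q)\<^sup>2 / 2 - (dist p q)\<^sup>2 / 4"
  note mid = tau_dist_midpoint[OF u assms(2) _ assms(4)]
  have "(\<Sum>j\<in>J. \<tau> (dist (x j) u)) \<le> (\<Sum>j\<in>J. \<tau> (dist (x j) p) / 2 + \<tau> (dist (x j) q) / 2 - w j * (dist p q)\<^sup>2 / 8)"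
    using mid(1) q by (intro sum_mono) auto
  also have "... = (\<Sum>j\<in>J. \<tau> (dist (x j) p)) / 2 + (\<Sum>j\<in>J. \<tau> (dist (x j) q)) / 2 - (\<Sum>j\<in>J. w j) * (dist p q)\<^sup>2 / 8"
    by (simp add: sum_subtractf sum.distrib sum_divide_distrib sum_distrib_right)
  finally show "(\<forall>j\<in>J. dist (x j) u \<le> R j) \<and> (\<Sum>j\<in>J. \<tau> (dist (x j) u)) \<le> (\<Sum>j\<in>J. \<tau> (dist (x j) p)) / 2 + (\<Sum>j\<in>J. \<tau> (dist (x j) q)) / 2 - (\<Sum>j\<in>J. w j) * (dist p q)\<^sup>2 / 8"
    using mid(2) q by auto
qed (use assms in \<open>auto simp: lower_slope_def intro: sum_nonneg\<close>)

text \<open>Summing \<open>tau_triangle_lower\<close> bounds card J * \<tau> D by 2 D times the sum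
  of \<open>a\<close>; D a D \<le> 2 \<tau> D then makes the constant 4.\<close>

lemma a_empirical:
  fixes x :: "'i \<Rightarrow> 'b::metric_space"
  assumes "finite J" and "(\<Sum>j\<in>J. \<tau> (dist (x j) p)) \<le> (\<Sum>j\<in>J. \<tau> (dist (x j) m))"
  shows "real (card J) * a (dist m p) \<le> 4 * (\<Sum>j\<in>J. a (dist (x j) m))"
proof (cases "dist m p = 0")
  case True
  have "real (card J) * a 0 = (\<Sum>j\<in>J. a 0)" by simp
  also have "... \<le> (\<Sum>j\<in>J. a (dist (x j) m))" by (intro sum_mono a_mono) auto
  also have "... \<le> 4 * (\<Sum>j\<in>J. a (dist (x j) m))" by (simp add: sum_nonneg a_nonneg)
  finally show ?thesis using True by simp
next
  case False
  define D where "D = dist m p"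
  have D: "0 < D" using False by (simp add: D_def)
  have "(\<Sum>j\<in>J. \<tau> D - 2 * D * a (dist (x j) m)) \<le> (\<Sum>j\<in>J. \<tau> (dist (x j) p) - \<tau> (dist (x j) m))"
    unfolding D_def by (intro sum_mono tau_triangle_lower)
  also have "... \<le> 0" using assms by (simp add: sum_subtractf)
  finally have "real (card J) * \<tau> D \<le> 2 * D * (\<Sum>j\<in>J. a (dist (x j) m))"
    by (simp add: sum_subtractf sum_distrib_left)
  moreover have "real (card J) * (D * a D) \<le> real (card J) * (2 * \<tau> D)"
    using tau_a_half[of D] D by (intro mult_left_mono) auto
  ultimately have "D * (real (card J) * a D) \<le> D * (4 * (\<Sum>j\<in>J. a (dist (x j) m)))"
    by (simp add: algebra_simps)
  then show ?thesis using D by (simp add: D_def)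
qed

end

section \<open>Leave-one-out stability\<close>

text \<open>The harmonic mean is at most the arithmetic mean, by Cauchy-Schwarz for sqrt (w j) and
  its reciprocal. This linearizes the random denominator, so that expectations can be taken term by
  term.\<close>

lemma inverse_sum_le:
  fixes w :: "'i \<Rightarrow> real"
  assumes "finite J" "J \<noteq> {}" "\<And>j. j \<in> J \<Longrightarrow> 0 < w j"
  shows "1 / (\<Sum>j\<in>J. w j) \<le> (\<Sum>j\<in>J. 1 / w j) / (real (card J))\<^sup>2"
proof -
  have pos: "0 < (\<Sum>j\<in>J. w j)" using assms by (intro sum_pos) auto
  have card: "0 < real (card J)" using assms by (simp add: card_gt_0_iff)
  have "(\<Sum>j\<in>J. sqrt (w j) * (1 / sqrt (w j)))\<^sup>2 \<le> (\<Sum>j\<in>J. (sqrt (w j))\<^sup>2) * (\<Sum>j\<in>J. (1 / sqrt (w j))\<^sup>2)"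
    by (rule Cauchy_Schwarz_ineq_sum)
  also have "(\<Sum>j\<in>J. sqrt (w j) * (1 / sqrt (w j))) = (\<Sum>j\<in>J. 1)"
    using assms(3) by (intro sum.cong) force+
  also have "(\<Sum>j\<in>J. (sqrt (w j))\<^sup>2) = (\<Sum>j\<in>J. w j)"
    using assms(3) by (intro sum.cong) (auto simp: less_imp_le)
  also have "(\<Sum>j\<in>J. (1 / sqrt (w j))\<^sup>2) = (\<Sum>j\<in>J. 1 / w j)"
    using assms(3) by (intro sum.cong) (auto simp: power_divide less_imp_le)
  finally show ?thesis using pos card by (simp add: field_simps)
qed

lemma sum_square_le:
  fixes b :: "'i \<Rightarrow> real"
  shows "(\<Sum>j\<in>J. b j)\<^sup>2 \<le> real (card J) * (\<Sum>j\<in>J. (b j)\<^sup>2)"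
  using Cauchy_Schwarz_ineq_sum[of "\<lambda>_. 1" b J] by simp

text \<open>
  The weights \<open>5\<close> and \<open>20/n\<close> come from \<open>(s + t)\<^sup>2 \<le> 5 s\<^sup>2 + (5/4) t\<^sup>2\<close>, with \<open>t\<close> bounded by four
  times an average over \<open>n\<close> points. They add up to \<open>25\<close>.
\<close>

definition loo_weight :: "'i set \<Rightarrow> 'i \<Rightarrow> 'i \<Rightarrow> real" where
  "loo_weight I i k = (if k = i then 5 else 20 / real (card I - 1))"

lemma loo_weight_nonneg: "0 \<le> loo_weight I i k"
  by (simp add: loo_weight_def)

lemma sum_loo_weight_split:
  assumes "finite I" "i \<in> I"
  shows "(\<Sum>k\<in>I. loo_weight I i k * b k) = 5 * b i + 20 / real (card I - 1) * (\<Sum>k\<in>I - {i}. b k)"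
proof -
  have "(\<Sum>k\<in>I. loo_weight I i k * b k) = 5 * b i + (\<Sum>k\<in>I - {i}. loo_weight I i k * b k)"
    using assms by (subst sum.remove[of I i]) (auto simp: loo_weight_def)
  also have "(\<Sum>k\<in>I - {i}. loo_weight I i k * b k) = (\<Sum>k\<in>I - {i}. 20 / real (card I - 1) * b k)"
    by (intro sum.cong) (auto simp: loo_weight_def)
  finally show ?thesis by (simp add: sum_distrib_left)
qed

lemma sum_loo_weight:
  assumes "finite I" "i \<in> I" "2 \<le> card I"
  shows "(\<Sum>k\<in>I. loo_weight I i k) = 25"
proof -
  define N where "N = real (card I - 1)"
  have "real (card (I - {i})) = N" "0 < N" using assms by (auto simp: N_def)
  moreover have "(\<Sum>k\<in>I. loo_weight I i k) = 5 + 20 / N * real (card (I - {i}))"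
    using sum_loo_weight_split[OF assms(1,2), of "\<lambda>_. 1"] by (simp add: N_def)
  ultimately show ?thesis by simp
qed

context transform
begin

text \<open>The functions f, \<gamma>, \<eta> are left open because the bound is integrated both
  with a^2, g, h and with their powers of exponent 1 + \<epsilon>. The average inside \<eta> omits k
  rather than i: for an independent sample it is then independent of the factor f (d k).\<close>

definition loo_bound :: "'i set \<Rightarrow> 'i \<Rightarrow> (real \<Rightarrow> real) \<Rightarrow> (real \<Rightarrow> real) \<Rightarrow> (real \<Rightarrow> real) \<Rightarrow> ('i \<Rightarrow> real) \<Rightarrow> real" where
  "loo_bound I i f \<gamma> \<eta> d = (\<Sum>k\<in>I. loo_weight I i k * (f (d k) *
     ((\<Sum>j\<in>I - {i}. \<gamma> (d j)) / real (card I - 1)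
      + \<eta> (2 * ((\<Sum>j\<in>I - {k}. a (d j)) / real (card I - 1)))
      + \<eta> (a (d k) / real (card I - 1)))))"

abbreviation loo_total :: "'i set \<Rightarrow> 'i \<Rightarrow> ('i \<Rightarrow> real) \<Rightarrow> real" where
  "loo_total I i \<equiv> loo_bound I i (\<lambda>x. (a x)\<^sup>2) g h"

definition loo_square :: "'i set \<Rightarrow> 'i \<Rightarrow> ('i \<Rightarrow> real) \<Rightarrow> real" where
  "loo_square I i d = (\<Sum>k\<in>I. loo_weight I i k * (a (d k))\<^sup>2)"

lemma loo_square_nonneg: "0 \<le> loo_square I i d"
  by (auto simp: loo_square_def loo_weight_nonneg intro!: sum_nonneg)

lemma loo_bound_nonneg:
  assumes "\<And>x. 0 \<le> f x" "\<And>x. 0 \<le> \<gamma> x" "\<And>x. 0 \<le> \<eta> x"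
  shows "0 \<le> loo_bound I i f \<gamma> \<eta> d"
  unfolding loo_bound_def
  by (intro sum_nonneg mult_nonneg_nonneg add_nonneg_nonneg divide_nonneg_nonneg assms loo_weight_nonneg) auto

end

text \<open>The deterministic part of the argument, for one fixed sample; only the final bounds in
  the distances \<open>d j\<close> are integrated later.\<close>

locale leave_one_out = transform +
  fixes I :: "'i set" and i :: 'i and x :: "'i \<Rightarrow> 'b::hadamard_space" and m p q :: 'b
  assumes finI: "finite I" and iI: "i \<in> I" and card2: "2 \<le> card I"
    and p_min: "\<And>z. (\<Sum>j\<in>I. \<tau> (dist (x j) p)) \<le> (\<Sum>j\<in>I. \<tau> (dist (x j) z))"
    and q_min: "\<And>z. (\<Sum>j\<in>I - {i}. \<tau> (dist (x j) q)) \<le> (\<Sum>j\<in>I - {i}. \<tau> (dist (x j) z))"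
begin

definition n :: real where "n = real (card I - 1)"
definition d :: "'i \<Rightarrow> real" where "d j = dist (x j) m"
definition D :: real where "D = max (dist m p) (dist m q)"

lemma n_pos: "0 < n" and card_loo: "k \<in> I \<Longrightarrow> real (card (I - {k})) = n" and card_I: "real (card I) = n + 1"
  using card2 finI by (auto simp: n_def of_nat_diff)

lemma d_nonneg: "0 \<le> d j" and D_nonneg: "0 \<le> D"
  by (auto simp: d_def D_def le_max_iff_disj)

text \<open>Both minimizers obey one bound after replacing n + 1 by n for p and adding the omitted
  nonnegative term for q.\<close>

lemma a_D: "a D \<le> 4 * ((\<Sum>j\<in>I. a (d j)) / n)"
proof -
  have "real (card I) * a (dist m p) \<le> 4 * (\<Sum>j\<in>I. a (d j))"
    unfolding d_def by (rule a_empirical[OF finI p_min])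
  moreover have "n * a (dist m p) \<le> real (card I) * a (dist m p)"
    using card_I a_nonneg by (intro mult_right_mono) auto
  ultimately have "n * a (dist m p) \<le> 4 * (\<Sum>j\<in>I. a (d j))" by simp
  moreover have "n * a (dist m q) \<le> 4 * (\<Sum>j\<in>I. a (d j))"
  proof -
    have "n * a (dist m q) \<le> 4 * (\<Sum>j\<in>I - {i}. a (d j))"
      using a_empirical[OF _ q_min] finI unfolding d_def card_loo[OF iI, symmetric] by simp
    also have "... \<le> 4 * (\<Sum>j\<in>I. a (d j))"
      using finI by (intro mult_left_mono sum_mono2) (auto simp: a_nonneg)
    finally show ?thesis .
  qed
  ultimately have "n * a D \<le> 4 * (\<Sum>j\<in>I. a (d j))" by (simp add: D_def max_def)
  then show ?thesis using n_pos by (simp add: field_simps)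
qed

text \<open>The index k is free, so each summand of \<open>loo_bound\<close> can use the split that
  removes its own observation from the average.\<close>

lemma g_D: assumes "k \<in> I"
  shows "g D \<le> h (2 * ((\<Sum>j\<in>I - {k}. a (d j)) / n)) + h (a (d k) / n)"
proof (rule g_le_h_sum[OF D_nonneg])
  have "(\<Sum>j\<in>I. a (d j)) = a (d k) + (\<Sum>j\<in>I - {k}. a (d j))" using finI assms by (rule sum.remove)
  then show "a D \<le> 4 * ((\<Sum>j\<in>I - {k}. a (d j)) / n + a (d k) / n)"
    using a_D by (simp add: add_divide_distrib)
qed (use n_pos in \<open>auto intro!: divide_nonneg_nonneg sum_nonneg a_nonneg\<close>)

lemma square_le: "(a (d i) + a (dist m q))\<^sup>2 \<le> loo_square I i d"
proof -
  define A where "A = (\<Sum>j\<in>I - {i}. a (d j)) / n"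
  have "n * a (dist m q) \<le> 4 * (\<Sum>j\<in>I - {i}. a (d j))"
    using a_empirical[OF _ q_min] finI unfolding d_def card_loo[OF iI, symmetric] by simp
  then have "a (dist m q) \<le> 4 * A" using n_pos by (simp add: A_def field_simps)
  then have "(a (d i) + a (dist m q))\<^sup>2 \<le> (a (d i) + 4 * A)\<^sup>2"
    using a_nonneg by (intro power_mono) auto
  \<comment> \<open>The difference of the two sides is 4 (a (d i) - A)^2.\<close>
  also have "... \<le> 5 * (a (d i))\<^sup>2 + 20 * A\<^sup>2"
    using zero_le_power2[of "a (d i) - A"] by (simp add: power2_eq_square algebra_simps)
  also have "A\<^sup>2 \<le> (\<Sum>j\<in>I - {i}. (a (d j))\<^sup>2) / n"
  proof -
    have "(\<Sum>j\<in>I - {i}. a (d j))\<^sup>2 \<le> n * (\<Sum>j\<in>I - {i}. (a (d j))\<^sup>2)"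
      using sum_square_le[of "\<lambda>j. a (d j)" "I - {i}"] card_loo[OF iI] by simp
    then show ?thesis using n_pos by (simp add: A_def power_divide field_simps power2_eq_square)
  qed
  also have "5 * (a (d i))\<^sup>2 + 20 * ((\<Sum>j\<in>I - {i}. (a (d j))\<^sup>2) / n) = loo_square I i d"
    unfolding loo_square_def using sum_loo_weight_split[OF finI iI, of "\<lambda>k. (a (d k))\<^sup>2"] by (simp add: n_def)
  finally show ?thesis by simp
qed

text \<open>Adding the growth inequalities at both minimizers cancels all terms but the one of \<open>i\<close>.\<close>

lemma loo_diff_weights:
  assumes w: "\<And>j. j \<in> I - {i} \<Longrightarrow> lower_slope (d j + D) (w j)" and pos: "0 < (\<Sum>j\<in>I - {i}. w j)"
  shows "\<tau> (dist (x i) q) - \<tau> (dist (x i) p) \<le> loo_square I i d / (\<Sum>j\<in>I - {i}. w j)"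
proof -
  define W \<delta> T where "W = (\<Sum>j\<in>I - {i}. w j)" and "\<delta> = dist p q" and "T = a (d i) + a (dist m q)"
  have R: "dist (x j) p \<le> d j + D" "dist (x j) q \<le> d j + D" for j
    using dist_triangle[of "x j" p m] dist_triangle[of "x j" q m] by (auto simp: d_def D_def)
  \<comment> \<open>The weight 0 at i makes the growth at p involve the same sum W as the growth at
    q.\<close>
  define w' where "w' = w(i := 0)"
  have "(\<Sum>j\<in>I. w' j) * \<delta>\<^sup>2 / 2 \<le> (\<Sum>j\<in>I. \<tau> (dist (x j) q)) - (\<Sum>j\<in>I. \<tau> (dist (x j) p))"
    unfolding \<delta>_def using w R by (intro sum_argmin_growth[where R = "\<lambda>j. d j + D", OF p_min]) (auto simp: w'_def lower_slope_0)
  moreover have "(\<Sum>j\<in>I. w' j) = W"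
    using finI iI by (subst sum.remove[of I i]) (auto simp: w'_def W_def intro!: sum.cong)
  moreover have "W * (dist q p)\<^sup>2 / 2 \<le> (\<Sum>j\<in>I - {i}. \<tau> (dist (x j) p)) - (\<Sum>j\<in>I - {i}. \<tau> (dist (x j) q))"
    unfolding W_def using w R by (intro sum_argmin_growth[where R = "\<lambda>j. d j + D", OF q_min]) auto
  moreover have "(\<Sum>j\<in>I. \<tau> (dist (x j) z)) = \<tau> (dist (x i) z) + (\<Sum>j\<in>I - {i}. \<tau> (dist (x j) z))" for z
    using finI iI by (rule sum.remove)
  ultimately have low: "W * \<delta>\<^sup>2 \<le> \<tau> (dist (x i) q) - \<tau> (dist (x i) p)"
    by (simp add: \<delta>_def dist_commute)
  have up: "\<tau> (dist (x i) q) - \<tau> (dist (x i) p) \<le> \<delta> * T"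
    unfolding \<delta>_def T_def d_def by (rule tau_dist_diff)
  have W: "0 < W" using pos by (simp add: W_def)
  \<comment> \<open>The lower bound W \<delta>^2 and the upper bound \<delta> T for the same
    difference force \<delta> \<le> T / W unless \<delta> = 0, where the claim is trivial.\<close>
  have "\<delta> * T \<le> T\<^sup>2 / W"
  proof (cases "\<delta> = 0")
    case False
    then have "0 < \<delta>" by (simp add: \<delta>_def)
    moreover have "\<delta> * (W * \<delta>) \<le> \<delta> * T" using low up by (simp add: power2_eq_square mult_ac)
    ultimately have "W * \<delta> \<le> T" by simp
    then have "T * (W * \<delta>) \<le> T * T" using a_nonneg by (intro mult_left_mono) (auto simp: T_def)
    then show ?thesis using W by (simp add: field_simps power2_eq_square)
  qed (use W in simp)
  also have "... \<le> loo_square I i d / W"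
    using square_le W by (intro divide_right_mono) (auto simp: T_def)
  finally show ?thesis using up by (simp add: W_def)
qed

lemma loo_diff_trivial: "D = 0 \<Longrightarrow> \<tau> (dist (x i) q) - \<tau> (dist (x i) p) = 0"
  by (metis D_def diff_self dist_eq_0_iff max.cobounded1 max.cobounded2 zero_le_dist antisym)

lemma square_times_le_bound:
  "loo_square I i d * ((\<Sum>j\<in>I - {i}. g (d j)) / n + g D) \<le> loo_total I i d"
  unfolding loo_square_def loo_bound_def sum_distrib_right mult.assoc n_def[symmetric]
  using g_D by (intro sum_mono mult_left_mono loo_weight_nonneg) (auto simp: add.assoc)

text \<open>The weights are \<kappa> (d j + D), and \<open>inverse_sum_le\<close> linearizes the
  reciprocal of their sum. If D = 0, some argument may vanish, but then both minimizers equal m and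
  the difference is 0.\<close>

lemma loo_diff:
  "\<tau> (dist (x i) q) - \<tau> (dist (x i) p) \<le> loo_total I i d / n"
proof (cases "D = 0")
  case True
  then show ?thesis using n_pos
    by (auto simp: loo_diff_trivial intro!: divide_nonneg_pos loo_bound_nonneg g_nonneg h_nonneg)
next
  case False
  then have Dpos: "0 < D" using D_nonneg by simp
  let ?J = "I - {i}"
  have R: "0 < d j + D" for j using Dpos d_nonneg[of j] by simp
  have ne: "?J \<noteq> {}"
  proof
    assume "?J = {}" then show False using card_loo[OF iI] n_pos by (metis card.empty of_nat_0 less_irrefl)
  qed
  have "\<tau> (dist (x i) q) - \<tau> (dist (x i) p) \<le> loo_square I i d / (\<Sum>j\<in>?J. \<kappa> (d j + D))"
    using R kappa_pos ne finI by (intro loo_diff_weights lower_slope_kappa sum_pos) auto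
  also have "... = loo_square I i d * (1 / (\<Sum>j\<in>?J. \<kappa> (d j + D)))" by simp
  also have "... \<le> loo_square I i d * ((\<Sum>j\<in>?J. 1 / \<kappa> (d j + D)) / n\<^sup>2)"
    using inverse_sum_le[of ?J "\<lambda>j. \<kappa> (d j + D)"] ne finI R kappa_pos card_loo[OF iI]
    by (intro mult_left_mono loo_square_nonneg) auto
  also have "... \<le> loo_square I i d * ((\<Sum>j\<in>?J. g (d j) + g D) / n\<^sup>2)"
  proof (intro mult_left_mono loo_square_nonneg divide_right_mono sum_mono)
    fix j
    \<comment> \<open>d j + D is at most 2 M, within the factor 7 of \<open>g\<close>, and g M is
      one of g (d j) and g D.\<close>
    define M where "M = max (d j) D"
    have M: "0 < M" "d j + D \<le> 7 * M" using Dpos d_nonneg[of j] by (auto simp: M_def)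
    then have "\<kappa> (7 * M) \<le> \<kappa> (d j + D)" using R by (intro kappa_antimono) auto
    then have "1 / \<kappa> (d j + D) \<le> g M" using M kappa_pos[of "7 * M"] by (simp add: g_eq frac_le)
    also have "g M \<le> g (d j) + g D" using g_nonneg[of D] g_nonneg[of "d j"] by (simp add: M_def max_def)
    finally show "1 / \<kappa> (d j + D) \<le> g (d j) + g D" .
  qed simp
  also have "(\<Sum>j\<in>?J. g (d j) + g D) / n\<^sup>2 = ((\<Sum>j\<in>?J. g (d j)) / n + g D) / n"
    using n_pos card_loo[OF iI] by (simp add: sum.distrib field_simps power2_eq_square)
  also have "loo_square I i d * (((\<Sum>j\<in>?J. g (d j)) / n + g D) / n) \<le> loo_total I i d / n"
    using divide_right_mono[OF square_times_le_bound, of n] n_pos by simp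
  finally show ?thesis .
qed

text \<open>A crude bound without the factor 1 / n. It serves to make the loss at the omitted
  observation integrable, so that Fubini's theorem applies.\<close>

lemma loo_dist_diff_abs:
  "\<bar>\<tau> (dist (x i) q) - \<tau> (dist (x i) m)\<bar> \<le> loo_total I i d"
proof -
  define E where "E = dist m q"
  have E0: "0 \<le> E" "E \<le> D" by (auto simp: E_def D_def)
  have "\<bar>\<tau> (dist (x i) q) - \<tau> (dist (x i) m)\<bar> \<le> E * (a (d i) + a E)"
    unfolding E_def d_def by (rule tau_dist_diff_abs)
  also have "... \<le> (a E * g E) * (a (d i) + a E)"
  proof (cases "E = 0")
    case True
    then show ?thesis using a_nonneg g_nonneg by simp
  next
    case False
    then have "0 < E" using E0 by simp
    \<comment> \<open>The distance is absorbed by E \<le> a E * g E, a consequence of \<kappa> (7 E)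
      * 7 E \<le> a (7 E) \<le> 7 a E.\<close>
    have "E * a (7 * E) \<le> 7 * E * a E" using a_quotient[of E "7 * E"] E0 by simp
    moreover have "E * (\<kappa> (7 * E) * (7 * E)) \<le> E * a (7 * E)"
      using kappa_le_quotient[of "7 * E"] \<open>0 < E\<close> by (intro mult_left_mono) auto
    ultimately have "E * (\<kappa> (7 * E) * (7 * E)) \<le> E * (7 * a E)" by (simp only: mult_ac)
    then have "\<kappa> (7 * E) * (7 * E) \<le> 7 * a E"
      by (simp only: mult_le_cancel_left_pos[OF \<open>0 < E\<close>])
    then have "E \<le> a E * g E"
      using \<open>0 < E\<close> kappa_pos[of "7 * E"] by (simp add: g_eq field_simps)
    then show ?thesis using a_nonneg by (intro mult_right_mono) auto
  qed
  also have "... \<le> g E * (a (d i) + a E)\<^sup>2"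
    using a_nonneg[of "d i"] a_nonneg[of E] g_nonneg[of E]
    by (simp add: power2_eq_square algebra_simps mult_left_mono)
  also have "... \<le> ((\<Sum>j\<in>I - {i}. g (d j)) / n + g D) * loo_square I i d"
    using square_le g_mono[OF E0(2)] n_pos unfolding E_def
    by (intro mult_mono) (auto intro!: add_nonneg_nonneg add_increasing divide_nonneg_pos sum_nonneg g_nonneg)
  also have "... \<le> loo_total I i d"
    using square_times_le_bound by (simp add: mult.commute)
  finally show ?thesis .
qed

text \<open>The points within c of m receive the common weight \<kappa> (c + D) and all others 0, so
  the sum of the weights has a nonrandom lower bound. N + 1 such points are required because i may
  be one of them.\<close>

lemma loo_diff_good:
  assumes "0 < r" and "c + inv_a (4 * ((\<Sum>j\<in>I. a (d j)) / n)) \<le> r"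
    and N: "real (card {j \<in> I. d j \<le> c}) \<ge> N + 1" "0 < N"
  shows "\<tau> (dist (x i) q) - \<tau> (dist (x i) p) \<le> loo_square I i d / (N * \<kappa> r)"
proof -
  have "D \<le> inv_a (4 * ((\<Sum>j\<in>I. a (d j)) / n))" by (rule le_inv_a[OF a_D D_nonneg])
  then have cD: "c + D \<le> r" using assms by simp
  have \<kappa>r: "0 < \<kappa> r" using kappa_pos assms by simp
  show ?thesis
  proof (cases "D = 0")
    case True
    then show ?thesis
      using \<kappa>r N by (simp only: loo_diff_trivial) (intro divide_nonneg_pos loo_square_nonneg mult_pos_pos)
  next
    case False
    then have Dpos: "0 < D" using D_nonneg by simp
    define J where "J = {j \<in> I - {i}. d j \<le> c}"
    have finJ: "finite J" using finI by (simp add: J_def)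
    have "{j \<in> I. d j \<le> c} \<subseteq> insert i J" by (auto simp: J_def)
    then have "card {j \<in> I. d j \<le> c} \<le> card (insert i J)" using finJ by (intro card_mono) auto
    also have "... \<le> card J + 1" using finJ by (simp add: card_insert_if)
    finally have cJ: "N \<le> real (card J)" using N by linarith
    define w where "w j = (if d j \<le> c then \<kappa> (c + D) else 0)" for j
    have w: "lower_slope (d j + D) (w j)" for j
    proof (cases "d j \<le> c")
      case True
      then have "0 < d j + D" "0 < c + D" using Dpos d_nonneg[of j] by auto
      then have "\<kappa> (c + D) \<le> \<kappa> (d j + D)" using True by (intro kappa_antimono) auto
      moreover have "lower_slope (d j + D) (\<kappa> (d j + D))" using \<open>0 < d j + D\<close> by (rule lower_slope_kappa)
      ultimately show ?thesis
        using True kappa_pos[OF \<open>0 < c + D\<close>] unfolding lower_slope_def w_def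
        by (auto intro: order_trans[OF mult_right_mono])
    qed (simp add: w_def lower_slope_0)
    have "J \<noteq> {}" using cJ N by auto
    then have c0: "0 \<le> c" using d_nonneg by (auto simp: J_def intro: order_trans)
    then have "0 < c + D" using Dpos by simp
    have "(\<Sum>j\<in>I - {i}. w j) = (\<Sum>j\<in>J. \<kappa> (c + D))"
      unfolding J_def w_def using finI by (subst sum.inter_filter) auto
    then have sw: "(\<Sum>j\<in>I - {i}. w j) = real (card J) * \<kappa> (c + D)" by simp
    have ge: "N * \<kappa> r \<le> (\<Sum>j\<in>I - {i}. w j)"
      unfolding sw using cJ N \<kappa>r cD \<open>0 < c + D\<close> by (intro mult_mono kappa_antimono) auto
    moreover have "0 < N * \<kappa> r" using N \<kappa>r by simp
    ultimately have "\<tau> (dist (x i) q) - \<tau> (dist (x i) p) \<le> loo_square I i d / (\<Sum>j\<in>I - {i}. w j)"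
      using w by (intro loo_diff_weights) auto
    also have "... \<le> loo_square I i d / (N * \<kappa> r)"
      using ge \<open>0 < N * \<kappa> r\<close> loo_square_nonneg by (intro divide_left_mono) auto
    finally show ?thesis .
  qed
qed

end

section \<open>Independent samples\<close>

declare One_nat_def [simp del]

lemma measurable_dist_const [measurable (raw)]:
  fixes f :: "'b \<Rightarrow> 'a::metric_space"
  assumes "f \<in> borel_measurable N"
  shows "(\<lambda>x. dist (f x) c) \<in> borel_measurable N" "(\<lambda>x. dist c (f x)) \<in> borel_measurable N"
  by (rule measurable_compose[OF assms], intro borel_measurable_continuous_onI continuous_intros)+

locale iid_sample = prob_space M for M :: "'w measure" +
  fixes Y :: "'w \<Rightarrow> 'a::topological_space" and X :: "nat \<Rightarrow> 'w \<Rightarrow> 'a"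
  assumes Y_meas [measurable]: "Y \<in> borel_measurable M"
    and indep: "indep_vars (\<lambda>_. borel) X {1..}"
    and law: "\<And>j. j \<ge> 1 \<Longrightarrow> distr M borel (X j) = distr M borel Y"
begin

lemma X_meas [measurable]: "j \<ge> 1 \<Longrightarrow> X j \<in> borel_measurable M"
  using indep by (auto simp: indep_vars_def)

abbreviation N :: "'a measure" where "N \<equiv> distr M borel Y"

abbreviation PB :: "nat \<Rightarrow> (nat \<Rightarrow> 'a) measure" where "PB n \<equiv> PiM {1..n} (\<lambda>_. borel)"

text \<open>A subsample selected by \<beta>, extensional on {1..n} so that it lies in the product
  space. Empirical means are functions of such tuples, and those without observation i arise from a
  \<beta> that avoids i.\<close>

definition tup :: "(nat \<Rightarrow> nat) \<Rightarrow> nat \<Rightarrow> 'w \<Rightarrow> nat \<Rightarrow> 'a" where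
  "tup \<beta> n w = (\<lambda>j\<in>{1..n}. X (\<beta> j) w)"

lemma tup_meas [measurable]:
  assumes "\<beta> ` {1..n} \<subseteq> {1..}" shows "tup \<beta> n \<in> measurable M (PB n)"
proof -
  have "\<beta> j \<in> {1..}" if "j \<in> {1..n}" for j using assms that by blast
  then show ?thesis unfolding tup_def[abs_def] by (intro measurable_restrict X_meas) auto
qed

text \<open>By independence the selected observations have a product law with equal factors, which
  every injective renumbering preserves.\<close>

lemma tup_law:
  assumes \<beta>: "inj_on \<beta> {1..n}" "\<beta> ` {1..n} \<subseteq> {1..}" and n: "n \<ge> 1"
  shows "distr M (PB n) (tup \<beta> n) = PiM {1..n} (\<lambda>_. N)"
proof -
  define J where "J = \<beta> ` {1..n}"
  have J: "J \<noteq> {}" "J \<subseteq> {1..}" "finite J" using n \<beta> by (auto simp: J_def)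
  have "indep_vars (\<lambda>_. borel) X J" using indep J(2) by (rule indep_vars_subset)
  then have "distr M (PiM J (\<lambda>_. borel)) (\<lambda>w. \<lambda>j\<in>J. X j w) = PiM J (\<lambda>j. distr M borel (X j))"
    using J by (subst (asm) indep_vars_iff_distr_eq_PiM') auto
  also have "... = PiM J (\<lambda>_. N)" using J law by (intro PiM_cong) auto
  finally have *: "distr M (PiM J (\<lambda>_. borel)) (\<lambda>w. \<lambda>j\<in>J. X j w) = PiM J (\<lambda>_. N)" .
  have m1: "(\<lambda>w. \<lambda>j\<in>J. X j w) \<in> measurable M (PiM J (\<lambda>_. borel))"
    using J by (intro measurable_restrict X_meas) auto
  have m2: "(\<lambda>x. \<lambda>j\<in>{1..n}. x (\<beta> j)) \<in> measurable (PiM J (\<lambda>_. borel)) (PB n)"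
    by (intro measurable_restrict measurable_component_singleton) (auto simp: J_def)
  have "PiM {1..n} (\<lambda>_. N) = distr (PiM J (\<lambda>_. N)) (PiM {1..n} (\<lambda>_. N)) (\<lambda>x. \<lambda>j\<in>{1..n}. x (\<beta> j))"
    by (rule distr_PiM_reindex[symmetric]) (use \<beta> in \<open>auto simp: J_def intro: prob_space_distr\<close>)
  also have "... = distr (PiM J (\<lambda>_. N)) (PB n) (\<lambda>x. \<lambda>j\<in>{1..n}. x (\<beta> j))"
    by (intro distr_cong sets_PiM_cong) auto
  also have "... = distr M (PB n) (tup \<beta> n)"
    unfolding *[symmetric] distr_distr[OF m2 m1]
    by (auto simp: comp_def tup_def J_def restrict_def fun_eq_iff intro!: distr_cong)
  finally show ?thesis ..
qed

lemma tup_law_eq: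
  assumes "inj_on \<beta> {1..n}" "\<beta> ` {1..n} \<subseteq> {1..}" "n \<ge> 1"
  shows "distr M (PB n) (tup \<beta> n) = distr M (PB n) (tup id n)"
  using tup_law[OF assms] tup_law[of id n] assms by auto

lemma AE_tup:
  assumes "inj_on \<beta> {1..n}" "\<beta> ` {1..n} \<subseteq> {1..}" "n \<ge> 1"
    and P: "{x \<in> space (PB n). P x} \<in> sets (PB n)"
    and AE: "AE w in M. P (tup id n w)"
  shows "AE w in M. P (tup \<beta> n w)"
  using arg_cong[OF tup_law_eq[OF assms(1-3)], of "\<lambda>D. AE x in D. P x"] assms
  by (subst (asm) (1 2) AE_distr_iff) auto

lemma nn_integral_X:
  assumes "k \<ge> 1" and [measurable]: "u \<in> borel_measurable borel"
  shows "(\<integral>\<^sup>+w. u (X k w) \<partial>M) = (\<integral>\<^sup>+w. u (Y w) \<partial>M)"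
  using arg_cong[OF law[OF assms(1)], of "\<lambda>P. integral\<^sup>N P u"] assms
  by (subst (asm) (1 2) nn_integral_distr) auto

lemma AE_X:
  assumes "k \<ge> 1" "{x. P x} \<in> sets borel" "AE w in M. P (Y w)"
  shows "AE w in M. P (X k w)"
  using arg_cong[OF law[OF assms(1)], of "\<lambda>D. AE x in D. P x"] assms
  by (subst (asm) (1 2) AE_distr_iff) auto

text \<open>Observation k and the tuple are functions of disjoint blocks of an independent family.
  The right-hand side depends neither on k nor on \<beta>, which makes all leave-one-out samples
  interchangeable.\<close>

lemma pair_law:
  assumes \<beta>: "inj_on \<beta> {1..n}" "\<beta> ` {1..n} \<subseteq> {1..}" "n \<ge> 1" and k: "k \<ge> 1" "k \<notin> \<beta> ` {1..n}"
  shows "distr M (borel \<Otimes>\<^sub>M PB n) (\<lambda>w. (X k w, tup \<beta> n w))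
       = N \<Otimes>\<^sub>M distr M (PB n) (tup id n)"
proof -
  let ?J = "\<beta> ` {1..n}" and ?P = "PB n"
  let ?PK = "PiM {k} (\<lambda>_. borel :: 'a measure)" and ?XK = "\<lambda>w. restrict (\<lambda>i. X i w) {k}"
  let ?A = "distr M ?PK ?XK" and ?T = "distr M ?P (tup \<beta> n)"
  have "indep_var (PiM {k} (\<lambda>_. borel)) (\<lambda>w. restrict (\<lambda>i. X i w) {k}) (PiM ?J (\<lambda>_. borel)) (\<lambda>w. restrict (\<lambda>i. X i w) ?J)"
    using k \<beta> by (intro indep_var_restrict[OF indep]) auto
  then have "indep_var (PiM {k} (\<lambda>_. borel)) (id \<circ> (\<lambda>w. restrict (\<lambda>i. X i w) {k}))
     (PB n) ((\<lambda>f. \<lambda>j\<in>{1..n}. f (\<beta> j)) \<circ> (\<lambda>w. restrict (\<lambda>i. X i w) ?J))"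
    by (rule indep_var_compose) (auto intro!: measurable_restrict measurable_component_singleton)
  moreover have "id \<circ> (\<lambda>w. restrict (\<lambda>i. X i w) {k}) = (\<lambda>w. restrict (\<lambda>i. X i w) {k})" by simp
  moreover have "(\<lambda>f. \<lambda>j\<in>{1..n}. f (\<beta> j)) \<circ> (\<lambda>w. restrict (\<lambda>i. X i w) ?J) = tup \<beta> n"
    by (auto simp: comp_def tup_def restrict_def fun_eq_iff)
  ultimately have "indep_var (PiM {k} (\<lambda>_. borel)) (\<lambda>w. restrict (\<lambda>i. X i w) {k}) (PB n) (tup \<beta> n)"
    by simp
  then have eq: "?A \<Otimes>\<^sub>M ?T = distr M (?PK \<Otimes>\<^sub>M ?P) (\<lambda>w. (?XK w, tup \<beta> n w))"
    unfolding indep_var_distribution_eq by blast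
  have m [measurable]: "tup \<beta> n \<in> measurable M ?P" using \<beta> by simp
  have mk [measurable]: "?XK \<in> measurable M ?PK" using k by (intro measurable_restrict X_meas) auto
  interpret T: prob_space ?T by (rule prob_space_distr) (rule m)
  have "N \<Otimes>\<^sub>M distr M ?P (tup id n) = distr M borel (X k) \<Otimes>\<^sub>M ?T"
    using law[OF k(1)] tup_law_eq[OF \<beta>] by simp
  also have "... = distr ?A borel (\<lambda>f. f k) \<Otimes>\<^sub>M distr ?T ?P (\<lambda>x. x)"
    by (subst distr_distr) (auto simp: comp_def distr_id2)
  also have "... = distr (?A \<Otimes>\<^sub>M ?T) (borel \<Otimes>\<^sub>M ?P) (\<lambda>(f, x). (f k, x))"
    by (rule pair_measure_distr) (auto simp: distr_id2 T.sigma_finite_measure_axioms)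
  also have "... = distr M (borel \<Otimes>\<^sub>M ?P) (\<lambda>w. (X k w, tup \<beta> n w))"
    unfolding eq by (subst distr_distr) (auto simp: comp_def)
  finally show ?thesis ..
qed

lemma nn_integral_mult_tup:
  assumes \<beta>: "inj_on \<beta> {1..n}" "\<beta> ` {1..n} \<subseteq> {1..}" "n \<ge> 1" and k: "k \<ge> 1" "k \<notin> \<beta> ` {1..n}"
    and [measurable]: "u \<in> borel_measurable borel" "\<Psi> \<in> borel_measurable (PB n)"
  shows "(\<integral>\<^sup>+w. u (X k w) * \<Psi> (tup \<beta> n w) \<partial>M) = (\<integral>\<^sup>+w. u (Y w) \<partial>M) * (\<integral>\<^sup>+w. \<Psi> (tup id n w) \<partial>M)"
proof -
  let ?T = "distr M (PB n) (tup id n)"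
  have [measurable]: "tup \<beta> n \<in> measurable M (PB n)" using \<beta> by simp
  have [measurable]: "tup id n \<in> measurable M (PB n)" by (intro tup_meas) auto
  have [measurable]: "X k \<in> borel_measurable M" using k by simp
  interpret T: prob_space ?T by (rule prob_space_distr) simp
  interpret N: prob_space N by (rule prob_space_distr) simp
  have "(\<integral>\<^sup>+w. u (X k w) * \<Psi> (tup \<beta> n w) \<partial>M)
    = (\<integral>\<^sup>+z. (\<lambda>(y, x). u y * \<Psi> x) z \<partial>distr M (borel \<Otimes>\<^sub>M PB n) (\<lambda>w. (X k w, tup \<beta> n w)))"
    by (subst nn_integral_distr) auto
  also have "... = (\<integral>\<^sup>+z. (\<lambda>(y, x). u y * \<Psi> x) z \<partial>(N \<Otimes>\<^sub>M ?T))"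
    by (simp only: pair_law[OF \<beta> k])
  also have "... = (\<integral>\<^sup>+y. \<integral>\<^sup>+x. u y * \<Psi> x \<partial>?T \<partial>N)"
    by (subst T.nn_integral_fst[symmetric]) auto
  also have "... = (\<integral>\<^sup>+y. u y * (\<integral>\<^sup>+x. \<Psi> x \<partial>?T) \<partial>N)"
    by (intro nn_integral_cong nn_integral_cmult) auto
  also have "... = (\<integral>\<^sup>+y. u y \<partial>N) * (\<integral>\<^sup>+x. \<Psi> x \<partial>?T)"
    by (rule nn_integral_multc) auto
  also have "... = (\<integral>\<^sup>+w. u (Y w) \<partial>M) * (\<integral>\<^sup>+w. \<Psi> (tup id n w) \<partial>M)"
    by (simp add: nn_integral_distr)
  finally show ?thesis .
qed

lemma nn_integral_mult_X:
  assumes "k \<ge> 1" "j \<ge> 1" "k \<noteq> j" and [measurable]: "u \<in> borel_measurable borel" "v \<in> borel_measurable borel"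
  shows "(\<integral>\<^sup>+w. u (X k w) * v (X j w) \<partial>M) = (\<integral>\<^sup>+w. u (Y w) \<partial>M) * (\<integral>\<^sup>+w. v (Y w) \<partial>M)"
proof -
  have "(\<integral>\<^sup>+w. u (X k w) * v (tup (\<lambda>_. j) 1 w 1) \<partial>M) = (\<integral>\<^sup>+w. u (Y w) \<partial>M) * (\<integral>\<^sup>+w. v (tup id 1 w 1) \<partial>M)"
    using assms by (intro nn_integral_mult_tup[where \<Psi> = "\<lambda>x. v (x 1)"]) auto
  then show ?thesis using assms nn_integral_X[of 1 v] by (simp add: tup_def)
qed

lemma integral_X:
  fixes u :: "'a \<Rightarrow> real"
  assumes "k \<ge> 1" and [measurable]: "u \<in> borel_measurable borel"
  shows "integrable M (\<lambda>w. u (X k w)) = integrable M (\<lambda>w. u (Y w))"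
    "(\<integral>w. u (X k w) \<partial>M) = (\<integral>w. u (Y w) \<partial>M)"
proof -
  have [measurable]: "X k \<in> borel_measurable M" using assms by simp
  show "integrable M (\<lambda>w. u (X k w)) = integrable M (\<lambda>w. u (Y w))"
    "(\<integral>w. u (X k w) \<partial>M) = (\<integral>w. u (Y w) \<partial>M)"
    using law[OF assms(1)] integrable_distr_eq[of "X k" M borel u] integrable_distr_eq[of Y M borel u]
      integral_distr[of "X k" M borel u] integral_distr[of Y M borel u] by simp_all
qed

text \<open>Chebyshev's inequality: centering makes the mixed terms of the squared sum vanish in
  expectation, so only n variances remain.\<close>

lemma prob_sum_deviation:
  fixes u :: "'a \<Rightarrow> real"
  assumes [measurable]: "u \<in> borel_measurable borel" and u: "integrable M (\<lambda>w. (u (Y w))\<^sup>2)"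
    and "n \<ge> 1" "t > 0"
  shows "prob {w \<in> space M. \<bar>(\<Sum>j=1..n. u (X j w)) - real n * expectation (\<lambda>w. u (Y w))\<bar> \<ge> real n * t}
     \<le> variance (\<lambda>w. u (Y w)) / (real n * t\<^sup>2)"
proof -
  define \<mu> where "\<mu> = expectation (\<lambda>w. u (Y w))"
  define v where "v y = u y - \<mu>" for y
  have [measurable]: "v \<in> borel_measurable borel" by (simp add: v_def[abs_def])
  have Xm [measurable]: "j \<in> {1..n} \<Longrightarrow> X j \<in> borel_measurable M" for j by simp
  have iu: "integrable M (\<lambda>w. u (Y w))" by (rule square_integrable_imp_integrable[OF _ u]) simp
  have iv2: "integrable M (\<lambda>w. (v (Y w))\<^sup>2)"
    unfolding v_def power2_diff using iu u by auto
  have iv: "integrable M (\<lambda>w. v (Y w))" using iu by (simp add: v_def)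
  have ev: "expectation (\<lambda>w. v (Y w)) = 0" using iu by (simp add: v_def \<mu>_def prob_space)
  have ivX: "integrable M (\<lambda>w. v (X j w))" "integrable M (\<lambda>w. (v (X j w))\<^sup>2)" "expectation (\<lambda>w. v (X j w)) = 0"
    "expectation (\<lambda>w. (v (X j w))\<^sup>2) = variance (\<lambda>w. u (Y w))" if "j \<ge> 1" for j
    using integral_X[of j v] integral_X[of j "\<lambda>y. (v y)\<^sup>2"] that iv iv2 ev by (auto simp: v_def \<mu>_def)
  have prod: "integrable M (\<lambda>w. v (X j w) * v (X k w))"
    "expectation (\<lambda>w. v (X j w) * v (X k w)) = (if j = k then variance (\<lambda>w. u (Y w)) else 0)"
    if "j \<ge> 1" "k \<ge> 1" for j k
  proof -
    have "integrable M (\<lambda>w. v (X j w) * v (X k w)) \<and>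
      expectation (\<lambda>w. v (X j w) * v (X k w)) = (if j = k then variance (\<lambda>w. u (Y w)) else 0)"
    proof (cases "j = k")
      case True
      then show ?thesis using ivX[OF that(1)] by (simp add: power2_eq_square)
    next
      case False
      have "indep_var (PiM {j} (\<lambda>_. borel)) (\<lambda>w. restrict (\<lambda>i. X i w) {j}) (PiM {k} (\<lambda>_. borel)) (\<lambda>w. restrict (\<lambda>i. X i w) {k})"
        using that False by (intro indep_var_restrict[OF indep]) auto
      then have "indep_var borel ((\<lambda>f. v (f j)) \<circ> (\<lambda>w. restrict (\<lambda>i. X i w) {j})) borel ((\<lambda>f. v (f k)) \<circ> (\<lambda>w. restrict (\<lambda>i. X i w) {k}))"
        by (rule indep_var_compose) (auto intro!: measurable_compose[of _ _ borel v] measurable_component_singleton)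
      then have "indep_var borel (\<lambda>w. v (X j w)) borel (\<lambda>w. v (X k w))" by (simp add: comp_def)
      from indep_var_integrable[OF this] indep_var_lebesgue_integral[OF this] ivX that False show ?thesis by auto
    qed
    then show "integrable M (\<lambda>w. v (X j w) * v (X k w))"
      "expectation (\<lambda>w. v (X j w) * v (X k w)) = (if j = k then variance (\<lambda>w. u (Y w)) else 0)" by auto
  qed
  define S where "S w = (\<Sum>j=1..n. v (X j w))" for w
  have [measurable]: "S \<in> borel_measurable M" unfolding S_def[abs_def] by measurable
  have S2: "(S w)\<^sup>2 = (\<Sum>j=1..n. \<Sum>k=1..n. v (X j w) * v (X k w))" for w
    by (simp add: S_def power2_eq_square sum_product)
  have iS2: "integrable M (\<lambda>w. (S w)\<^sup>2)"
    unfolding S2 by (intro Bochner_Integration.integrable_sum prod) auto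
  have "expectation (\<lambda>w. (S w)\<^sup>2) = (\<Sum>j=1..n. \<Sum>k=1..n. expectation (\<lambda>w. v (X j w) * v (X k w)))"
    unfolding S2 by (subst Bochner_Integration.integral_sum, intro Bochner_Integration.integrable_sum prod)
      (auto intro!: sum.cong Bochner_Integration.integral_sum prod)
  also have "... = (\<Sum>j=1..n. \<Sum>k=1..n. if j = k then variance (\<lambda>w. u (Y w)) else 0)"
    by (intro sum.cong prod) auto
  also have "... = real n * variance (\<lambda>w. u (Y w))" by simp
  finally have ES2: "expectation (\<lambda>w. (S w)\<^sup>2) = real n * variance (\<lambda>w. u (Y w))" .
  have nt: "0 < real n * t" using assms by simp
  have Seq: "S w = (\<Sum>j=1..n. u (X j w)) - real n * \<mu>" for w
    by (simp add: S_def v_def sum_subtractf)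
  have "{w \<in> space M. \<bar>S w\<bar> \<ge> real n * t} = {w \<in> space M. (S w)\<^sup>2 \<ge> (real n * t)\<^sup>2}"
    using nt by (auto simp: abs_le_square_iff[symmetric])
  also have "prob ... \<le> expectation (\<lambda>w. (S w)\<^sup>2) / (real n * t)\<^sup>2"
    using nt iS2 \<open>n \<ge> 1\<close> by (intro integral_Markov_inequality_measure[where A = "{}"]) auto
  also have "... = variance (\<lambda>w. u (Y w)) / (real n * t\<^sup>2)"
    unfolding ES2 using assms by (simp add: power2_eq_square field_simps)
  finally show ?thesis by (simp add: Seq \<mu>_def)
qed

end

section \<open>Measurability in nonseparable spaces\<close>

lemma closure_range_approx:
  fixes s :: "nat \<Rightarrow> 'a::metric_space"
  assumes "y \<in> closure (range s)" "0 < e" obtains k where "dist y (s k) < e"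
  using assms unfolding closure_approachable by (metis dist_commute rangeE)

locale separable_sample = transform \<tau> + iid_sample M Y X
  for \<tau> and M :: "'w measure" and Y :: "'w \<Rightarrow> 'a::hadamard_space" and X +
  fixes s :: "nat \<Rightarrow> 'a"
  assumes Y_dense: "AE w in M. Y w \<in> closure (range s)"
begin

lemma X_dense: assumes "j \<ge> 1" shows "AE w in M. X j w \<in> closure (range s)"
  by (rule AE_X[OF assms _ Y_dense]) (simp add: borel_closed)

lemma X_dense_all: "AE w in M. \<forall>j\<in>{1..}. X j w \<in> closure (range s)"
  using X_dense by (intro AE_ball_countable[THEN iffD2]) auto

text \<open>
  The metric of a nonseparable space is not measurable with respect to the product of the Borel
  \<open>\<sigma>\<close>-algebras; \<open>dS\<close> is a measurable substitute which agrees with it on the support of \<open>Y\<close>.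
\<close>

definition dS :: "'a \<Rightarrow> 'a \<Rightarrow> real" where
  "dS y q = (INF k. dist y (s k) + dist (s k) q)"

lemma dS_meas [measurable (raw)]:
  assumes [measurable]: "f \<in> borel_measurable K" "f' \<in> borel_measurable K"
  shows "(\<lambda>x. dS (f x) (f' x)) \<in> borel_measurable K"
  unfolding dS_def by measurable

lemma dS_bdd: "bdd_below (range (\<lambda>k. dist y (s k) + dist (s k) q))"
  by (rule bdd_belowI[of _ 0]) auto

text \<open>The infimum is never below the distance by the triangle inequality; for y in the
  closure, points \<open>s k\<close> near y approach it.\<close>

lemma dS_eq: assumes "y \<in> closure (range s)" shows "dS y q = dist y q"
proof (rule antisym)
  show "dist y q \<le> dS y q" unfolding dS_def by (rule cINF_greatest) (auto intro: dist_triangle)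
  show "dS y q \<le> dist y q"
  proof (rule field_le_epsilon)
    fix e :: real assume "0 < e"
    then have "0 < e / 2" by simp
    obtain k where k: "dist y (s k) < e / 2" by (rule closure_range_approx[OF assms \<open>0 < e / 2\<close>])
    have "dS y q \<le> dist y (s k) + dist (s k) q" unfolding dS_def by (rule cINF_lower[OF dS_bdd]) simp
    also have "... \<le> dist y (s k) + (dist (s k) y + dist y q)" by (intro add_left_mono dist_triangle)
    also have "... \<le> dist y q + e" using k by (simp add: dist_commute)
    finally show "dS y q \<le> dist y q + e" .
  qed
qed

text \<open>
  To transfer the almost sure minimality from one sample to a permuted one, the event must be
  measurable although the infimum ranges over a nonseparable space. Countably many boxes around
  tuples of points \<open>s k\<close> detect all points whose risk falls below a rational level.
\<close>

definition box :: "nat \<Rightarrow> nat list \<Rightarrow> nat \<Rightarrow> (nat \<Rightarrow> 'a) set" where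
  "box n u k = {x. \<forall>j\<in>{1..n}. dist (x j) (s (u ! j)) < 1 / real (Suc k)}"

text \<open>The uncountable quantifier over z only selects a subset of a countable index type, where
  no measurability question arises.\<close>

definition risk_below :: "nat \<Rightarrow> real \<Rightarrow> (nat list \<times> nat) set" where
  "risk_below n c = {(u, k). \<exists>z. \<forall>x\<in>box n u k. (\<Sum>j=1..n. \<tau> (dist (x j) z)) < c}"

lemma risk_below_iff:
  assumes x: "\<And>j. j \<in> {1..n} \<Longrightarrow> x j \<in> closure (range s)"
  shows "(\<exists>z. (\<Sum>j=1..n. \<tau> (dist (x j) z)) < c) \<longleftrightarrow> (\<exists>(u, k)\<in>risk_below n c. x \<in> box n u k)"
proof
  assume "\<exists>z. (\<Sum>j=1..n. \<tau> (dist (x j) z)) < c"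
  then obtain z where z: "(\<Sum>j=1..n. \<tau> (dist (x j) z)) < c" by blast
  \<comment> \<open>Continuity of \<tau> leaves room: every distance may grow by 2 / (k + 1), the
    bound on the distance of two points in one box, while the risk stays below c.\<close>
  have "(\<lambda>k. \<Sum>j=1..n. \<tau> (dist (x j) z + 2 * (1 / real (Suc k)))) \<longlonglongrightarrow> (\<Sum>j=1..n. \<tau> (dist (x j) z + 2 * 0))"
  proof (intro tendsto_sum)
    fix j
    have "(\<lambda>k. dist (x j) z + 2 * (1 / real (Suc k))) \<longlonglongrightarrow> dist (x j) z + 2 * 0"
      by (intro tendsto_intros LIMSEQ_Suc[OF lim_1_over_n])
    then show "(\<lambda>k. \<tau> (dist (x j) z + 2 * (1 / real (Suc k)))) \<longlonglongrightarrow> \<tau> (dist (x j) z + 2 * 0)"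
      by (rule continuous_on_tendsto_compose[OF tau_continuous]) auto
  qed
  then have "\<forall>\<^sub>F k in sequentially. (\<Sum>j=1..n. \<tau> (dist (x j) z + 2 * (1 / real (Suc k)))) < c"
    using z by (intro order_tendstoD(2)) auto
  then obtain k where k: "(\<Sum>j=1..n. \<tau> (dist (x j) z + 2 * (1 / real (Suc k)))) < c"
    by (auto simp: eventually_sequentially)
  have "\<exists>l. dist (x j) (s l) < 1 / real (Suc k)" if "j \<in> {1..n}" for j
    using closure_range_approx[OF x[OF that], of "1 / real (Suc k)"] by auto
  then obtain v where v: "\<And>j. j \<in> {1..n} \<Longrightarrow> dist (x j) (s (v j)) < 1 / real (Suc k)" by metis
  \<comment> \<open>Position 0 of the list is a dummy entry, so that \<open>u ! j\<close> follows
    the numbering from 1.\<close>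
  define u where "u = map v [0..<Suc n]"
  have u: "u ! j = v j" if "j \<in> {1..n}" for j using that by (simp add: u_def del: upt_Suc)
  have "x \<in> box n u k" using v u by (simp add: box_def)
  moreover have "(u, k) \<in> risk_below n c"
  proof -
    have "(\<Sum>j=1..n. \<tau> (dist (x' j) z)) < c" if "x' \<in> box n u k" for x'
    proof -
      have "(\<Sum>j=1..n. \<tau> (dist (x' j) z)) \<le> (\<Sum>j=1..n. \<tau> (dist (x j) z + 2 * (1 / real (Suc k))))"
      proof (intro sum_mono tau_mono)
        fix j assume j: "j \<in> {1..n}"
        have "dist (x' j) z \<le> dist (x' j) (s (u ! j)) + dist (s (u ! j)) z" by (rule dist_triangle)
        also have "dist (s (u ! j)) z \<le> dist (s (u ! j)) (x j) + dist (x j) z" by (rule dist_triangle)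
        finally show "dist (x' j) z \<le> dist (x j) z + 2 * (1 / real (Suc k))"
          using bspec[OF that[unfolded box_def mem_Collect_eq] j] v[OF j] u[OF j] by (simp add: dist_commute)
      qed auto
      with k show ?thesis by simp
    qed
    then show ?thesis by (auto simp: risk_below_def)
  qed
  ultimately show "\<exists>(u, k)\<in>risk_below n c. x \<in> box n u k" by blast
qed (auto simp: risk_below_def)

lemma box_meas: "{x \<in> space (PB n). x \<in> box n u k} \<in> sets (PB n)"
  unfolding box_def mem_Collect_eq by measurable

text \<open>For samples in the closure of the dense sequence, minimality is equivalent to the
  measurable condition Q, whose almost sure validity depends only on the law of the tuple.\<close>

lemma AE_argmin_tup:
  assumes F [measurable]: "F \<in> measurable (PB n) borel"
    and \<beta>: "inj_on \<beta> {1..n}" "\<beta> ` {1..n} \<subseteq> {1..}" "n \<ge> 1"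
    and min: "AE w in M. \<forall>z. (\<Sum>j=1..n. \<tau> (dist (X j w) (F (tup id n w)))) \<le> (\<Sum>j=1..n. \<tau> (dist (X j w) z))"
  shows "AE w in M. \<forall>z. (\<Sum>j=1..n. \<tau> (dist (X (\<beta> j) w) (F (tup \<beta> n w)))) \<le> (\<Sum>j=1..n. \<tau> (dist (X (\<beta> j) w) z))"
proof -
  let ?P = "PB n"
  define L where "L x = (\<Sum>j=1..n. \<tau> \<bar>dS (x j) (F x)\<bar>)" for x
  have [measurable]: "L \<in> borel_measurable ?P"
  proof -
    have "(\<lambda>x. \<tau> \<bar>dS (x j) (F x)\<bar>) \<in> borel_measurable ?P" if "j \<in> {1..n}" for j
      using that by (intro measurable_compose[OF _ measurable_tau] dS_meas measurable_component_singleton F)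
    then show ?thesis unfolding L_def[abs_def] by (intro borel_measurable_sum)
  qed
  \<comment> \<open>Minimality in countable form: whenever some z has risk below a rational level c,
    which the boxes detect, so does F x.\<close>
  define Q where "Q x \<longleftrightarrow> (\<forall>c\<in>\<rat>. \<forall>(u, k)\<in>risk_below n c. x \<in> box n u k \<longrightarrow> L x < c)" for x
  have Q: "{x \<in> space ?P. Q x} \<in> sets ?P"
  proof -
    have "{x \<in> space ?P. x \<in> box n u k \<longrightarrow> L x < c} \<in> sets ?P" for u k c
    proof -
      have "{x \<in> space ?P. x \<in> box n u k \<longrightarrow> L x < c} =
        (space ?P - {x \<in> space ?P. x \<in> box n u k}) \<union> {x \<in> space ?P. L x < c}" by auto
      also have "... \<in> sets ?P" using box_meas by measurable
      finally show ?thesis .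
    qed
    then have "{x \<in> space ?P. \<forall>(u, k)\<in>risk_below n c. x \<in> box n u k \<longrightarrow> L x < c} \<in> sets ?P" for c
      unfolding split_def by (intro sets.sets_Collect_countable_Ball) auto
    then show ?thesis unfolding Q_def by (rule sets.sets_Collect_countable_All'[OF _ countable_rat])
  qed
  have iff: "Q (tup \<beta> n w) \<longleftrightarrow> (\<forall>z. (\<Sum>j=1..n. \<tau> (dist (X (\<beta> j) w) (F (tup \<beta> n w)))) \<le> (\<Sum>j=1..n. \<tau> (dist (X (\<beta> j) w) z)))"
    if dense: "\<forall>j\<in>{1..}. X j w \<in> closure (range s)" and \<beta>: "\<beta> ` {1..n} \<subseteq> {1..}" for w \<beta>
  proof -
    let ?x = "tup \<beta> n w"
    have x: "?x j = X (\<beta> j) w" "?x j \<in> closure (range s)" if "j \<in> {1..n}" for j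
      using that dense \<beta> by (auto simp: tup_def image_subset_iff)
    have L: "L ?x = (\<Sum>j=1..n. \<tau> (dist (X (\<beta> j) w) (F ?x)))"
      unfolding L_def using x by (intro sum.cong refl) (simp add: dS_eq)
    have S: "(\<Sum>j=1..n. \<tau> (dist (?x j) z)) = (\<Sum>j=1..n. \<tau> (dist (X (\<beta> j) w) z))" for z
      using x by (intro sum.cong refl) simp
    have "Q ?x \<longleftrightarrow> (\<forall>c\<in>\<rat>. (\<exists>z. (\<Sum>j=1..n. \<tau> (dist (?x j) z)) < c) \<longrightarrow> L ?x < c)"
      unfolding Q_def using risk_below_iff[of n ?x, OF x(2)] by blast
    also have "... \<longleftrightarrow> (\<forall>z. L ?x \<le> (\<Sum>j=1..n. \<tau> (dist (?x j) z)))"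
    proof safe
      fix z assume *: "\<forall>c\<in>\<rat>. (\<exists>z. (\<Sum>j=1..n. \<tau> (dist (?x j) z)) < c) \<longrightarrow> L ?x < c"
      show "L ?x \<le> (\<Sum>j=1..n. \<tau> (dist (?x j) z))"
      proof (rule ccontr)
        assume "\<not> ?thesis"
        then obtain c where "c \<in> \<rat>" "(\<Sum>j=1..n. \<tau> (dist (?x j) z)) < c" "c < L ?x"
          using Rats_dense_in_real[of "\<Sum>j=1..n. \<tau> (dist (?x j) z)" "L ?x"] by auto
        with * show False by (meson less_asym)
      qed
    qed (meson le_less_trans)
    finally show ?thesis unfolding L S .
  qed
  have "AE w in M. Q (tup id n w)"
    using min X_dense_all by eventually_elim (subst iff, auto)
  then have "AE w in M. Q (tup \<beta> n w)" by (rule AE_tup[OF \<beta> Q])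
  with X_dense_all show ?thesis
  proof eventually_elim
    case (elim w)
    then show ?case using iff[OF _ \<beta>(2)] by blast
  qed
qed

end

section \<open>The excess risk\<close>

context transform
begin

lemma measurable_tau_dist [measurable (raw)]:
  fixes f :: "'b \<Rightarrow> 'c::metric_space"
  assumes [measurable]: "f \<in> borel_measurable K"
  shows "(\<lambda>x. \<tau> (dist (f x) q)) \<in> borel_measurable K" "(\<lambda>x. \<tau> (dist q (f x))) \<in> borel_measurable K"
proof -
  have "(\<lambda>x. \<tau> \<bar>dist (f x) q\<bar>) \<in> borel_measurable K" by measurable
  then show "(\<lambda>x. \<tau> (dist (f x) q)) \<in> borel_measurable K" by simp
  then show "(\<lambda>x. \<tau> (dist q (f x))) \<in> borel_measurable K" by (simp add: dist_commute)
qed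

end

lemma (in separable_sample) tau_diff_integrable:
  assumes "integrable M (\<lambda>w. a (dist (Y w) m))"
  shows "integrable M (\<lambda>w. \<tau> (dist (Y w) q) - \<tau> (dist (Y w) m))"
proof (rule Bochner_Integration.integrable_bound)
  show "integrable M (\<lambda>w. dist m q * (a (dist (Y w) m) + a (dist m q)))"
    using assms by auto
  show "AE w in M. norm (\<tau> (dist (Y w) q) - \<tau> (dist (Y w) m)) \<le> norm (dist m q * (a (dist (Y w) m) + a (dist m q)))"
    using tau_dist_diff_abs[of _ q m] a_nonneg by (intro AE_I2) (auto simp: abs_mult intro: order_trans)
qed measurable

text \<open>The functions F n are kept as data because they are also evaluated at subsamples, which
  produces the empirical means without one observation.\<close>

locale frechet_sample = separable_sample \<tau> M Y X s
  for \<tau> and M :: "'w measure" and Y :: "'w \<Rightarrow> 'a::hadamard_space" and X s +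
  fixes m :: 'a and mn :: "nat \<Rightarrow> 'w \<Rightarrow> 'a" and F :: "nat \<Rightarrow> (nat \<Rightarrow> 'a) \<Rightarrow> 'a"
  assumes a_int: "integrable M (\<lambda>w. a (dist (Y w) m))"
    and m_min: "\<And>q. 0 \<le> (\<integral>w. \<tau> (dist (Y w) q) - \<tau> (dist (Y w) m) \<partial>M)"
    and F_meas: "\<And>n. n \<ge> 1 \<Longrightarrow> F n \<in> measurable (PB n) borel"
    and mn_eq: "\<And>n w. n \<ge> 1 \<Longrightarrow> w \<in> space M \<Longrightarrow> mn n w = F n (\<lambda>j\<in>{1..n}. X j w)"
    and mn_min: "\<And>n. n \<ge> 1 \<Longrightarrow> AE w in M. \<forall>z. (\<Sum>j=1..n. \<tau> (dist (X j w) (mn n w))) \<le> (\<Sum>j=1..n. \<tau> (dist (X j w) z))"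
begin

definition excess :: "'a \<Rightarrow> real" where
  "excess q = (\<integral>w. \<tau> (dist (Y w) q) - \<tau> (dist (Y w) m) \<partial>M)"

abbreviation \<sigma> :: real where "\<sigma> \<equiv> expectation (\<lambda>w. a (dist (Y w) m))"

lemma mn_tup: "n \<ge> 1 \<Longrightarrow> w \<in> space M \<Longrightarrow> mn n w = F n (tup id n w)"
  by (simp add: mn_eq tup_def)

lemma tup_id_meas [measurable]: "tup id n \<in> measurable M (PB n)"
  by (intro tup_meas) auto

lemma mn_meas [measurable]: assumes "n \<ge> 1" shows "mn n \<in> borel_measurable M"
proof -
  have "(\<lambda>w. F n (tup id n w)) \<in> borel_measurable M"
    by (rule measurable_compose[OF tup_id_meas F_meas[OF assms]])
  then show ?thesis by (rule measurable_cong[THEN iffD1, rotated]) (simp add: mn_tup assms)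
qed

lemma sigma_nonneg: "0 \<le> \<sigma>"
  by (intro integral_nonneg_AE) (simp add: a_nonneg)

lemma a_0_le_sigma: "a 0 \<le> \<sigma>"
proof -
  have "a 0 = (\<integral>w. a 0 \<partial>M)" by (simp add: prob_space)
  also have "... \<le> \<sigma>" using a_int by (intro integral_mono a_mono) auto
  finally show ?thesis .
qed

lemma excess_integrable: "integrable M (\<lambda>w. \<tau> (dist (Y w) q) - \<tau> (dist (Y w) m))"
  using a_int by (rule tau_diff_integrable)

lemma excess_nonneg: "0 \<le> excess q"
  unfolding excess_def by (rule m_min)

lemma excess_m: "excess m = 0"
  by (simp add: excess_def)

lemma excess_lower: "\<tau> (dist m q) - 2 * dist m q * \<sigma> \<le> excess q"
proof -
  have "\<tau> (dist m q) - 2 * dist m q * \<sigma> = (\<integral>w. \<tau> (dist m q) - 2 * dist m q * a (dist (Y w) m) \<partial>M)"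
    using a_int by (simp add: prob_space)
  also have "... \<le> excess q"
    unfolding excess_def using a_int by (intro integral_mono excess_integrable tau_triangle_lower) auto
  finally show ?thesis .
qed

text \<open>Where Y is within c of m, which has probability at least 1/2, midpoints gain with
  modulus \<kappa> (c + D); elsewhere the modulus is 0. The constant 1/4 is this 1/2 times the 1/2
  of \<open>argmin_growth\<close>.\<close>

lemma excess_growth:
  assumes half: "1 / 2 \<le> prob {w \<in> space M. dist (Y w) m \<le> c}" and c: "0 \<le> c" and q: "0 < dist m q"
  shows "(dist m q)\<^sup>2 * \<kappa> (c + dist m q) / 4 \<le> excess q"
proof -
  define D A where "D = dist m q" and "A = {w \<in> space M. dist (Y w) m \<le> c}"
  have D: "0 < D" using q by (simp add: D_def)
  then have k: "0 < \<kappa> (c + D)" using c by (intro kappa_pos) simp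
  have [measurable]: "A \<in> sets M" unfolding A_def by measurable
  define W where "W = \<kappa> (c + D) * prob A"
  have "W * (dist m q)\<^sup>2 / 2 \<le> excess q - excess m"
  proof (rule argmin_growth[where P = "\<lambda>q. dist m q \<le> D"])
    show "0 \<le> W" using k by (simp add: W_def)
    show "excess m \<le> excess q" for q by (simp add: excess_m excess_nonneg)
    fix q u
    assume q: "dist m q \<le> D"
      and u: "\<And>z. (dist z u)\<^sup>2 \<le> (dist z m)\<^sup>2 / 2 + (dist z q)\<^sup>2 / 2 - (dist m q)\<^sup>2 / 4"
    have mu: "dist m u \<le> D"
      using tau_dist_midpoint(2)[OF u, of m D 0] q D lower_slope_0 by simp
    have le: "\<tau> (dist (Y w) u) - \<tau> (dist (Y w) m) \<le> (\<tau> (dist (Y w) q) - \<tau> (dist (Y w) m)) / 2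
        - \<kappa> (c + D) * (dist m q)\<^sup>2 / 8 * indicator A w" if "w \<in> space M" for w
    proof (cases "dist (Y w) m \<le> c")
      case True
      have "dist (Y w) q \<le> dist (Y w) m + dist m q" by (rule dist_triangle)
      then have "\<tau> (dist (Y w) u) \<le> \<tau> (dist (Y w) m) / 2 + \<tau> (dist (Y w) q) / 2 - \<kappa> (c + D) * (dist m q)\<^sup>2 / 8"
        using True q D c by (intro tau_dist_midpoint(1)[OF u, of _ "c + D"] lower_slope_kappa) auto
      then show ?thesis using True that by (simp add: A_def field_simps)
    next
      case False
      have "\<tau> (dist (Y w) u) \<le> \<tau> (dist (Y w) m) / 2 + \<tau> (dist (Y w) q) / 2 - 0 * (dist m q)\<^sup>2 / 8"
        by (rule tau_dist_midpoint(1)[OF u, of _ "max (dist (Y w) m) (dist (Y w) q)"]) (auto simp: lower_slope_0)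
      then show ?thesis using False by (simp add: A_def field_simps)
    qed
    have "excess u \<le> (\<integral>w. (\<tau> (dist (Y w) q) - \<tau> (dist (Y w) m)) / 2 - \<kappa> (c + D) * (dist m q)\<^sup>2 / 8 * indicator A w \<partial>M)"
      unfolding excess_def using le
      by (intro integral_mono excess_integrable Bochner_Integration.integrable_diff integrable_divide_zero
          integrable_mult_right integrable_real_indicator) (auto simp: less_top[symmetric])
    also have "... = excess q / 2 - \<kappa> (c + D) * (dist m q)\<^sup>2 / 8 * prob A"
      unfolding excess_def
      by (subst Bochner_Integration.integral_diff)
         (auto intro!: excess_integrable integrable_divide_zero simp: less_top[symmetric])
    finally show "dist m u \<le> D \<and> excess u \<le> excess m / 2 + excess q / 2 - W * (dist m q)\<^sup>2 / 8"
      using mu by (simp add: excess_m W_def mult_ac)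
  qed (simp add: D_def)
  moreover have "D\<^sup>2 * \<kappa> (c + D) / 4 \<le> W * D\<^sup>2 / 2"
    using mult_left_mono[OF half, of "\<kappa> (c + D) * D\<^sup>2 / 2"] k D by (simp add: W_def A_def mult_ac)
  ultimately show ?thesis by (simp add: excess_m D_def mult_ac)
qed

text \<open>Fubini: the tuple avoids k, so integrating over observation k first yields the excess
  risk of the empirical mean. The substitute \<open>dS\<close> makes the integrand jointly
  measurable, and B supplies integrability.\<close>

lemma integral_loo:
  assumes n: "n \<ge> 1" and \<beta>: "inj_on \<beta> {1..n}" "\<beta> ` {1..n} \<subseteq> {1..}" and k: "k \<ge> 1" "k \<notin> \<beta> ` {1..n}"
    and U_def: "\<And>w. U w = \<tau> \<bar>dS (X k w) (F n (tup \<beta> n w))\<bar> - \<tau> (dist (X k w) m)"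
    and B: "AE w in M. \<bar>U w\<bar> \<le> B w" "(\<integral>\<^sup>+w. ennreal (B w) \<partial>M) < \<infinity>"
  shows "integrable M U" "integrable M (\<lambda>w. excess (mn n w))" "(\<integral>w. U w \<partial>M) = (\<integral>w. excess (mn n w) \<partial>M)"
proof -
  let ?P = "PB n"
  let ?T = "distr M ?P (tup id n)"
  let ?Q = "\<lambda>w. (X k w, tup \<beta> n w)"
  have [measurable]: "tup \<beta> n \<in> measurable M ?P" "X k \<in> borel_measurable M" "F n \<in> measurable ?P borel"
    using \<beta> k n F_meas by auto
  interpret T: prob_space ?T by (rule prob_space_distr) simp
  interpret N: prob_space N by (rule prob_space_distr) simp
  interpret NT: pair_sigma_finite N ?T ..
  define \<Phi> where "\<Phi> y x = \<tau> \<bar>dS y (F n x)\<bar> - \<tau> (dist y m)" for y x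
  have \<Phi>_meas [measurable]: "case_prod \<Phi> \<in> borel_measurable (borel \<Otimes>\<^sub>M ?P)"
    unfolding \<Phi>_def[abs_def] by measurable
  have U: "U w = case_prod \<Phi> (?Q w)" for w by (simp add: U_def \<Phi>_def)
  have Ueq: "U = (\<lambda>w. case_prod \<Phi> (?Q w))" by (rule ext) (rule U)
  have law: "distr M (borel \<Otimes>\<^sub>M ?P) ?Q = N \<Otimes>\<^sub>M ?T" using \<beta> n k by (rule pair_law)
  show iU: "integrable M U"
  proof (rule integrableI_bounded)
    show "U \<in> borel_measurable M" unfolding U_def[abs_def] by measurable
    have "(\<integral>\<^sup>+w. ennreal (norm (U w)) \<partial>M) \<le> (\<integral>\<^sup>+w. ennreal (B w) \<partial>M)"
      using B(1) by (intro nn_integral_mono_AE) (auto intro: ennreal_leI)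
    then show "(\<integral>\<^sup>+w. ennreal (norm (U w)) \<partial>M) < \<infinity>" using B(2) by (rule le_less_trans)
  qed
  then have "integrable (distr M (borel \<Otimes>\<^sub>M ?P) ?Q) (case_prod \<Phi>)"
    unfolding Ueq by (subst integrable_distr_eq) auto
  then have i\<Phi>: "integrable (N \<Otimes>\<^sub>M ?T) (case_prod \<Phi>)" by (simp only: law)
  have inner: "(\<integral>y. \<Phi> y x \<partial>N) = excess (F n x)" if "x \<in> space ?P" for x
  proof -
    have [measurable]: "(\<lambda>y. \<Phi> y x) \<in> borel_measurable borel" using that by measurable
    have "(\<integral>y. \<Phi> y x \<partial>N) = (\<integral>w. \<Phi> (Y w) x \<partial>M)" by (rule integral_distr) auto
    also have "... = (\<integral>w. \<tau> (dist (Y w) (F n x)) - \<tau> (dist (Y w) m) \<partial>M)"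
    proof (rule integral_cong_AE)
      show "AE w in M. \<Phi> (Y w) x = \<tau> (dist (Y w) (F n x)) - \<tau> (dist (Y w) m)"
        using Y_dense by eventually_elim (simp add: \<Phi>_def dS_eq)
    qed measurable
    finally show ?thesis by (simp add: excess_def)
  qed
  have "integrable ?T (\<lambda>x. \<integral>y. \<Phi> y x \<partial>N)" by (rule NT.integrable_snd[OF i\<Phi>])
  moreover have "integrable ?T (\<lambda>x. \<integral>y. \<Phi> y x \<partial>N) = integrable ?T (\<lambda>x. excess (F n x))"
    by (rule Bochner_Integration.integrable_cong) (auto simp: inner)
  ultimately have iT: "integrable ?T (\<lambda>x. excess (F n x))" by simp
  then have "(\<lambda>x. excess (F n x)) \<in> borel_measurable ?P"
    by (auto dest: borel_measurable_integrable)
  note [measurable] = this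
  have "integrable M (\<lambda>w. excess (F n (tup id n w)))"
    using iT by (subst (asm) integrable_distr_eq) auto
  then show "integrable M (\<lambda>w. excess (mn n w))"
    by (rule Bochner_Integration.integrable_cong[THEN iffD1, rotated 2]) (auto simp: mn_tup n)
  have "(\<integral>w. U w \<partial>M) = (\<integral>z. case_prod \<Phi> z \<partial>distr M (borel \<Otimes>\<^sub>M ?P) ?Q)"
    unfolding Ueq by (subst integral_distr) auto
  also have "... = (\<integral>z. case_prod \<Phi> z \<partial>(N \<Otimes>\<^sub>M ?T))" by (simp only: law)
  also have "... = (\<integral>x. (\<integral>y. \<Phi> y x \<partial>N) \<partial>?T)" by (rule NT.integral_snd[OF i\<Phi>, symmetric])
  also have "... = (\<integral>x. excess (F n x) \<partial>?T)"
    by (rule Bochner_Integration.integral_cong) (auto simp: inner)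
  also have "... = (\<integral>w. excess (F n (tup id n w)) \<partial>M)" by (rule integral_distr) auto
  also have "... = (\<integral>w. excess (mn n w) \<partial>M)"
    by (rule Bochner_Integration.integral_cong) (auto simp: mn_tup n)
  finally show "(\<integral>w. U w \<partial>M) = (\<integral>w. excess (mn n w) \<partial>M)" .
qed

text \<open>The last index n + 1 takes the place of the omitted i; for i = n + 1 this is the
  identity on {1..n}.\<close>

definition skip :: "nat \<Rightarrow> nat \<Rightarrow> nat \<Rightarrow> nat" where
  "skip n i j = (if j = i then Suc n else j)"

lemma skip_inj: "inj_on (skip n i) {1..n}"
  by (auto simp: inj_on_def skip_def)

lemma skip_image: assumes "i \<in> {1..Suc n}" shows "skip n i ` {1..n} = {1..Suc n} - {i}"
proof (intro equalityI subsetI)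
  fix j assume "j \<in> {1..Suc n} - {i}"
  then show "j \<in> skip n i ` {1..n}"
    using assms by (intro image_eqI[of _ _ "if j = Suc n then i else j"]) (auto simp: skip_def)
qed (use assms in \<open>auto simp: skip_def\<close>)

lemma skip_subset: "i \<in> {1..Suc n} \<Longrightarrow> skip n i ` {1..n} \<subseteq> {1..}"
  and skip_notin: "i \<in> {1..Suc n} \<Longrightarrow> i \<notin> skip n i ` {1..n}"
  by (auto simp: skip_image simp del: image_eqI)

lemma sum_skip:
  fixes f :: "nat \<Rightarrow> real"
  assumes "i \<in> {1..Suc n}" shows "(\<Sum>j=1..n. f (skip n i j)) = (\<Sum>j\<in>{1..Suc n} - {i}. f j)"
  by (rule sum.reindex_bij_betw) (use assms skip_inj in \<open>auto simp: bij_betw_def skip_image\<close>)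

abbreviation dm :: "'w \<Rightarrow> nat \<Rightarrow> real" where "dm w j \<equiv> dist (X j w) m"

text \<open>Each \<open>U i\<close> integrates to the expected excess risk; \<open>fin\<close> and
  \<open>loo_dist_diff_abs\<close> make it integrable. The bounds B i stay open because (i) and (ii)
  use different ones.\<close>

lemma excess_bound:
  fixes B :: "nat \<Rightarrow> 'w \<Rightarrow> real"
  assumes n: "n \<ge> 1"
    and fin: "\<And>i. i \<in> {1..Suc n} \<Longrightarrow> (\<integral>\<^sup>+w. ennreal (loo_total {1..Suc n} i (dm w)) \<partial>M) < \<infinity>"
    and B_meas: "\<And>i. i \<in> {1..Suc n} \<Longrightarrow> B i \<in> borel_measurable M" and B_nonneg: "\<And>i w. 0 \<le> B i w"
    and B: "\<And>i. i \<in> {1..Suc n} \<Longrightarrow> (\<integral>\<^sup>+w. ennreal (B i w) \<partial>M) \<le> C"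
    and le: "\<And>i w p q. i \<in> {1..Suc n} \<Longrightarrow> w \<in> space M \<Longrightarrow> leave_one_out \<tau> {1..Suc n} i (\<lambda>j. X j w) p q \<Longrightarrow>
       \<tau> (dist (X i w) q) - \<tau> (dist (X i w) p) \<le> B i w"
  shows "(\<integral>\<^sup>+w. ennreal (excess (mn n w)) \<partial>M) \<le> C"
proof (cases "C = \<infinity>")
  case False
  let ?I = "{1..Suc n}"
  define q where "q i w = F n (tup (skip n i) n w)" for i w
  define p where "p = mn (Suc n)"
  define U where "U i w = \<tau> \<bar>dS (X i w) (q i w)\<bar> - \<tau> (dm w i)" for i w
  have p_min: "AE w in M. \<forall>z. (\<Sum>j\<in>?I. \<tau> (dist (X j w) (p w))) \<le> (\<Sum>j\<in>?I. \<tau> (dist (X j w) z))"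
    unfolding p_def by (rule mn_min) simp
  have q_min: "AE w in M. \<forall>z. (\<Sum>j\<in>?I - {i}. \<tau> (dist (X j w) (q i w))) \<le> (\<Sum>j\<in>?I - {i}. \<tau> (dist (X j w) z))"
    if i: "i \<in> ?I" for i
  proof -
    have "AE w in M. \<forall>z. (\<Sum>j=1..n. \<tau> (dist (X j w) (F n (tup id n w)))) \<le> (\<Sum>j=1..n. \<tau> (dist (X j w) z))"
      using mn_min[OF n] AE_space by eventually_elim (simp add: mn_tup n)
    from AE_argmin_tup[OF F_meas[OF n] skip_inj skip_subset[OF i] n this]
    show ?thesis unfolding q_def[symmetric] sum_skip[OF i, of "\<lambda>j. \<tau> (dist (X j _) _)"] .
  qed
  have loo: "AE w in M. leave_one_out \<tau> ?I i (\<lambda>j. X j w) (p w) (q i w)" if i: "i \<in> ?I" for i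
    using p_min q_min[OF i]
    by eventually_elim (use i n in \<open>auto simp: leave_one_out_def leave_one_out_axioms_def transform_axioms\<close>)
  have "AE w in M. \<bar>U i w\<bar> \<le> loo_total ?I i (dm w)" if i: "i \<in> ?I" for i
    using loo[OF i] X_dense_all
  proof eventually_elim
    case (elim w)
    interpret leave_one_out \<tau> ?I i "\<lambda>j. X j w" m "p w" "q i w" by (rule elim(1))
    show ?case using loo_dist_diff_abs elim(2) i by (simp add: U_def dS_eq d_def[abs_def])
  qed
  note loo' = integral_loo[OF n skip_inj skip_subset _ skip_notin U_def[unfolded q_def] this fin]
  have iU: "integrable M (U i)" and iE: "integrable M (\<lambda>w. excess (mn n w))"
    and eq: "(\<integral>w. U i w \<partial>M) = (\<integral>w. excess (mn n w) \<partial>M)" if "i \<in> ?I" for i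
    using loo'[of i] that by auto
  have iB: "integrable M (B i)" "(\<integral>w. B i w \<partial>M) \<le> enn2real C" if i: "i \<in> ?I" for i
  proof -
    have "(\<integral>\<^sup>+w. ennreal (B i w) \<partial>M) < \<infinity>" using B[OF i] False by (auto simp: less_top intro: le_less_trans)
    then show iB: "integrable M (B i)" using B_meas[OF i] B_nonneg by (intro integrableI_nonneg) auto
    have "ennreal (\<integral>w. B i w \<partial>M) \<le> C"
      using B[OF i] nn_integral_eq_integral[OF iB] B_nonneg by simp
    then have "ennreal (\<integral>w. B i w \<partial>M) \<le> ennreal (enn2real C)" using False by (simp add: less_top)
    then show "(\<integral>w. B i w \<partial>M) \<le> enn2real C" by (simp add: ennreal_le_iff)
  qed
  have "AE w in M. \<forall>i\<in>?I. leave_one_out \<tau> ?I i (\<lambda>j. X j w) (p w) (q i w)"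
    using loo by (intro AE_finite_allI) auto
  then have "AE w in M. (\<Sum>i\<in>?I. U i w) \<le> (\<Sum>i\<in>?I. B i w)"
    using p_min X_dense_all AE_space
  proof eventually_elim
    case (elim w)
    have "(\<Sum>i\<in>?I. U i w) \<le> (\<Sum>i\<in>?I. B i w + (\<tau> (dist (X i w) (p w)) - \<tau> (dm w i)))"
    proof (rule sum_mono)
      fix i assume i: "i \<in> ?I"
      have "\<tau> (dist (X i w) (q i w)) - \<tau> (dist (X i w) (p w)) \<le> B i w"
        using le[OF i] elim i by blast
      then show "U i w \<le> B i w + (\<tau> (dist (X i w) (p w)) - \<tau> (dm w i))"
        using elim(3) i by (simp add: U_def dS_eq)
    qed
    \<comment> \<open>The remaining sum is the empirical risk of p on all points minus that of m,
      hence not positive.\<close>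
    also have "... \<le> (\<Sum>i\<in>?I. B i w)"
      using elim(2)[rule_format, of m] by (simp add: sum.distrib sum_subtractf)
    finally show ?case .
  qed
  then have "(\<integral>w. (\<Sum>i\<in>?I. U i w) \<partial>M) \<le> (\<integral>w. (\<Sum>i\<in>?I. B i w) \<partial>M)"
    using iU iB by (intro integral_mono_AE Bochner_Integration.integrable_sum)
  then have "(\<Sum>i\<in>?I. \<integral>w. U i w \<partial>M) \<le> (\<Sum>i\<in>?I. \<integral>w. B i w \<partial>M)"
    using iU iB by (subst (asm) (1 2) Bochner_Integration.integral_sum) auto
  also have "... \<le> (\<Sum>i\<in>?I. enn2real C)" by (intro sum_mono iB)
  finally have "real (Suc n) * (\<integral>w. excess (mn n w) \<partial>M) \<le> real (Suc n) * enn2real C"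
    using eq by simp
  then have "(\<integral>w. excess (mn n w) \<partial>M) \<le> enn2real C" by (rule mult_left_le_imp_le) simp
  moreover have "(\<integral>\<^sup>+w. ennreal (excess (mn n w)) \<partial>M) = ennreal (\<integral>w. excess (mn n w) \<partial>M)"
    using iE[of 1] by (intro nn_integral_eq_integral) (auto simp: excess_nonneg)
  ultimately show ?thesis using False by (simp add: less_top ennreal_leI le_ennreal_iff) (metis ennreal_enn2real ennreal_leI less_top)
qed simp

end

lemma ennreal_sum_mult:
  assumes "\<And>k. 0 \<le> w k" "\<And>k. 0 \<le> b k"
  shows "ennreal (\<Sum>k\<in>I. w k * b k) = (\<Sum>k\<in>I. ennreal (w k) * ennreal (b k))"
  using assms by (simp add: sum_ennreal[symmetric] ennreal_mult)

context frechet_sample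
begin

abbreviation dY :: "'w \<Rightarrow> real" where "dY w \<equiv> dist (Y w) m"

lemma nn_integral_dm:
  assumes "k \<ge> 1" and [measurable]: "u \<in> borel_measurable borel"
  shows "(\<integral>\<^sup>+w. u (dm w k) \<partial>M) = (\<integral>\<^sup>+w. u (dY w) \<partial>M)"
  by (rule nn_integral_X[OF assms(1), of "\<lambda>y. u (dist y m)"]) measurable

lemma nn_integral_loo_square:
  assumes n: "n \<ge> 1" and i: "i \<in> {1..Suc n}"
  shows "(\<integral>\<^sup>+w. ennreal (loo_square {1..Suc n} i (dm w)) \<partial>M) = 25 * (\<integral>\<^sup>+w. ennreal ((a (dY w))\<^sup>2) \<partial>M)"
proof -
  let ?I = "{1..Suc n}" and ?E = "\<integral>\<^sup>+w. ennreal ((a (dY w))\<^sup>2) \<partial>M"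
  have "(\<integral>\<^sup>+w. ennreal (loo_square ?I i (dm w)) \<partial>M)
     = (\<integral>\<^sup>+w. (\<Sum>k\<in>?I. ennreal (loo_weight ?I i k) * ennreal ((a (dm w k))\<^sup>2)) \<partial>M)"
    unfolding loo_square_def
    by (intro nn_integral_cong ennreal_sum_mult loo_weight_nonneg) simp
  also have "... = (\<Sum>k\<in>?I. \<integral>\<^sup>+w. ennreal (loo_weight ?I i k) * ennreal ((a (dm w k))\<^sup>2) \<partial>M)"
    by (rule nn_integral_sum) measurable
  also have "... = (\<Sum>k\<in>?I. ennreal (loo_weight ?I i k) * ?E)"
  proof (intro sum.cong refl)
    fix k assume "k \<in> ?I"
    then have k: "k \<ge> 1" by simp
    then have "(\<integral>\<^sup>+w. ennreal ((a (dm w k))\<^sup>2) \<partial>M) = ?E"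
      by (rule nn_integral_dm[of _ "\<lambda>x. ennreal ((a x)\<^sup>2)"]) measurable
    then show "(\<integral>\<^sup>+w. ennreal (loo_weight ?I i k) * ennreal ((a (dm w k))\<^sup>2) \<partial>M) = ennreal (loo_weight ?I i k) * ?E"
      using k by (subst nn_integral_cmult) auto
  qed
  also have "... = ennreal (\<Sum>k\<in>?I. loo_weight ?I i k) * ?E"
    by (simp only: sum_distrib_right[symmetric] sum_ennreal loo_weight_nonneg)
  also have "(\<Sum>k\<in>?I. loo_weight ?I i k) = 25" using n i by (intro sum_loo_weight) auto
  finally show ?thesis by simp
qed

text \<open>In summand k, f (d k) is independent of \<gamma> (d j) for j \<noteq> k and of the
  average without k. The diagonal j = k gives the term with 1 / n, and the last term involves
  observation k alone.\<close>

lemma nn_integral_loo_bound: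
  fixes f \<gamma> \<eta> :: "real \<Rightarrow> real"
  assumes n: "n \<ge> 1" and i: "i \<in> {1..Suc n}"
    and [measurable]: "f \<in> borel_measurable borel" "\<gamma> \<in> borel_measurable borel" "\<eta> \<in> borel_measurable borel"
    and nn: "\<And>x. 0 \<le> f x" "\<And>x. 0 \<le> \<gamma> x" "\<And>x. 0 \<le> \<eta> x"
  shows "(\<integral>\<^sup>+w. ennreal (loo_bound {1..Suc n} i f \<gamma> \<eta> (dm w)) \<partial>M)
    \<le> 25 * ((\<integral>\<^sup>+w. ennreal (f (dY w)) \<partial>M) * (\<integral>\<^sup>+w. ennreal (\<gamma> (dY w)) \<partial>M)
       + ennreal (1 / real n) * (\<integral>\<^sup>+w. ennreal (f (dY w) * \<gamma> (dY w)) \<partial>M)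
       + (\<integral>\<^sup>+w. ennreal (f (dY w)) \<partial>M) * (\<integral>\<^sup>+w. ennreal (\<eta> (2 * sigma_hat X m a n w)) \<partial>M)
       + (\<integral>\<^sup>+w. ennreal (f (dY w) * \<eta> (a (dY w) / real n)) \<partial>M))"
    (is "_ \<le> 25 * (?Ef * ?Eg + _ * ?Efg + ?Ef * ?Eh + ?Efh)")
proof -
  let ?I = "{1..Suc n}" and ?w = "ennreal (1 / real n)"
  have n0: "0 < real n" using n by simp
  have dm_meas [measurable]: "k \<in> ?I \<Longrightarrow> (\<lambda>w. dm w k) \<in> borel_measurable M" for k by measurable
  define A where "A w k = f (dm w k) *
     ((\<Sum>j\<in>?I - {i}. \<gamma> (dm w j)) / real n + \<eta> (2 * ((\<Sum>j\<in>?I - {k}. a (dm w j)) / real n)) + \<eta> (a (dm w k) / real n))" for w k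
  have A0: "0 \<le> A w k" for w k
    unfolding A_def by (intro mult_nonneg_nonneg add_nonneg_nonneg divide_nonneg_nonneg sum_nonneg nn) simp
  have A_meas [measurable]: "k \<in> ?I \<Longrightarrow> (\<lambda>w. A w k) \<in> borel_measurable M" for k
    unfolding A_def by measurable
  have bound: "(\<integral>\<^sup>+w. ennreal (A w k) \<partial>M) \<le> ?Ef * ?Eg + ?w * ?Efg + ?Ef * ?Eh + ?Efh" if k: "k \<in> ?I" for k
  proof -
    have k1: "k \<ge> 1" using k by simp
    \<comment> \<open>The average without k as a function of a tuple; on \<open>tup id n\<close> it
      becomes the empirical average of the first n observations.\<close>
    define \<Psi> where "\<Psi> x = ennreal (\<eta> (2 * ((\<Sum>j=1..n. a (dist (x j) m)) / real n)))" for x :: "nat \<Rightarrow> 'a"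
    have \<Psi>_meas [measurable]: "\<Psi> \<in> borel_measurable (PB n)"
      unfolding \<Psi>_def by measurable
    have \<Psi>_skip: "\<Psi> (tup (skip n k) n w) = ennreal (\<eta> (2 * ((\<Sum>j\<in>?I - {k}. a (dm w j)) / real n)))" for w
    proof -
      have "(\<Sum>j=1..n. a (dist (tup (skip n k) n w j) m)) = (\<Sum>j=1..n. a (dm w (skip n k j)))"
        by (intro sum.cong) (auto simp: tup_def)
      also have "... = (\<Sum>j\<in>?I - {k}. a (dm w j))" by (rule sum_skip[OF k])
      finally show ?thesis by (simp add: \<Psi>_def)
    qed
    have \<Psi>_id: "\<Psi> (tup id n w) = ennreal (\<eta> (2 * sigma_hat X m a n w))" for w
      by (simp add: \<Psi>_def tup_def sigma_hat_def)
    have [measurable]: "tup (skip n k) n \<in> measurable M (PB n)"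
      by (rule tup_meas[OF skip_subset[OF k]])
    have eq: "ennreal (A w k) = (\<Sum>j\<in>?I - {i}. ?w * (ennreal (f (dm w k)) * ennreal (\<gamma> (dm w j))))
       + ennreal (f (dm w k)) * \<Psi> (tup (skip n k) n w) + ennreal (f (dm w k) * \<eta> (a (dm w k) / real n))" for w
    proof -
      have "A w k = (\<Sum>j\<in>?I - {i}. 1 / real n * (f (dm w k) * \<gamma> (dm w j)))
        + f (dm w k) * \<eta> (2 * ((\<Sum>j\<in>?I - {k}. a (dm w j)) / real n)) + f (dm w k) * \<eta> (a (dm w k) / real n)"
        by (simp add: A_def distrib_left sum_distrib_left sum_divide_distrib)
      also have "ennreal ... = ennreal (\<Sum>j\<in>?I - {i}. 1 / real n * (f (dm w k) * \<gamma> (dm w j)))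
        + ennreal (f (dm w k) * \<eta> (2 * ((\<Sum>j\<in>?I - {k}. a (dm w j)) / real n)))
        + ennreal (f (dm w k) * \<eta> (a (dm w k) / real n))"
        using n0 by (simp add: ennreal_plus nn sum_nonneg)
      also have "ennreal (\<Sum>j\<in>?I - {i}. 1 / real n * (f (dm w k) * \<gamma> (dm w j)))
         = (\<Sum>j\<in>?I - {i}. ?w * (ennreal (f (dm w k)) * ennreal (\<gamma> (dm w j))))"
        using n0 nn by (subst sum_ennreal[symmetric]) (auto simp: ennreal_mult[symmetric])
      finally show ?thesis by (simp add: \<Psi>_skip ennreal_mult nn)
    qed
    define p1 p2 p3 where "p1 w = (\<Sum>j\<in>?I - {i}. ?w * (ennreal (f (dm w k)) * ennreal (\<gamma> (dm w j))))"
      and "p2 w = ennreal (f (dm w k)) * \<Psi> (tup (skip n k) n w)"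
      and "p3 w = ennreal (f (dm w k) * \<eta> (a (dm w k) / real n))" for w
    have [measurable]: "(\<lambda>w. dm w k) \<in> borel_measurable M" using k by (rule dm_meas)
    have prod_meas: "(\<lambda>w. ennreal (f (dm w k)) * ennreal (\<gamma> (dm w j))) \<in> borel_measurable M" if "j \<in> ?I - {i}" for j
    proof -
      have [measurable]: "(\<lambda>w. dm w j) \<in> borel_measurable M" using that by (intro dm_meas) simp
      show ?thesis by measurable
    qed
    have "p1 \<in> borel_measurable M"
      unfolding p1_def[abs_def] by (intro borel_measurable_sum borel_measurable_times_ennreal borel_measurable_const prod_meas)
    moreover have "p2 \<in> borel_measurable M" unfolding p2_def[abs_def] by measurable
    moreover have "p3 \<in> borel_measurable M" unfolding p3_def[abs_def] by measurable
    moreover have "(\<integral>\<^sup>+w. ennreal (A w k) \<partial>M) = (\<integral>\<^sup>+w. p1 w + p2 w + p3 w \<partial>M)"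
      unfolding eq p1_def p2_def p3_def ..
    ultimately have "(\<integral>\<^sup>+w. ennreal (A w k) \<partial>M) = (\<integral>\<^sup>+w. p1 w \<partial>M) + (\<integral>\<^sup>+w. p2 w \<partial>M) + (\<integral>\<^sup>+w. p3 w \<partial>M)"
      by (simp add: nn_integral_add)
    also have "(\<integral>\<^sup>+w. p1 w \<partial>M) = (\<Sum>j\<in>?I - {i}. \<integral>\<^sup>+w. ?w * (ennreal (f (dm w k)) * ennreal (\<gamma> (dm w j))) \<partial>M)"
      unfolding p1_def by (intro nn_integral_sum borel_measurable_times_ennreal borel_measurable_const prod_meas)
    also have "... = (\<Sum>j\<in>?I - {i}. ?w * (\<integral>\<^sup>+w. ennreal (f (dm w k)) * ennreal (\<gamma> (dm w j)) \<partial>M))"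
      by (intro sum.cong refl nn_integral_cmult prod_meas)
    also have "(\<integral>\<^sup>+w. p2 w \<partial>M) = ?Ef * ?Eh"
      unfolding p2_def
      using nn_integral_mult_tup[OF skip_inj skip_subset[OF k] n k1 skip_notin[OF k],
        of "\<lambda>y. ennreal (f (dist y m))" \<Psi>] by (simp add: \<Psi>_id)
    also have "(\<integral>\<^sup>+w. p3 w \<partial>M) = ?Efh"
      unfolding p3_def
      by (rule nn_integral_dm[OF k1, of "\<lambda>x. ennreal (f x * \<eta> (a x / real n))"]) measurable
    also have "(\<Sum>j\<in>?I - {i}. ?w * (\<integral>\<^sup>+w. ennreal (f (dm w k)) * ennreal (\<gamma> (dm w j)) \<partial>M))
       \<le> (\<Sum>j\<in>?I - {i}. ?w * (?Ef * ?Eg) + (if j = k then ?w * ?Efg else 0))"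
    proof (intro sum_mono)
      fix j assume j: "j \<in> ?I - {i}"
      show "?w * (\<integral>\<^sup>+w. ennreal (f (dm w k)) * ennreal (\<gamma> (dm w j)) \<partial>M) \<le> ?w * (?Ef * ?Eg) + (if j = k then ?w * ?Efg else 0)"
      proof (cases "j = k")
        case True
        have "(\<integral>\<^sup>+w. ennreal (f (dm w k) * \<gamma> (dm w k)) \<partial>M) = ?Efg"
          by (rule nn_integral_dm[OF k1, of "\<lambda>x. ennreal (f x * \<gamma> x)"]) measurable
        then show ?thesis using True by (simp add: ennreal_mult nn add_increasing)
      next
        case False
        have "(\<integral>\<^sup>+w. ennreal (f (dm w k)) * ennreal (\<gamma> (dm w j)) \<partial>M) = ?Ef * ?Eg"
          using False j k1
          by (intro nn_integral_mult_X[of k j "\<lambda>y. ennreal (f (dist y m))" "\<lambda>y. ennreal (\<gamma> (dist y m))"]) auto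
        then show ?thesis using False by simp
      qed
    qed
    also have "... \<le> ?Ef * ?Eg + ?w * ?Efg"
    proof -
      have "(\<Sum>j\<in>?I - {i}. ?w * (?Ef * ?Eg)) = (\<Sum>j\<in>?I - {i}. ?w) * (?Ef * ?Eg)" by (rule sum_distrib_right[symmetric])
      also have "(\<Sum>j\<in>?I - {i}. ?w) = ennreal (\<Sum>j\<in>?I - {i}. 1 / real n)" by (intro sum_ennreal) simp
      also have "(\<Sum>j\<in>?I - {i}. 1 / real n) = 1" using i n0 by simp
      finally have "(\<Sum>j\<in>?I - {i}. ?w * (?Ef * ?Eg)) = ?Ef * ?Eg" by simp
      \<comment> \<open>Only an inequality, because the diagonal index is absent when k = i.\<close>
      moreover have "(\<Sum>j\<in>?I - {i}. if j = k then ?w * ?Efg else 0) \<le> ?w * ?Efg" by (simp add: sum.delta)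
      ultimately show ?thesis by (simp add: sum.distrib add_left_mono)
    qed
    finally show ?thesis by (simp add: add_right_mono)
  qed
  have "(\<integral>\<^sup>+w. ennreal (loo_bound ?I i f \<gamma> \<eta> (dm w)) \<partial>M)
     = (\<integral>\<^sup>+w. (\<Sum>k\<in>?I. ennreal (loo_weight ?I i k) * ennreal (A w k)) \<partial>M)"
  proof (rule nn_integral_cong)
    fix w
    have "loo_bound ?I i f \<gamma> \<eta> (dm w) = (\<Sum>k\<in>?I. loo_weight ?I i k * A w k)"
      by (simp only: loo_bound_def A_def card_atLeastAtMost diff_Suc_1)
    then show "ennreal (loo_bound ?I i f \<gamma> \<eta> (dm w)) = (\<Sum>k\<in>?I. ennreal (loo_weight ?I i k) * ennreal (A w k))"
      by (simp only: ennreal_sum_mult loo_weight_nonneg A0)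
  qed
  also have "... = (\<Sum>k\<in>?I. ennreal (loo_weight ?I i k) * (\<integral>\<^sup>+w. ennreal (A w k) \<partial>M))"
  proof -
    have "(\<integral>\<^sup>+w. (\<Sum>k\<in>?I. ennreal (loo_weight ?I i k) * ennreal (A w k)) \<partial>M)
       = (\<Sum>k\<in>?I. \<integral>\<^sup>+w. ennreal (loo_weight ?I i k) * ennreal (A w k) \<partial>M)"
      by (rule nn_integral_sum) measurable
    also have "... = (\<Sum>k\<in>?I. ennreal (loo_weight ?I i k) * (\<integral>\<^sup>+w. ennreal (A w k) \<partial>M))"
      by (intro sum.cong refl nn_integral_cmult) measurable
    finally show ?thesis .
  qed
  also have "... \<le> (\<Sum>k\<in>?I. ennreal (loo_weight ?I i k) * (?Ef * ?Eg + ?w * ?Efg + ?Ef * ?Eh + ?Efh))"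
    by (intro sum_mono mult_left_mono bound) auto
  also have "... = ennreal (\<Sum>k\<in>?I. loo_weight ?I i k) * (?Ef * ?Eg + ?w * ?Efg + ?Ef * ?Eh + ?Efh)"
    by (simp only: sum_distrib_right[symmetric] sum_ennreal loo_weight_nonneg)
  also have "(\<Sum>k\<in>?I. loo_weight ?I i k) = 25" using n i by (intro sum_loo_weight) auto
  finally show ?thesis by simp
qed

section \<open>Rates\<close>

abbreviation "E_a2 \<equiv> \<integral>\<^sup>+w. ennreal ((a (dY w))\<^sup>2) \<partial>M"
abbreviation "E_g \<equiv> \<integral>\<^sup>+w. ennreal (g (dY w)) \<partial>M"
abbreviation "E_a2g \<equiv> \<integral>\<^sup>+w. ennreal ((a (dY w))\<^sup>2 * g (dY w)) \<partial>M"
abbreviation "E_a2h n \<equiv> \<integral>\<^sup>+w. ennreal ((a (dY w))\<^sup>2 * h (a (dY w) / real n)) \<partial>M"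
abbreviation "E_h n \<equiv> \<integral>\<^sup>+w. ennreal (h (2 * sigma_hat X m a n w)) \<partial>M"

lemma loo_bound_meas [measurable]:
  fixes f \<gamma> \<eta> :: "real \<Rightarrow> real"
  assumes [measurable]: "f \<in> borel_measurable borel" "\<gamma> \<in> borel_measurable borel" "\<eta> \<in> borel_measurable borel"
  shows "(\<lambda>w. loo_bound {1..Suc n} i f \<gamma> \<eta> (dm w)) \<in> borel_measurable M"
proof -
  have dm_meas [measurable]: "k \<in> {1..Suc n} \<Longrightarrow> (\<lambda>w. dm w k) \<in> borel_measurable M" for k by measurable
  have dm_meas' [measurable]: "k \<in> {1..Suc n} - {j} \<Longrightarrow> (\<lambda>w. dm w k) \<in> borel_measurable M" for k j by simp
  show ?thesis unfolding loo_bound_def by measurable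
qed

lemma loo_square_meas [measurable]:
  "(\<lambda>w. loo_square {1..Suc n} i (dm w)) \<in> borel_measurable M"
proof -
  have dm_meas [measurable]: "k \<in> {1..Suc n} \<Longrightarrow> (\<lambda>w. dm w k) \<in> borel_measurable M" for k by measurable
  show ?thesis unfolding loo_square_def by measurable
qed

text \<open>An infinite bound is trivial; a finite one provides exactly the integrability that
  \<open>excess_bound\<close> asks for.\<close>

lemma excess_rate:
  assumes n: "n \<ge> 1"
  shows "(\<integral>\<^sup>+w. ennreal (excess (mn n w)) \<partial>M)
    \<le> ennreal (1 / real n) * (25 * (E_a2 * E_g + ennreal (1 / real n) * E_a2g + E_a2 * E_h n + E_a2h n))"
    (is "_ \<le> ennreal (1 / real n) * ?C")
proof (cases "?C = \<infinity>")
  case True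
  show ?thesis unfolding True using n by (simp add: ennreal_mult_top)
next
  case False
  let ?I = "{1..Suc n}"
  have le: "(\<integral>\<^sup>+w. ennreal (loo_total ?I i (dm w)) \<partial>M) \<le> ?C" if "i \<in> ?I" for i
    using n that by (rule nn_integral_loo_bound) (auto simp: g_nonneg h_nonneg)
  show ?thesis
  proof (rule excess_bound[OF n])
    fix i assume i: "i \<in> ?I"
    show "(\<integral>\<^sup>+w. ennreal (loo_total ?I i (dm w)) \<partial>M) < \<infinity>"
      using le[OF i] False by (auto simp: less_top intro: le_less_trans)
    have "(\<integral>\<^sup>+w. ennreal (1 / real n * loo_total ?I i (dm w)) \<partial>M)
       = ennreal (1 / real n) * (\<integral>\<^sup>+w. ennreal (loo_total ?I i (dm w)) \<partial>M)"
      by (subst nn_integral_cmult[symmetric]) (auto simp: ennreal_mult[symmetric] loo_bound_nonneg g_nonneg h_nonneg)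
    also have "... \<le> ennreal (1 / real n) * ?C" using le[OF i] by (rule mult_left_mono) simp
    finally show "(\<integral>\<^sup>+w. ennreal (1 / real n * loo_total ?I i (dm w)) \<partial>M) \<le> ennreal (1 / real n) * ?C" .
    fix w p q
    assume "leave_one_out \<tau> ?I i (\<lambda>j. X j w) p q"
    then interpret L: leave_one_out \<tau> ?I i "\<lambda>j. X j w" m p q .
    have "L.n = real n" by (simp add: L.n_def)
    then show "\<tau> (dist (X i w) q) - \<tau> (dist (X i w) p) \<le> 1 / real n * loo_total ?I i (dm w)"
      using L.loo_diff by (simp add: L.d_def[abs_def])
  qed (auto simp: loo_bound_nonneg g_nonneg h_nonneg intro!: loo_bound_meas mult_nonneg_nonneg divide_nonneg_nonneg)
qed

text \<open>Measurability is obtained without integrability, as a parameter integral of the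
  substitute \<open>dS\<close>.\<close>

lemma excess_mn_meas [measurable]:
  assumes n: "n \<ge> 1" shows "(\<lambda>w. excess (mn n w)) \<in> borel_measurable M"
proof -
  let ?P = "PB n"
  interpret N: prob_space N by (rule prob_space_distr) simp
  have [measurable]: "F n \<in> measurable ?P borel" using n by (rule F_meas)
  define \<Phi> where "\<Phi> x y = \<tau> \<bar>dS y (F n x)\<bar> - \<tau> (dist y m)" for x y
  have "case_prod \<Phi> \<in> borel_measurable (?P \<Otimes>\<^sub>M N)"
    unfolding \<Phi>_def[abs_def] by measurable
  then have [measurable]: "(\<lambda>x. \<integral>y. \<Phi> x y \<partial>N) \<in> borel_measurable ?P"
    by (rule N.borel_measurable_lebesgue_integral)
  have eq: "(\<integral>y. \<Phi> (tup id n w) y \<partial>N) = excess (mn n w)" if w: "w \<in> space M" for w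
  proof -
    have [measurable]: "\<Phi> (tup id n w) \<in> borel_measurable borel" unfolding \<Phi>_def[abs_def] by measurable
    have "(\<integral>y. \<Phi> (tup id n w) y \<partial>N) = (\<integral>w'. \<Phi> (tup id n w) (Y w') \<partial>M)" by (rule integral_distr) auto
    also have "... = (\<integral>w'. \<tau> (dist (Y w') (mn n w)) - \<tau> (dist (Y w') m) \<partial>M)"
    proof (rule integral_cong_AE)
      show "AE w' in M. \<Phi> (tup id n w) (Y w') = \<tau> (dist (Y w') (mn n w)) - \<tau> (dist (Y w') m)"
        using Y_dense by eventually_elim (simp add: \<Phi>_def dS_eq mn_tup n w)
    qed measurable
    finally show ?thesis by (simp add: excess_def)
  qed
  have "(\<lambda>w. \<integral>y. \<Phi> (tup id n w) y \<partial>N) \<in> borel_measurable M"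
    by (rule measurable_compose[OF tup_id_meas]) measurable
  then show ?thesis by (rule measurable_cong[THEN iffD1, rotated]) (rule eq)
qed

lemma nn_integral_affine_le:
  assumes "\<And>w. u w \<le> b + b' * v w" "0 \<le> b" "0 \<le> b'" "\<And>w. 0 \<le> v w" and [measurable]: "v \<in> borel_measurable M"
  shows "(\<integral>\<^sup>+w. ennreal (u w) \<partial>M) \<le> ennreal b + ennreal b' * (\<integral>\<^sup>+w. ennreal (v w) \<partial>M)"
proof -
  have "(\<integral>\<^sup>+w. ennreal (u w) \<partial>M) \<le> (\<integral>\<^sup>+w. ennreal b + ennreal b' * ennreal (v w) \<partial>M)"
    using assms by (intro nn_integral_mono) (auto simp: ennreal_mult[symmetric] ennreal_plus[symmetric] simp del: ennreal_plus intro!: ennreal_leI)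
  also have "... = ennreal b + ennreal b' * (\<integral>\<^sup>+w. ennreal (v w) \<partial>M)"
    by (subst nn_integral_add) (auto simp: nn_integral_cmult emeasure_space_1)
  finally show ?thesis .
qed

lemma affine_finite: "c < \<infinity> \<Longrightarrow> ennreal b + ennreal b' * c < \<infinity>"
  by (simp add: less_top[symmetric] ennreal_mult_eq_top_iff)

text \<open>For x \<ge> 1 both a x and h (a x) \<ge> g x are bounded away from 0, so a^2, g and a^2
  g are at most a constant plus a multiple of a^2 h (a).\<close>

lemma moments_finite:
  assumes "E_a2h 1 < \<infinity>" shows "E_a2 < \<infinity>" "E_g < \<infinity>" "E_a2g < \<infinity>"
proof -
  have le: "(\<integral>\<^sup>+w. ennreal (u (dY w)) \<partial>M) < \<infinity>"
    if u: "\<And>x. 0 \<le> x \<Longrightarrow> u x \<le> b + b' * ((a x)\<^sup>2 * h (a x))" "0 \<le> b" "0 \<le> b'" for u b b'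
  proof -
    have "(\<integral>\<^sup>+w. ennreal (u (dY w)) \<partial>M) \<le> ennreal b + ennreal b' * (\<integral>\<^sup>+w. ennreal ((a (dY w))\<^sup>2 * h (a (dY w))) \<partial>M)"
      using u h_nonneg by (intro nn_integral_affine_le) auto
    also have "... < \<infinity>" using assms by (intro affine_finite) simp
    finally show ?thesis .
  qed
  have pos: "0 \<le> (a x)\<^sup>2 * h (a x)" for x using h_nonneg by simp
  show "E_a2 < \<infinity>"
  proof (rule le[of "\<lambda>x. (a x)\<^sup>2" "(a 1)\<^sup>2" "1 / g 1"])
    fix x :: real assume x: "0 \<le> x"
    show "(a x)\<^sup>2 \<le> (a 1)\<^sup>2 + 1 / g 1 * ((a x)\<^sup>2 * h (a x))"
    proof (cases "x \<le> 1")
      case True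
      then have "(a x)\<^sup>2 \<le> (a 1)\<^sup>2" by (intro power_mono a_mono a_nonneg)
      then show ?thesis using pos[of x] g_pos[of 1] by (simp add: add_increasing2)
    next
      case False
      have "g 1 \<le> h (a x)" using False g_mono[of 1 x] g_le_h_a[of x] by simp
      then have "(a x)\<^sup>2 * g 1 \<le> (a x)\<^sup>2 * h (a x)" by (rule mult_left_mono) simp
      then have "(a x)\<^sup>2 \<le> 1 / g 1 * ((a x)\<^sup>2 * h (a x))" using g_pos[of 1] by (simp add: field_simps)
      then show ?thesis by (simp add: add_increasing)
    qed
  qed (auto simp: g_nonneg)
  show "E_g < \<infinity>"
  proof (rule le[of g "g 1" "1 / (a 1)\<^sup>2"])
    fix x :: real assume x: "0 \<le> x"
    show "g x \<le> g 1 + 1 / (a 1)\<^sup>2 * ((a x)\<^sup>2 * h (a x))"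
    proof (cases "x \<le> 1")
      case True
      then have "g x \<le> g 1" by (rule g_mono)
      then show ?thesis using pos[of x] by (simp add: add_increasing2)
    next
      case False
      have "(a 1)\<^sup>2 \<le> (a x)\<^sup>2" using False by (intro power_mono a_mono a_nonneg) simp
      then have "(a 1)\<^sup>2 * g x \<le> (a x)\<^sup>2 * h (a x)" using g_le_h_a[OF x] g_nonneg by (intro mult_mono) auto
      then have "g x \<le> 1 / (a 1)\<^sup>2 * ((a x)\<^sup>2 * h (a x))" using a_pos[of 1] by (simp add: field_simps)
      then show ?thesis using g_nonneg by (simp add: add_increasing)
    qed
  qed (auto simp: g_nonneg)
  show "E_a2g < \<infinity>"
  proof (rule le[of "\<lambda>x. (a x)\<^sup>2 * g x" 0 1])
    fix x :: real assume "0 \<le> x"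
    then show "(a x)\<^sup>2 * g x \<le> 0 + 1 * ((a x)\<^sup>2 * h (a x))" by (simp add: mult_left_mono g_le_h_a)
  qed simp_all
qed

lemma E_a2h_mono: assumes "n \<ge> 1" shows "E_a2h n \<le> E_a2h 1"
proof -
  have "a x / real n \<le> a x / real 1" for x
    using assms a_nonneg[of x] by (intro divide_left_mono) auto
  then show ?thesis by (intro nn_integral_mono ennreal_leI mult_left_mono h_mono) auto
qed

text \<open>Dominated convergence: \<open>h_tendsto_0\<close> gives the pointwise limit, and the
  integrand at n = 1 is a majorant.\<close>

lemma E_a2h_tendsto:
  assumes fin: "E_a2h 1 < \<infinity>" and lim: "(rdtau \<tau> \<longlongrightarrow> \<infinity>) (at_right 0)"
  shows "E_a2h \<longlonglongrightarrow> 0"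
proof -
  have "(\<lambda>n. \<integral>\<^sup>+w. ennreal ((a (dY w))\<^sup>2 * h (a (dY w) / real (Suc n))) \<partial>M) \<longlonglongrightarrow> (\<integral>\<^sup>+w. 0 \<partial>M)"
  proof (rule nn_integral_dominated_convergence[where w = "\<lambda>w. ennreal ((a (dY w))\<^sup>2 * h (a (dY w)))"])
    show "AE w in M. (\<lambda>n. ennreal ((a (dY w))\<^sup>2 * h (a (dY w) / real (Suc n)))) \<longlonglongrightarrow> 0"
    proof (rule AE_I2)
      fix w
      have "(\<lambda>n. (a (dY w))\<^sup>2 * h (a (dY w) / real (Suc n))) \<longlonglongrightarrow> (a (dY w))\<^sup>2 * 0"
        by (intro tendsto_mult_left LIMSEQ_Suc[OF h_tendsto_0[OF lim]] a_nonneg)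
      then show "(\<lambda>n. ennreal ((a (dY w))\<^sup>2 * h (a (dY w) / real (Suc n)))) \<longlonglongrightarrow> 0"
        using tendsto_ennrealI by fastforce
    qed
    show "AE w in M. ennreal ((a (dY w))\<^sup>2 * h (a (dY w) / real (Suc n))) \<le> ennreal ((a (dY w))\<^sup>2 * h (a (dY w)))" for n
      using a_nonneg by (intro AE_I2 ennreal_leI mult_left_mono h_mono) (auto simp: field_simps)
    show "(\<integral>\<^sup>+w. ennreal ((a (dY w))\<^sup>2 * h (a (dY w))) \<partial>M) < \<infinity>" using fin by simp
  qed auto
  then have "(\<lambda>n. E_a2h (Suc n)) \<longlonglongrightarrow> 0" by simp
  then show ?thesis by (rule LIMSEQ_imp_Suc)
qed

text \<open>\<open>excess_growth\<close> gives the factor 4 where D > 0; where D = 0, the convention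
  0 * \<infinity> = 0 disposes of a possibly infinite right derivative. A negative median of a
  distance would make the lower event empty.\<close>

lemma risk_le_excess:
  assumes "n \<ge> 1" and med: "is_median M dY c"
  shows "frechet_risk M \<tau> m c (mn n) \<le> 4 * (\<integral>\<^sup>+w. ennreal (excess (mn n w)) \<partial>M)"
    and "1 / 2 \<le> prob {w \<in> space M. dY w \<le> c}" and "0 \<le> c"
proof -
  show half: "1 / 2 \<le> prob {w \<in> space M. dY w \<le> c}" using med by (simp add: is_median_def)
  show c: "0 \<le> c"
  proof (rule ccontr)
    assume "\<not> 0 \<le> c"
    then have "{w \<in> space M. dY w \<le> c} = {}" by (auto simp: not_le intro: less_le_trans[OF _ zero_le_dist])
    then have "prob {w \<in> space M. dY w \<le> c} = 0" by (simp only: measure_empty)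
    then show False using half by simp
  qed
  have "frechet_risk M \<tau> m c (mn n) \<le> (\<integral>\<^sup>+w. 4 * ennreal (excess (mn n w)) \<partial>M)"
    unfolding frechet_risk_def
  proof (rule nn_integral_mono)
    fix w
    define D where "D = dist m (mn n w)"
    show "ennreal (D\<^sup>2) * rdtau \<tau> (c + D) \<le> 4 * ennreal (excess (mn n w))"
    proof (cases "D = 0")
      case False
      then have D: "0 < D" by (simp add: D_def)
      have "ennreal (D\<^sup>2) * rdtau \<tau> (c + D) = ennreal (D\<^sup>2 * \<kappa> (c + D))"
        using D c kappa_pos[of "c + D"] by (simp add: rdtau_pos ennreal_mult)
      also have "... \<le> ennreal (4 * excess (mn n w))"
        using excess_growth[OF half c, of "mn n w"] D by (intro ennreal_leI) (simp add: D_def)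
      finally show ?thesis by (simp add: ennreal_mult excess_nonneg)
    qed simp
  qed
  also have "... = 4 * (\<integral>\<^sup>+w. ennreal (excess (mn n w)) \<partial>M)"
    by (rule nn_integral_cmult) (use excess_mn_meas assms in simp)
  finally show "frechet_risk M \<tau> m c (mn n) \<le> 4 * (\<integral>\<^sup>+w. ennreal (excess (mn n w)) \<partial>M)" .
qed

lemma frechet_risk_bound:
  assumes cond: "cond_i M \<tau> Y m" and med: "is_median M dY c"
  shows "\<exists>e :: nat \<Rightarrow> real. e \<longlonglongrightarrow> 0 \<and> (\<forall>\<^sub>F n in sequentially. frechet_risk M \<tau> m c (mn n) \<le>
     ennreal (256 / real n) * (sigma_f M Y m (\<lambda>x. (a x)\<^sup>2) * S_n1 M \<tau> Y X m n + ennreal (e n)))"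
proof -
  have fin: "E_a2h 1 < \<infinity>" and lim: "(rdtau \<tau> \<longlongrightarrow> \<infinity>) (at_right 0)" using cond by (auto simp: cond_i_def)
  \<comment> \<open>The vanishing part: the diagonal term of order 1 / n and the share of a single
    observation in the average.\<close>
  define R where "R n = ennreal (1 / real n) * E_a2g + E_a2h n" for n
  have "(\<lambda>n. ennreal (1 / real n) * E_a2g + E_a2h n) \<longlonglongrightarrow> ennreal 0 * E_a2g + 0"
    using moments_finite[OF fin]
    by (intro tendsto_add E_a2h_tendsto[OF fin lim] tendsto_mult_ennreal tendsto_ennrealI lim_1_over_n tendsto_const) auto
  then have "R \<longlonglongrightarrow> 0" by (simp add: R_def[abs_def])
  then have e: "(\<lambda>n. enn2real (R n)) \<longlonglongrightarrow> 0" using tendsto_enn2real[of R 0 sequentially] by simp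
  have Rfin: "R n < \<infinity>" if "n \<ge> 1" for n
    using moments_finite[OF fin] fin E_a2h_mono[OF that]
    by (auto simp: R_def less_top[symmetric] ennreal_mult_eq_top_iff top_unique)
  have "frechet_risk M \<tau> m c (mn n) \<le> ennreal (256 / real n) * (sigma_f M Y m (\<lambda>x. (a x)\<^sup>2) * S_n1 M \<tau> Y X m n + ennreal (enn2real (R n)))"
    if n: "n \<ge> 1" for n
  proof -
    define S where "S = S_n1 M \<tau> Y X m n"
    have S: "E_g \<le> S" "E_h n \<le> S" by (auto simp: S_def S_n1_def sigma_f_def le_max_iff_disj)
    have "E_a2 * E_g + ennreal (1 / real n) * E_a2g + E_a2 * E_h n + E_a2h n = (E_a2 * E_g + E_a2 * E_h n) + R n"
      by (simp add: R_def ac_simps)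
    \<comment> \<open>E_g and E_h n are each at most S, which produces the factor 2; R n is doubled
      to share it.\<close>
    also have "... \<le> (E_a2 * S + E_a2 * S) + (R n + R n)"
      using S by (intro add_mono mult_left_mono) (auto simp: add_increasing)
    also have "... = 2 * (E_a2 * S + R n)" unfolding mult_2 by (simp only: ac_simps)
    finally have *: "E_a2 * E_g + ennreal (1 / real n) * E_a2g + E_a2 * E_h n + E_a2h n \<le> 2 * (E_a2 * S + R n)" .
    have "frechet_risk M \<tau> m c (mn n) \<le> 4 * (ennreal (1 / real n) * (25 * (2 * (E_a2 * S + R n))))"
      using risk_le_excess(1)[OF n med] excess_rate[OF n] *
      by (meson mult_left_mono order_trans zero_le)
    also have "... = ennreal (200 / real n) * (E_a2 * S + R n)"
    proof -
      have "ennreal (200 / real n) = 4 * (ennreal (1 / real n) * (25 * 2))"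
        using n by (simp add: ennreal_mult[symmetric] flip: ennreal_numeral)
      then show ?thesis by (simp add: mult.assoc)
    qed
    also have "... \<le> ennreal (256 / real n) * (E_a2 * S + R n)"
      using n by (intro mult_right_mono ennreal_leI divide_right_mono) auto
    also have "R n = ennreal (enn2real (R n))" using Rfin[OF n] by (simp add: less_top[symmetric])
    finally show ?thesis by (simp add: S_def sigma_f_def)
  qed
  then show ?thesis using e by (intro exI[of _ "\<lambda>n. enn2real (R n)"]) (auto simp: eventually_sequentially)
qed

section \<open>Rates for the distance between the mean and the empirical mean\<close>

lemma the_inv_tau:
  assumes "0 \<le> y" "y \<le> \<tau> x" "0 \<le> x"
  shows "0 \<le> the_inv_into {0..} \<tau> y \<and> the_inv_into {0..} \<tau> y \<le> x"
proof -
  have inj: "inj_on \<tau> {0..}"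
  proof (rule linorder_inj_onI)
    fix x y :: real assume "x < y" "x \<in> {0..}" "y \<in> {0..}"
    then have "\<tau> x < \<tau> y" by (intro tau_strict) auto
    then show "\<tau> x \<noteq> \<tau> y" by simp
  qed auto
  have "continuous_on {0..x} \<tau>" by (rule continuous_on_subset[OF tau_continuous]) auto
  then obtain z where "0 \<le> z" "z \<le> x" "\<tau> z = y" using IVT'[of \<tau> 0 y x] assms by auto
  then show ?thesis using the_inv_into_f_f[OF inj, of z] by auto
qed

lemma excess_uniform_rate:
  assumes fin: "E_a2h 1 < \<infinity>" and sup: "(SUP n\<in>{1..}. E_h n) < \<infinity>"
  obtains C where "0 \<le> C" "\<And>n. n \<ge> 1 \<Longrightarrow> (\<integral>\<^sup>+w. ennreal (excess (mn n w)) \<partial>M) \<le> ennreal (C / real n)"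
proof -
  let ?H = "SUP n\<in>{1..}. E_h n"
  define B where "B = 25 * (E_a2 * E_g + E_a2g + E_a2 * ?H + E_a2h 1)"
  have Bfin: "B < \<infinity>"
    using moments_finite[OF fin] fin sup by (auto simp: B_def less_top[symmetric] ennreal_mult_eq_top_iff)
  show ?thesis
  proof
    fix n :: nat assume n: "n \<ge> 1"
    have "ennreal (1 / real n) * E_a2g \<le> 1 * E_a2g" using n by (intro mult_right_mono) (auto simp: ennreal_le_1)
    moreover have "E_h n \<le> ?H" using n by (intro SUP_upper) auto
    ultimately have "25 * (E_a2 * E_g + ennreal (1 / real n) * E_a2g + E_a2 * E_h n + E_a2h n) \<le> B"
      unfolding B_def using E_a2h_mono[OF n] by (intro mult_left_mono add_mono) auto
    then have "(\<integral>\<^sup>+w. ennreal (excess (mn n w)) \<partial>M) \<le> ennreal (1 / real n) * B"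
      using excess_rate[OF n] by (meson mult_left_mono order_trans zero_le)
    also have "... = ennreal (1 / real n) * ennreal (enn2real B)" using Bfin by (simp add: less_top[symmetric])
    also have "... = ennreal (enn2real B / real n)" by (simp add: ennreal_mult[symmetric])
    finally show "(\<integral>\<^sup>+w. ennreal (excess (mn n w)) \<partial>M) \<le> ennreal (enn2real B / real n)" .
  qed simp
qed

text \<open>Two regimes around a fixed K: below it the excess risk grows quadratically with constant
  c0, above it the excess risk dominates \<tau> and thereby the distance. The scale s = n^(-1/2)
  matches the rate 1 / n of the excess risk.\<close>

lemma frechet_mean_rates:
  assumes half: "1 / 2 \<le> prob {w \<in> space M. dY w \<le> c}" and c: "0 \<le> c"
    and fin: "E_a2h 1 < \<infinity>" "(SUP n\<in>{1..}. E_h n) < \<infinity>"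
  shows "(\<forall>\<^sub>F n in sequentially. integrable M (\<lambda>w. \<tau> (dist m (mn n w)))) \<and>
       (\<lambda>n. the_inv_into {0..} \<tau> (\<integral>w. \<tau> (dist m (mn n w)) \<partial>M)) \<in> O(\<lambda>n. real n powr (- 1 / 2)) \<and>
       (\<forall>\<^sub>F n in sequentially. integrable M (\<lambda>w. dist m (mn n w))) \<and>
       (\<lambda>n. \<integral>w. dist m (mn n w) \<partial>M) \<in> O(\<lambda>n. real n powr (- 1 / 2))"
proof -
  obtain C where C: "0 \<le> C" "\<And>n. n \<ge> 1 \<Longrightarrow> (\<integral>\<^sup>+w. ennreal (excess (mn n w)) \<partial>M) \<le> ennreal (C / real n)"
    using excess_uniform_rate[OF fin] by blast
  \<comment> \<open>Beyond K the derivative is at least 16 \<sigma>; the summand 1 ensures K >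
    0.\<close>
  define K where "K = inv_a (16 * \<sigma>) + 1"
  have K: "0 < K" using inv_a_nonneg by (simp add: K_def add_nonneg_pos)
  have "a 0 \<le> 16 * \<sigma>" using a_0_le_sigma sigma_nonneg by simp
  then have aK: "16 * \<sigma> \<le> a K" using a_inv_a[of "16 * \<sigma>"] a_mono[of "inv_a (16 * \<sigma>)" K] by (simp add: K_def)
  define c0 where "c0 = \<kappa> (c + K) / 4"
  have c0: "0 < c0" using kappa_pos[of "c + K"] c K by (simp add: c0_def)
  have small: "c0 * (dist m q)\<^sup>2 \<le> excess q" if "dist m q \<le> K" for q
  proof (cases "dist m q = 0")
    case False
    then have D: "0 < dist m q" by simp
    have "c0 \<le> \<kappa> (c + dist m q) / 4"
      using that add_nonneg_pos[OF c D] unfolding c0_def by (intro divide_right_mono kappa_antimono) auto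
    then have "(dist m q)\<^sup>2 * c0 \<le> (dist m q)\<^sup>2 * (\<kappa> (c + dist m q) / 4)" by (rule mult_left_mono) simp
    then show ?thesis using excess_growth[OF half c D] by (simp add: mult.commute)
  next
    case True
    show ?thesis unfolding True using excess_nonneg[of q] by simp
  qed
  have large: "\<tau> (dist m q) \<le> 4 / 3 * excess q" if "K \<le> dist m q" for q
  proof -
    let ?D = "dist m q"
    have "16 * \<sigma> \<le> a ?D" using aK a_mono[OF that] by simp
    then have "?D * (16 * \<sigma>) \<le> ?D * a ?D" by (rule mult_left_mono) simp
    \<comment> \<open>Since D a D \<le> 2 \<tau> D, the loss 2 D \<sigma> in
      \<open>excess_lower\<close> is at most \<tau> D / 4, which leaves 3/4 of \<tau> D.\<close>
    then show ?thesis using tau_a_half[of ?D] excess_lower[of q] by (simp add: mult_ac)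
  qed
  have largeD: "dist m q \<le> K * 4 / (3 * \<tau> K) * excess q" if "K \<le> dist m q" for q
  proof -
    have "dist m q / K * \<tau> K \<le> \<tau> (dist m q)"
      using tau_scale[of K "dist m q / K"] K that by simp
    also have "... \<le> 4 / 3 * excess q" using large[OF that] .
    finally show ?thesis using K tau_pos[OF K] by (simp add: field_simps)
  qed
  define C3 where "C3 = 1 + C / c0 + 4 / 3 * C / \<tau> 1"
  define C4 where "C4 = 1 + C / c0 + K * 4 / (3 * \<tau> K) * C"
  have t1: "0 < \<tau> 1" and tK: "0 < \<tau> K" using tau_pos K by auto
  have C3: "1 \<le> C3" using C c0 t1 by (simp add: C3_def)
  have C4: "0 \<le> C4" using C c0 tK K by (simp add: C4_def)
  have main: "integrable M (\<lambda>w. \<tau> (dist m (mn n w))) \<and> (\<integral>w. \<tau> (dist m (mn n w)) \<partial>M) \<le> \<tau> (C3 * real n powr (- 1 / 2)) \<and>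
      integrable M (\<lambda>w. dist m (mn n w)) \<and> (\<integral>w. dist m (mn n w) \<partial>M) \<le> C4 * real n powr (- 1 / 2)"
    if n: "n \<ge> 1" for n
  proof -
    define s where "s = real n powr (- 1 / 2)"
    have s0: "0 < s" using n by (simp add: s_def)
    have "s\<^sup>2 = real n powr (- 1)"
      unfolding s_def power2_eq_square powr_add[symmetric] by simp
    also have "... = 1 / real n" using n by (simp only: powr_minus_divide) simp
    finally have s2: "s\<^sup>2 = 1 / real n" .
    have "s\<^sup>2 \<le> 1\<^sup>2" using n by (simp add: s2)
    then have s1: "s \<le> 1" by (rule power2_le_imp_le) simp
    have meas [measurable]: "mn n \<in> borel_measurable M" using n by simp
    have iE: "integrable M (\<lambda>w. excess (mn n w))"
    proof (rule integrableI_nonneg)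
      show "(\<integral>\<^sup>+w. ennreal (excess (mn n w)) \<partial>M) < \<infinity>" using C(2)[OF n] by (rule le_less_trans) simp
    qed (use excess_mn_meas[OF n] in \<open>auto simp: excess_nonneg\<close>)
    have EE: "(\<integral>w. excess (mn n w) \<partial>M) \<le> C * s\<^sup>2"
    proof -
      have "ennreal (\<integral>w. excess (mn n w) \<partial>M) \<le> ennreal (C / real n)"
        using C(2)[OF n] nn_integral_eq_integral[OF iE] by (simp add: excess_nonneg)
      then show ?thesis using C(1) by (simp add: ennreal_le_iff s2)
    qed
    have bound: "integrable M (\<lambda>w. u (mn n w)) \<and> (\<integral>w. u (mn n w) \<partial>M) \<le> b1 + b2 * (C * s\<^sup>2)"
      if u: "\<And>q. 0 \<le> u q" "\<And>q. u q \<le> b1 + b2 * excess q" "0 \<le> b2" and [measurable]: "(\<lambda>w. u (mn n w)) \<in> borel_measurable M" for u b1 b2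
    proof
      have "integrable M (\<lambda>w. b1 + b2 * excess (mn n w))" using iE by auto
      then show iu: "integrable M (\<lambda>w. u (mn n w))"
        by (rule Bochner_Integration.integrable_bound) (use u in \<open>auto intro!: AE_I2 intro: order_trans[OF _ abs_ge_self]\<close>)
      have "(\<integral>w. u (mn n w) \<partial>M) \<le> (\<integral>w. b1 + b2 * excess (mn n w) \<partial>M)"
        using iu iE u by (intro integral_mono) auto
      also have "... = b1 + b2 * (\<integral>w. excess (mn n w) \<partial>M)" using iE by (simp add: prob_space)
      also have "... \<le> b1 + b2 * (C * s\<^sup>2)" using EE u(3) by (intro add_left_mono mult_left_mono)
      finally show "(\<integral>w. u (mn n w) \<partial>M) \<le> b1 + b2 * (C * s\<^sup>2)" .
    qed
    have ts: "0 < \<tau> s" using tau_pos s0 by simp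
    have B1: "integrable M (\<lambda>w. \<tau> (dist m (mn n w))) \<and> (\<integral>w. \<tau> (dist m (mn n w)) \<partial>M) \<le> \<tau> s + (\<tau> s / (s\<^sup>2 * c0) + 4 / 3) * (C * s\<^sup>2)"
    proof (rule bound)
      fix q
      have e0: "0 \<le> \<tau> s / (s\<^sup>2 * c0) * excess q" "0 \<le> excess q" using ts s0 c0 excess_nonneg by auto
      \<comment> \<open>Up to s by monotonicity; between s and K \<open>tau_square_quotient\<close>
        passes to the square and so to the excess risk; beyond K by \<open>large\<close>.\<close>
      show "\<tau> (dist m q) \<le> \<tau> s + (\<tau> s / (s\<^sup>2 * c0) + 4 / 3) * excess q"
      proof (cases "dist m q \<le> K")
        case True
        show ?thesis
        proof (cases "dist m q \<le> s")
          case True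
          then have "\<tau> (dist m q) \<le> \<tau> s" by (intro tau_mono) auto
          then show ?thesis using e0 by (simp add: distrib_right add_increasing2)
        next
          case False
          have "s\<^sup>2 * \<tau> (dist m q) * c0 \<le> (dist m q)\<^sup>2 * \<tau> s * c0"
            using tau_square_quotient[OF s0, of "dist m q"] False c0 by (intro mult_right_mono) auto
          also have "... \<le> excess q * \<tau> s"
            using mult_right_mono[OF small[OF \<open>dist m q \<le> K\<close>], of "\<tau> s"] ts by (simp add: mult_ac)
          finally have "\<tau> (dist m q) \<le> \<tau> s / (s\<^sup>2 * c0) * excess q"
            using s0 c0 by (simp add: field_simps)
          then show ?thesis using e0 ts by (simp add: distrib_right)
        qed
      next
        case False
        then have "\<tau> (dist m q) \<le> 4 / 3 * excess q" by (intro large) simp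
        then show ?thesis using e0 ts by (simp add: distrib_right)
      qed
    qed (use ts c0 s0 in \<open>auto simp: tau_nonneg\<close>)
    have B2: "integrable M (\<lambda>w. dist m (mn n w)) \<and> (\<integral>w. dist m (mn n w) \<partial>M) \<le> s + (1 / (s * c0) + K * 4 / (3 * \<tau> K)) * (C * s\<^sup>2)"
    proof (rule bound)
      fix q
      have e0: "0 \<le> 1 / (s * c0) * excess q" "0 \<le> K * 4 / (3 * \<tau> K) * excess q"
        using tK K s0 c0 excess_nonneg[of q] by auto
      show "dist m q \<le> s + (1 / (s * c0) + K * 4 / (3 * \<tau> K)) * excess q"
      proof (cases "dist m q \<le> K")
        case True
        have "dist m q * (s * c0) \<le> s * (s * c0) + c0 * (dist m q)\<^sup>2"
        proof -
          have "dist m q * s \<le> s * s + (dist m q)\<^sup>2"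
            using s0 by (cases "dist m q \<le> s") (auto simp: power2_eq_square mult_right_mono mult_left_mono add_increasing add_increasing2)
          then show ?thesis using mult_left_mono[of "dist m q * s" "s * s + (dist m q)\<^sup>2" c0] c0 by (simp add: algebra_simps)
        qed
        also have "... \<le> s * (s * c0) + excess q" using small[OF True] by simp
        finally have "dist m q \<le> s + 1 / (s * c0) * excess q" using s0 c0 by (simp add: field_simps)
        then show ?thesis using e0 by (simp add: distrib_right)
      next
        case False
        then have "dist m q \<le> K * 4 / (3 * \<tau> K) * excess q" by (intro largeD) simp
        then show ?thesis using e0 s0 by (simp add: distrib_right)
      qed
    qed (use tK K c0 s0 in auto)
    have "\<tau> s + (\<tau> s / (s\<^sup>2 * c0) + 4 / 3) * (C * s\<^sup>2) = \<tau> s + \<tau> s * (C / c0) + 4 / 3 * C * s\<^sup>2"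
      using s0 c0 by (simp add: field_simps)
    \<comment> \<open>As s \<le> 1, s^2 is at most \<tau> s / \<tau> 1, so the contribution of large
      distances is a multiple of \<tau> s as well.\<close>
    also have "4 / 3 * C * s\<^sup>2 \<le> 4 / 3 * C * (\<tau> s / \<tau> 1)"
      using tau_square_quotient[OF s0 s1] t1 C(1) by (intro mult_left_mono) (auto simp: field_simps)
    also have "\<tau> s + \<tau> s * (C / c0) + 4 / 3 * C * (\<tau> s / \<tau> 1) = C3 * \<tau> s"
      by (simp add: C3_def algebra_simps)
    also have "... \<le> \<tau> (C3 * s)" using C3 s0 by (intro tau_scale) auto
    finally have T1: "\<tau> s + (\<tau> s / (s\<^sup>2 * c0) + 4 / 3) * (C * s\<^sup>2) \<le> \<tau> (C3 * s)" by simp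
    have "s + (1 / (s * c0) + K * 4 / (3 * \<tau> K)) * (C * s\<^sup>2) = s + C / c0 * s + K * 4 / (3 * \<tau> K) * C * s\<^sup>2"
      using s0 c0 tK by (simp add: field_simps power2_eq_square)
    also have "... \<le> s + C / c0 * s + K * 4 / (3 * \<tau> K) * C * s"
      using s1 s0 tK K C(1) by (intro add_left_mono mult_left_mono) (auto simp: power2_eq_square mult_le_cancel_left1)
    also have "... = C4 * s" by (simp add: C4_def algebra_simps)
    finally show ?thesis using B1 B2 T1 unfolding s_def by linarith
  qed
  have ev: "\<forall>\<^sub>F n in sequentially. n \<ge> 1" by (rule eventually_ge_at_top)
  show ?thesis
  proof (intro conjI)
    show "\<forall>\<^sub>F n in sequentially. integrable M (\<lambda>w. \<tau> (dist m (mn n w)))"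
      "\<forall>\<^sub>F n in sequentially. integrable M (\<lambda>w. dist m (mn n w))"
      using ev by (eventually_elim, use main in blast)+
    show "(\<lambda>n. \<integral>w. dist m (mn n w) \<partial>M) \<in> O(\<lambda>n. real n powr (- 1 / 2))"
    proof (rule bigoI[where c = C4])
      show "\<forall>\<^sub>F n in sequentially. norm (\<integral>w. dist m (mn n w) \<partial>M) \<le> C4 * norm (real n powr (- 1 / 2))"
        using ev
      proof eventually_elim
        case (elim n)
        have "0 \<le> (\<integral>w. dist m (mn n w) \<partial>M)" by simp
        with main[OF elim] show ?case by simp
      qed
    qed
    show "(\<lambda>n. the_inv_into {0..} \<tau> (\<integral>w. \<tau> (dist m (mn n w)) \<partial>M)) \<in> O(\<lambda>n. real n powr (- 1 / 2))"
    proof (rule bigoI[where c = C3])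
      show "\<forall>\<^sub>F n in sequentially. norm (the_inv_into {0..} \<tau> (\<integral>w. \<tau> (dist m (mn n w)) \<partial>M)) \<le> C3 * norm (real n powr (- 1 / 2))"
        using ev
      proof eventually_elim
        case (elim n)
        have "0 \<le> (\<integral>w. \<tau> (dist m (mn n w)) \<partial>M)" by (intro integral_nonneg_AE) (simp add: tau_nonneg)
        then show ?case
          using the_inv_tau[of "\<integral>w. \<tau> (dist m (mn n w)) \<partial>M" "C3 * real n powr (- 1 / 2)"] main[OF elim] C3 by simp
      qed
    qed
  qed
qed

end

section \<open>Truncation and the exceptional event under moments of order 1 + \<epsilon>\<close>

lemma truncate_powr:
  fixes K z \<epsilon> :: real
  assumes "0 < K" "0 \<le> z" "0 < \<epsilon>"
  shows "z \<le> K + K powr (- \<epsilon>) * z powr (1 + \<epsilon>)"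
proof (cases "z \<le> K")
  case False
  then have z: "0 < z" using assms by simp
  have "1 = K powr (- \<epsilon>) * K powr \<epsilon>" using assms by (simp add: powr_minus)
  \<comment> \<open>Above K the factor (z / K)^\<epsilon> is at least 1.\<close>
  also have "... \<le> K powr (- \<epsilon>) * z powr \<epsilon>"
    using False assms by (intro mult_left_mono powr_mono2) auto
  finally have "z * 1 \<le> z * (K powr (- \<epsilon>) * z powr \<epsilon>)" using z by (intro mult_left_mono) auto
  also have "... = K powr (- \<epsilon>) * z powr (1 + \<epsilon>)" using z by (simp add: powr_add)
  finally show ?thesis using assms by simp
qed (use assms in \<open>simp add: add_increasing2\<close>)

lemma square_mult_powr:
  fixes u v p :: real
  assumes "0 \<le> u" "0 \<le> v" shows "(u\<^sup>2 * v) powr p = u powr (2 * p) * v powr p"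
proof (cases "u = 0")
  case False
  then have "u\<^sup>2 = u powr 2" using assms by simp
  then have "u\<^sup>2 powr p = u powr (2 * p)" by (simp only: powr_powr)
  then show ?thesis using assms by (simp add: powr_mult)
qed simp

context transform
begin

text \<open>Each product of a^2 with one value of g or h is truncated separately. The three kinds of
  terms contribute K each, and the weights sum to 25, which gives 75 K.\<close>

lemma loo_bound_truncate:
  fixes K \<epsilon> :: real
  assumes I: "finite I" "i \<in> I" "2 \<le> card I" and K: "0 < K" "0 < \<epsilon>"
  shows "loo_total I i d
    \<le> 75 * K + K powr (- \<epsilon>) * loo_bound I i (\<lambda>x. a x powr (2 * (1 + \<epsilon>))) (\<lambda>x. g x powr (1 + \<epsilon>)) (\<lambda>x. h x powr (1 + \<epsilon>)) d"
proof -
  define n c where "n = real (card I - 1)" and "c = K powr (- \<epsilon>)"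
  have n: "0 < n" "real (card (I - {i})) = n" using I by (auto simp: n_def)
  have t: "(a x)\<^sup>2 * v \<le> K + c * (a x powr (2 * (1 + \<epsilon>)) * v powr (1 + \<epsilon>))" if "0 \<le> v" for x v
    using truncate_powr[OF K(1) _ K(2), of "(a x)\<^sup>2 * v"] that a_nonneg by (simp add: square_mult_powr c_def)
  have "loo_total I i d \<le> (\<Sum>k\<in>I. loo_weight I i k * (3 * K + c * (a (d k) powr (2 * (1 + \<epsilon>)) *
     ((\<Sum>j\<in>I - {i}. g (d j) powr (1 + \<epsilon>)) / n + h (2 * ((\<Sum>j\<in>I - {k}. a (d j)) / n)) powr (1 + \<epsilon>) + h (a (d k) / n) powr (1 + \<epsilon>)))))"
    unfolding loo_bound_def n_def[symmetric]
  proof (intro sum_mono mult_left_mono loo_weight_nonneg)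
    fix k
    define f where "f = a (d k) powr (2 * (1 + \<epsilon>))"
    have "(a (d k))\<^sup>2 * (\<Sum>j\<in>I - {i}. g (d j)) = (\<Sum>j\<in>I - {i}. (a (d k))\<^sup>2 * g (d j))" by (rule sum_distrib_left)
    also have "... \<le> (\<Sum>j\<in>I - {i}. K + c * (f * g (d j) powr (1 + \<epsilon>)))"
      unfolding f_def by (intro sum_mono t g_nonneg)
    also have "... = n * K + c * (f * (\<Sum>j\<in>I - {i}. g (d j) powr (1 + \<epsilon>)))"
      using n by (simp add: sum.distrib sum_distrib_left)
    finally have "(a (d k))\<^sup>2 * (\<Sum>j\<in>I - {i}. g (d j)) / n \<le> K + c * (f * (\<Sum>j\<in>I - {i}. g (d j) powr (1 + \<epsilon>))) / n"
      using n by (simp add: field_simps)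
    moreover have "(a (d k))\<^sup>2 * h x \<le> K + c * (f * h x powr (1 + \<epsilon>))" for x
      unfolding f_def by (intro t h_nonneg)
    note this[of "2 * ((\<Sum>j\<in>I - {k}. a (d j)) / n)"] this[of "a (d k) / n"]
    ultimately show "(a (d k))\<^sup>2 * ((\<Sum>j\<in>I - {i}. g (d j)) / n + h (2 * ((\<Sum>j\<in>I - {k}. a (d j)) / n)) + h (a (d k) / n))
       \<le> 3 * K + c * (a (d k) powr (2 * (1 + \<epsilon>)) * ((\<Sum>j\<in>I - {i}. g (d j) powr (1 + \<epsilon>)) / n +
          h (2 * ((\<Sum>j\<in>I - {k}. a (d j)) / n)) powr (1 + \<epsilon>) + h (a (d k) / n) powr (1 + \<epsilon>)))"
      unfolding f_def[symmetric] by (simp add: distrib_left)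
  qed
  also have "... = (\<Sum>k\<in>I. loo_weight I i k) * (3 * K) + c * loo_bound I i (\<lambda>x. a x powr (2 * (1 + \<epsilon>))) (\<lambda>x. g x powr (1 + \<epsilon>)) (\<lambda>x. h x powr (1 + \<epsilon>)) d"
    unfolding loo_bound_def n_def[symmetric] by (simp add: distrib_left sum.distrib sum_distrib_left sum_distrib_right mult_ac)
  finally show ?thesis using sum_loo_weight[OF I] by (simp add: c_def)
qed

end

context frechet_sample
begin

lemma sigma_hat_meas [measurable]: "(\<lambda>w. sigma_hat X m a n w) \<in> borel_measurable M"
proof -
  have [measurable]: "j \<in> {1..n} \<Longrightarrow> (\<lambda>w. dm w j) \<in> borel_measurable M" for j by measurable
  show ?thesis unfolding sigma_hat_def by measurable
qed

text \<open>Truncation at level 1 reduces moments of order 1 + \<epsilon> to first moments; the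
  third bound repeats the comparison of \<open>moments_finite\<close> at the higher order.\<close>

lemma cond_ii_moments:
  assumes "0 < \<epsilon>" and cond: "cond_ii M \<tau> Y X m \<epsilon>"
  shows "E_a2h 1 < \<infinity>" and "(SUP n\<in>{1..}. E_h n) < \<infinity>"
    and "(\<integral>\<^sup>+w. ennreal (a (dY w) powr (2 * (1 + \<epsilon>))) \<partial>M) < \<infinity>"
proof -
  let ?p = "1 + \<epsilon>"
  have A: "(\<integral>\<^sup>+w. ennreal (a (dY w) powr (2 * ?p) * h (a (dY w)) powr ?p) \<partial>M) < \<infinity>"
    and H: "(SUP n\<in>{1..}. \<integral>\<^sup>+w. ennreal (h (2 * sigma_hat X m a n w) powr ?p) \<partial>M) < \<infinity>"
    using cond by (auto simp: cond_ii_def)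
  have t: "z \<le> 1 + 1 * z powr ?p" if "0 \<le> z" for z :: real
    using truncate_powr[of 1 z \<epsilon>] that assms(1) by simp
  have "E_a2h 1 \<le> ennreal 1 + ennreal 1 * (\<integral>\<^sup>+w. ennreal (a (dY w) powr (2 * ?p) * h (a (dY w)) powr ?p) \<partial>M)"
    using t[of "(a x)\<^sup>2 * h (a x)" for x] a_nonneg h_nonneg
    by (intro nn_integral_affine_le) (auto simp: square_mult_powr)
  also have "... < \<infinity>" using A by (rule affine_finite)
  finally show "E_a2h 1 < \<infinity>" .
  have "E_h n \<le> ennreal 1 + ennreal 1 * (SUP n\<in>{1..}. \<integral>\<^sup>+w. ennreal (h (2 * sigma_hat X m a n w) powr ?p) \<partial>M)" if "n \<in> {1..}" for n
  proof -
    have "E_h n \<le> ennreal 1 + ennreal 1 * (\<integral>\<^sup>+w. ennreal (h (2 * sigma_hat X m a n w) powr ?p) \<partial>M)"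
      using t h_nonneg by (intro nn_integral_affine_le) auto
    also have "... \<le> ennreal 1 + ennreal 1 * (SUP n\<in>{1..}. \<integral>\<^sup>+w. ennreal (h (2 * sigma_hat X m a n w) powr ?p) \<partial>M)"
      using that by (intro add_left_mono mult_left_mono SUP_upper) auto
    finally show ?thesis .
  qed
  then have "(SUP n\<in>{1..}. E_h n) \<le> ennreal 1 + ennreal 1 * (SUP n\<in>{1..}. \<integral>\<^sup>+w. ennreal (h (2 * sigma_hat X m a n w) powr ?p) \<partial>M)"
    by (rule SUP_least)
  also have "... < \<infinity>" using H by (rule affine_finite)
  finally show "(SUP n\<in>{1..}. E_h n) < \<infinity>" .
  have "(\<integral>\<^sup>+w. ennreal (a (dY w) powr (2 * ?p)) \<partial>M) \<le> ennreal (a 1 powr (2 * ?p)) +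
     ennreal (1 / g 1 powr ?p) * (\<integral>\<^sup>+w. ennreal (a (dY w) powr (2 * ?p) * h (a (dY w)) powr ?p) \<partial>M)"
  proof (rule nn_integral_affine_le)
    fix w
    show "a (dY w) powr (2 * ?p) \<le> a 1 powr (2 * ?p) + 1 / g 1 powr ?p * (a (dY w) powr (2 * ?p) * h (a (dY w)) powr ?p)"
    proof (cases "dY w \<le> 1")
      case True
      then have "a (dY w) powr (2 * ?p) \<le> a 1 powr (2 * ?p)"
        using assms(1) by (intro powr_mono2 a_mono a_nonneg) auto
      then show ?thesis by (simp add: add_increasing2)
    next
      case False
      have "g 1 \<le> h (a (dY w))" using False g_mono[of 1 "dY w"] g_le_h_a[of "dY w"] by simp
      then have "g 1 powr ?p \<le> h (a (dY w)) powr ?p" using assms(1) g_nonneg by (intro powr_mono2) auto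
      then have "a (dY w) powr (2 * ?p) * g 1 powr ?p \<le> a (dY w) powr (2 * ?p) * h (a (dY w)) powr ?p"
        by (rule mult_left_mono) simp
      then have "a (dY w) powr (2 * ?p) \<le> 1 / g 1 powr ?p * (a (dY w) powr (2 * ?p) * h (a (dY w)) powr ?p)"
        using g_pos[of 1] by (simp add: field_simps)
      then show ?thesis by (simp add: add_increasing)
    qed
  qed auto
  also have "... < \<infinity>" using A by (rule affine_finite)
  finally show "(\<integral>\<^sup>+w. ennreal (a (dY w) powr (2 * ?p)) \<partial>M) < \<infinity>" .
qed

text \<open>The complement supplies what \<open>loo_diff_good\<close> needs with N = 2 n / 5. For
  large n both thresholds differ from the expected sums by a fixed proportion, as Chebyshev's
  inequality requires.\<close>

definition bad :: "real \<Rightarrow> nat \<Rightarrow> 'w set" where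
  "bad c n = {w \<in> space M. (\<Sum>j=1..Suc n. indicator {y. dist y m \<le> c} (X j w)) < 2 / 5 * real n + (1::real)
     \<or> 4 * real n * \<sigma> < (\<Sum>j=1..Suc n. a (dm w j))}"

lemma X_ind_meas: "j \<in> {1..n} \<Longrightarrow> X j \<in> borel_measurable M"
  by simp

lemma bad_meas [measurable]: "bad c n \<in> sets M"
proof -
  note [measurable] = X_ind_meas
  show ?thesis unfolding bad_def by measurable
qed

lemma prob_bad:
  assumes half: "1 / 2 \<le> prob {w \<in> space M. dY w \<le> c}" and \<sigma>: "0 < \<sigma>" and fin: "E_a2 < \<infinity>"
  obtains b where "0 \<le> b" "\<And>n. n \<ge> 11 \<Longrightarrow> prob (bad c n) \<le> b / real n"
proof
  let ?u = "\<lambda>y. indicator {y. dist y m \<le> c} y :: real" and ?v = "\<lambda>y. a (dist y m)"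
  define b1 b2 where "b1 = variance (\<lambda>w. ?u (Y w))" and "b2 = variance (\<lambda>w. ?v (Y w))"
  have b: "0 \<le> b1" "0 \<le> b2" by (auto simp: b1_def b2_def)
  \<comment> \<open>400 is the inverse square of the relative deviation 1 / 20; for the second event
    the deviation is \<sigma> itself.\<close>
  define b where "b = 400 * b1 + b2 / \<sigma>\<^sup>2"
  show "0 \<le> b" using b by (simp add: b_def)
  have [measurable]: "?u \<in> borel_measurable borel" "?v \<in> borel_measurable borel" by measurable
  have iu: "integrable M (\<lambda>w. (?u (Y w))\<^sup>2)"
    by (rule integrable_const_bound[where B = 1]) (auto simp: indicator_def)
  have iv: "integrable M (\<lambda>w. (?v (Y w))\<^sup>2)"
    using fin by (intro integrableI_nonneg) auto
  have Eu: "1 / 2 \<le> expectation (\<lambda>w. ?u (Y w))"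
  proof -
    have "expectation (\<lambda>w. ?u (Y w)) = expectation (indicator {w \<in> space M. dY w \<le> c})"
      by (rule Bochner_Integration.integral_cong) (auto simp: indicator_def)
    also have "... = prob {w \<in> space M. dY w \<le> c}" by simp
    finally show ?thesis using half by simp
  qed
  \<comment> \<open>From 11 on, (n + 1) / 2 - (2 n / 5 + 1) is at least (n + 1) / 20.\<close>
  fix n :: nat assume n: "11 \<le> n"
  note [measurable] = X_ind_meas
  define N' where "N' = real (Suc n)"
  have N': "N' = real n + 1" "11 \<le> real n" using n by (auto simp: N'_def)
  let ?A = "{w \<in> space M. \<bar>(\<Sum>j=1..Suc n. ?u (X j w)) - N' * expectation (\<lambda>w. ?u (Y w))\<bar> \<ge> N' * (1 / 20)}"
  let ?B = "{w \<in> space M. \<bar>(\<Sum>j=1..Suc n. ?v (X j w)) - N' * expectation (\<lambda>w. ?v (Y w))\<bar> \<ge> N' * \<sigma>}"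
  have "bad c n \<subseteq> ?A \<union> ?B"
  proof
    fix w assume w: "w \<in> bad c n"
    then have sp: "w \<in> space M" by (simp add: bad_def)
    from w consider "(\<Sum>j=1..Suc n. ?u (X j w)) < 2 / 5 * real n + 1" | "4 * real n * \<sigma> < (\<Sum>j=1..Suc n. ?v (X j w))"
      unfolding bad_def by blast
    then show "w \<in> ?A \<union> ?B"
    proof cases
      case 1
      have "N' * (1 / 2) \<le> N' * expectation (\<lambda>w. ?u (Y w))" using Eu N' by (intro mult_left_mono) auto
      then have "N' * (1 / 20) \<le> \<bar>(\<Sum>j=1..Suc n. ?u (X j w)) - N' * expectation (\<lambda>w. ?u (Y w))\<bar>"
        using 1 N' by linarith
      then show ?thesis using sp by simp
    next
      case 2
      have "2 * N' * \<sigma> \<le> 4 * real n * \<sigma>" using N' \<sigma> by (intro mult_right_mono) auto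
      then have "N' * \<sigma> \<le> \<bar>(\<Sum>j=1..Suc n. ?v (X j w)) - N' * \<sigma>\<bar>"
        using 2 by linarith
      then show ?thesis using sp by simp
    qed
  qed
  then have "prob (bad c n) \<le> prob (?A \<union> ?B)" by (intro finite_measure_mono) measurable
  also have "... \<le> prob ?A + prob ?B" by (rule measure_Un_le) measurable
  also have "... \<le> b1 / (N' * (1 / 20)\<^sup>2) + b2 / (N' * \<sigma>\<^sup>2)"
    unfolding N'_def b1_def b2_def using \<sigma> iu iv by (intro add_mono prob_sum_deviation) auto
  also have "... = b / N'"
  proof -
    have "b1 / (N' * (1 / 20)\<^sup>2) = 400 * b1 / N'" by (simp add: power2_eq_square)
    moreover have "b2 / (N' * \<sigma>\<^sup>2) = b2 / \<sigma>\<^sup>2 / N'" by (simp add: mult.commute)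
    ultimately show ?thesis by (simp only: b_def add_divide_distrib)
  qed
  also have "... \<le> b / real n" using N' \<open>0 \<le> b\<close> by (intro divide_left_mono) auto
  finally show "prob (bad c n) \<le> b / real n" .
qed

text \<open>Truncating the general bound on \<open>bad\<close> costs 75 K times a probability of
  order 1 / n plus a term of order K^(-\<epsilon>); with K the square root of n both vanish. The
  constant 125 / 2 is 25 times 5 / 2.\<close>

lemma excess_bound_moments:
  assumes \<epsilon>: "0 < \<epsilon>" and cond: "cond_ii M \<tau> Y X m \<epsilon>" and \<sigma>: "0 < \<sigma>"
    and half: "1 / 2 \<le> prob {w \<in> space M. dY w \<le> c}" and c: "0 \<le> c"
    and r: "0 < r" "c + inv_a (16 * \<sigma>) \<le> r"
  shows "\<exists>e :: nat \<Rightarrow> real. e \<longlonglongrightarrow> 0 \<and> (\<forall>\<^sub>F n in sequentially. (\<integral>\<^sup>+w. ennreal (excess (mn n w)) \<partial>M)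
     \<le> ennreal (1 / real n) * (ennreal (125 / 2 / \<kappa> r) * E_a2 + ennreal (e n)))"
proof -
  let ?p = "1 + \<epsilon>"
  let ?f = "\<lambda>x. a x powr (2 * ?p)" and ?\<gamma> = "\<lambda>x. g x powr ?p" and ?\<eta> = "\<lambda>x. h x powr ?p"
  note mom = cond_ii_moments[OF \<epsilon> cond]
  note fin = moments_finite[OF mom(1)]
  have kr: "0 < \<kappa> r" using r by (intro kappa_pos)
  obtain b where b: "0 \<le> b" "\<And>n. n \<ge> 11 \<Longrightarrow> prob (bad c n) \<le> b / real n"
    using prob_bad[OF half \<sigma> fin(1)] by blast
  define A2 E1 G H where "A2 = (\<integral>\<^sup>+w. ennreal (?f (dY w)) \<partial>M)"
    and "E1 = (\<integral>\<^sup>+w. ennreal (?f (dY w) * ?\<eta> (a (dY w))) \<partial>M)"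
    and "G = (\<integral>\<^sup>+w. ennreal (?\<gamma> (dY w)) \<partial>M)"
    and "H = (SUP n\<in>{1..}. \<integral>\<^sup>+w. ennreal (?\<eta> (2 * sigma_hat X m a n w)) \<partial>M)"
  have lt: "A2 < \<infinity>" "E1 < \<infinity>" "G < \<infinity>" "H < \<infinity>"
    using cond mom(3) by (auto simp: A2_def E1_def G_def H_def cond_ii_def sigma_f_def)
  define C where "C = enn2real (25 * (A2 * G + E1 + A2 * H + E1))"
  have C: "ennreal C = 25 * (A2 * G + E1 + A2 * H + E1)"
    unfolding C_def using lt by (intro ennreal_enn2real) (auto simp: less_top[symmetric] ennreal_mult_eq_top_iff)
  have C0: "0 \<le> C" by (simp add: C_def)
  define e where "e n = 75 * b * real n powr (- 1 / 2) + (real n powr (1 / 2)) powr (- \<epsilon>) * C" for n :: nat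
  have e0: "0 \<le> e n" for n using b C0 by (simp add: e_def)
  have "(\<lambda>n. 75 * b * real n powr (- 1 / 2) + real n powr (- (\<epsilon> / 2)) * C) \<longlonglongrightarrow> 75 * b * 0 + 0 * C"
    using \<epsilon> by (intro tendsto_intros tendsto_neg_powr filterlim_real_sequentially) auto
  then have "e \<longlonglongrightarrow> 0" by (simp add: e_def[abs_def] powr_powr)
  moreover have "(\<integral>\<^sup>+w. ennreal (excess (mn n w)) \<partial>M) \<le> ennreal (1 / real n) * (ennreal (125 / 2 / \<kappa> r) * E_a2 + ennreal (e n))"
    if n11: "n \<ge> 11" for n
  proof -
    let ?I = "{1..Suc n}"
    have n: "n \<ge> 1" "0 < real n" using n11 by auto
    define L where "L i w = loo_total ?I i (dm w)" for i w
    define L' where "L' i w = loo_bound ?I i ?f ?\<gamma> ?\<eta> (dm w)" for i w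
    define V where "V i w = loo_square ?I i (dm w)" for i w
    have L0: "0 \<le> L i w" and L'0: "0 \<le> L' i w" and V0: "0 \<le> V i w" for i w
      by (auto simp: L_def L'_def V_def loo_square_nonneg g_nonneg h_nonneg intro!: loo_bound_nonneg)
    have [measurable]: "L i \<in> borel_measurable M" "L' i \<in> borel_measurable M" "V i \<in> borel_measurable M" for i
      unfolding L_def[abs_def] L'_def[abs_def] V_def[abs_def] by measurable
    define K where "K = real n powr (1 / 2)"
    have K0: "0 < K" using n by (simp add: K_def)
    have Kn: "K / real n = real n powr (- 1 / 2)"
    proof -
      have "real n powr (1 / 2 - 1) = real n powr (1 / 2) / real n powr 1" by (rule powr_diff)
      then show ?thesis using n by (simp add: K_def)
    qed
    have L'_int: "(\<integral>\<^sup>+w. ennreal (L' i w) \<partial>M) \<le> ennreal C" if i: "i \<in> ?I" for i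
    proof -
      have "(\<integral>\<^sup>+w. ennreal (L' i w) \<partial>M) \<le> 25 * (A2 * G
         + ennreal (1 / real n) * (\<integral>\<^sup>+w. ennreal (?f (dY w) * ?\<gamma> (dY w)) \<partial>M)
         + A2 * (\<integral>\<^sup>+w. ennreal (?\<eta> (2 * sigma_hat X m a n w)) \<partial>M)
         + (\<integral>\<^sup>+w. ennreal (?f (dY w) * ?\<eta> (a (dY w) / real n)) \<partial>M))"
        unfolding L'_def A2_def G_def using n(1) i by (rule nn_integral_loo_bound) auto
      also have "... \<le> 25 * (A2 * G + 1 * E1 + A2 * H + E1)"
      proof (intro mult_left_mono add_mono mult_mono order_refl)
        show "ennreal (1 / real n) \<le> 1" using n by (simp add: ennreal_le_1)
        show "(\<integral>\<^sup>+w. ennreal (?f (dY w) * ?\<gamma> (dY w)) \<partial>M) \<le> E1"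
          unfolding E1_def using \<epsilon>
          by (intro nn_integral_mono ennreal_leI mult_left_mono powr_mono2 g_le_h_a) (auto simp: g_nonneg)
        show "(\<integral>\<^sup>+w. ennreal (?\<eta> (2 * sigma_hat X m a n w)) \<partial>M) \<le> H"
          unfolding H_def using n by (intro SUP_upper) auto
        have "a x / real n \<le> a x" for x
          using n a_nonneg[of x] divide_left_mono[of 1 "real n" "a x"] by simp
        then show "(\<integral>\<^sup>+w. ennreal (?f (dY w) * ?\<eta> (a (dY w) / real n)) \<partial>M) \<le> E1"
          unfolding E1_def using \<epsilon>
          by (intro nn_integral_mono ennreal_leI mult_left_mono powr_mono2 h_mono) (auto simp: h_nonneg)
      qed auto
      finally show ?thesis by (simp add: C)
    qed
    \<comment> \<open>The good bound is kept on the whole space, so that its expectation is that of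
      \<open>loo_square\<close> without conditioning.\<close>
    define B where "B i w = 1 / real n * (5 / 2 / \<kappa> r * V i w + indicator (bad c n) w * L i w)" for i w
    show ?thesis
    proof (rule excess_bound[OF n(1), where B = B])
      fix i assume i: "i \<in> ?I"
      have trunc: "L i w \<le> 75 * k + k powr (- \<epsilon>) * L' i w" if "0 < k" for k w
        unfolding L_def L'_def using i n that \<epsilon> by (intro loo_bound_truncate) auto
      have "(\<integral>\<^sup>+w. ennreal (L i w) \<partial>M) \<le> ennreal 75 + ennreal 1 * (\<integral>\<^sup>+w. ennreal (L' i w) \<partial>M)"
        using trunc[of 1] L'0 by (intro nn_integral_affine_le) auto
      also have "... < \<infinity>" using L'_int[OF i] by (intro affine_finite) (auto intro: le_less_trans)
      finally show "(\<integral>\<^sup>+w. ennreal (loo_total ?I i (dm w)) \<partial>M) < \<infinity>" by (simp add: L_def)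
      show "B i \<in> borel_measurable M" unfolding B_def[abs_def] by measurable
      have "(\<integral>\<^sup>+w. ennreal (B i w) \<partial>M) \<le> (\<integral>\<^sup>+w. ennreal (1 / real n) * (ennreal (5 / 2 / \<kappa> r) * ennreal (V i w)
          + (ennreal (75 * K) * indicator (bad c n) w + ennreal (K powr (- \<epsilon>)) * ennreal (L' i w))) \<partial>M)"
      proof (rule nn_integral_mono)
        fix w
        have "indicator (bad c n) w * L i w \<le> 75 * K * indicator (bad c n) w + K powr (- \<epsilon>) * L' i w"
          using trunc[OF K0, of w] L'0[of i w] by (auto simp: indicator_def)
        then have "B i w \<le> 1 / real n * (5 / 2 / \<kappa> r * V i w + (75 * K * indicator (bad c n) w + K powr (- \<epsilon>) * L' i w))"
          unfolding B_def using n by (intro mult_left_mono) auto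
        then have "ennreal (B i w) \<le> ennreal (1 / real n * (5 / 2 / \<kappa> r * V i w + (75 * K * indicator (bad c n) w + K powr (- \<epsilon>) * L' i w)))"
          by (rule ennreal_leI)
        also have "... = ennreal (1 / real n) * (ennreal (5 / 2 / \<kappa> r) * ennreal (V i w)
          + (ennreal (75 * K) * indicator (bad c n) w + ennreal (K powr (- \<epsilon>)) * ennreal (L' i w)))"
          using V0 L'0 K0 kr by (simp only: ennreal_mult ennreal_plus ennreal_indicator mult_nonneg_nonneg
            add_nonneg_nonneg divide_nonneg_nonneg powr_ge_zero indicator_pos_le less_imp_le of_nat_0_le_iff zero_le_numeral zero_le_one)
        finally show "ennreal (B i w) \<le> ..." .
      qed
      also have "... = ennreal (1 / real n) * (ennreal (5 / 2 / \<kappa> r) * (\<integral>\<^sup>+w. ennreal (V i w) \<partial>M)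
          + (ennreal (75 * K) * emeasure M (bad c n) + ennreal (K powr (- \<epsilon>)) * (\<integral>\<^sup>+w. ennreal (L' i w) \<partial>M)))"
        by (simp add: nn_integral_cmult nn_integral_add nn_integral_cmult_indicator)
      also have "... \<le> ennreal (1 / real n) * (ennreal (5 / 2 / \<kappa> r) * (25 * E_a2)
          + (ennreal (75 * K) * ennreal (b / real n) + ennreal (K powr (- \<epsilon>)) * ennreal C))"
      proof (intro mult_left_mono add_mono)
        show "(\<integral>\<^sup>+w. ennreal (V i w) \<partial>M) \<le> 25 * E_a2" using nn_integral_loo_square[OF n(1) i] by (simp add: V_def)
        show "emeasure M (bad c n) \<le> ennreal (b / real n)"
          using b(2)[OF n11] by (simp add: emeasure_eq_measure ennreal_leI)
        show "(\<integral>\<^sup>+w. ennreal (L' i w) \<partial>M) \<le> ennreal C" by (rule L'_int[OF i])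
      qed auto
      also have "ennreal (75 * K) * ennreal (b / real n) + ennreal (K powr (- \<epsilon>)) * ennreal C = ennreal (e n)"
      proof -
        have nn: "0 \<le> 75 * K" "0 \<le> b / real n" "0 \<le> K powr (- \<epsilon>)" using K0 b n by auto
        have "ennreal (75 * K) * ennreal (b / real n) + ennreal (K powr (- \<epsilon>)) * ennreal C
          = ennreal (75 * K * (b / real n) + K powr (- \<epsilon>) * C)"
          unfolding ennreal_mult[OF nn(1,2), symmetric] ennreal_mult[OF nn(3) C0, symmetric]
          by (rule ennreal_plus[OF mult_nonneg_nonneg[OF nn(1,2)] mult_nonneg_nonneg[OF nn(3) C0], symmetric])
        also have "75 * K * (b / real n) + K powr (- \<epsilon>) * C = e n"
          unfolding e_def K_def[symmetric] Kn[symmetric] by simp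
        finally show ?thesis .
      qed
      also have "ennreal (5 / 2 / \<kappa> r) * (25 * E_a2) = ennreal (125 / 2 / \<kappa> r) * E_a2"
      proof -
        have "ennreal (125 / 2 / \<kappa> r) = ennreal (5 / 2 / \<kappa> r) * ennreal 25"
          using kr by (subst ennreal_mult[symmetric]) auto
        then show ?thesis by (simp add: mult.assoc)
      qed
      finally show "(\<integral>\<^sup>+w. ennreal (B i w) \<partial>M) \<le> ennreal (1 / real n) * (ennreal (125 / 2 / \<kappa> r) * E_a2 + ennreal (e n))" .
      fix w p q
      assume w: "w \<in> space M" and "leave_one_out \<tau> ?I i (\<lambda>j. X j w) p q"
      then interpret L: leave_one_out \<tau> ?I i "\<lambda>j. X j w" m p q by simp
      have Ln: "L.n = real n" by (simp add: L.n_def)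
      have Ld: "L.d = dm w" by (simp add: L.d_def[abs_def])
      show "\<tau> (dist (X i w) q) - \<tau> (dist (X i w) p) \<le> B i w"
      proof (cases "w \<in> bad c n")
        case True
        have "\<tau> (dist (X i w) q) - \<tau> (dist (X i w) p) \<le> L i w / real n"
          using L.loo_diff unfolding Ln Ld L_def .
        also have "... \<le> B i w" using True V0[of i w] kr n by (simp add: B_def field_simps)
        finally show ?thesis .
      next
        case False
        then have cnt: "2 / 5 * real n + 1 \<le> (\<Sum>j\<in>?I. indicator {y. dist y m \<le> c} (X j w) :: real)"
          and sa: "(\<Sum>j\<in>?I. a (dm w j)) \<le> 4 * real n * \<sigma>" using w unfolding bad_def by (auto simp: not_less)
        have "(\<Sum>j\<in>?I. indicator {y. dist y m \<le> c} (X j w) :: real) = (\<Sum>j\<in>?I. if dm w j \<le> c then 1 else 0)"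
          by (intro sum.cong) (auto simp: indicator_def)
        also have "... = (\<Sum>j\<in>{j \<in> ?I. dm w j \<le> c}. 1)" by (rule sum.inter_filter[symmetric]) simp
        also have "... = real (card {j \<in> ?I. dm w j \<le> c})" by simp
        finally have "2 / 5 * real n + 1 \<le> real (card {j \<in> ?I. dm w j \<le> c})" using cnt by simp
        moreover have "c + inv_a (4 * ((\<Sum>j\<in>?I. a (dm w j)) / real n)) \<le> r"
        proof -
          have "(\<Sum>j\<in>?I. a (dm w j)) / real n \<le> 4 * real n * \<sigma> / real n"
            by (rule divide_right_mono[OF sa]) simp
          moreover have "4 * real n * \<sigma> / real n = 4 * \<sigma>" using n by simp
          ultimately have "4 * ((\<Sum>j\<in>?I. a (dm w j)) / real n) \<le> 16 * \<sigma>" by linarith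
          then show ?thesis using inv_a_mono r(2) by (meson add_left_mono order_trans)
        qed
        ultimately have "\<tau> (dist (X i w) q) - \<tau> (dist (X i w) p) \<le> V i w / (2 / 5 * real n * \<kappa> r)"
          using L.loo_diff_good[OF r(1), of c "2 / 5 * real n"] n unfolding Ln Ld V_def by simp
        also have "... = B i w" using False n kr by (simp add: B_def field_simps)
        finally show ?thesis .
      qed
    qed (use L0 V0 kr n in \<open>auto simp: B_def intro!: mult_nonneg_nonneg add_nonneg_nonneg divide_nonneg_nonneg\<close>)
  qed
  ultimately show ?thesis by (intro exI[of _ e]) (auto simp: eventually_sequentially)
qed

lemma frechet_risk_bound_moments:
  assumes \<epsilon>: "0 < \<epsilon>" and cond: "cond_ii M \<tau> Y X m \<epsilon>" and med: "is_median M dY c"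
  shows "\<exists>e :: nat \<Rightarrow> real. e \<longlonglongrightarrow> 0 \<and> (\<forall>\<^sub>F n in sequentially. frechet_risk M \<tau> m c (mn n) \<le>
     ennreal (256 / real n) * (sigma_f M Y m (\<lambda>x. (a x)\<^sup>2) * inverse (rdtau \<tau> (4 * r_zero M \<tau> Y m c)) + ennreal (e n)))"
proof (cases "\<sigma> = 0")
  case True
  \<comment> \<open>Degenerate case: almost surely all observations equal m, hence so do the
    empirical means, and the risk is 0. It is set apart because \<open>r_zero\<close> may vanish and
    \<open>prob_bad\<close> divides by \<sigma>.\<close>
  then have "AE w in M. a (dY w) = 0"
    using integral_nonneg_eq_0_iff_AE[OF a_int] a_nonneg by simp
  then have X0: "AE w in M. a (dm w j) = 0" if "j \<ge> 1" for j
    by (intro AE_X[OF that, of "\<lambda>y. a (dist y m) = 0"]) measurable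
  have X0': "AE w in M. \<forall>j\<in>{1..}. a (dm w j) = 0"
    using X0 by (intro AE_ball_countable[THEN iffD2]) auto
  have "frechet_risk M \<tau> m c (mn n) = 0" if n: "n \<ge> 1" for n
  proof -
    have "AE w in M. ennreal ((dist m (mn n w))\<^sup>2) * rdtau \<tau> (c + dist m (mn n w)) = 0"
      using X0' mn_min[OF n]
    proof eventually_elim
      case (elim w)
      have Xm: "X j w = m" if "j \<in> {1..n}" for j
      proof (rule ccontr)
        assume "X j w \<noteq> m"
        then have "0 < a (dm w j)" by (intro a_pos) simp
        then show False using elim(1) that by simp
      qed
      have "(\<Sum>j=1..n. \<tau> (dist m (mn n w))) = (\<Sum>j=1..n. \<tau> (dist (X j w) (mn n w)))"
        by (intro sum.cong refl) (simp add: Xm)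
      also have "... \<le> (\<Sum>j=1..n. \<tau> (dist (X j w) m))" using elim(2) by blast
      also have "... = 0" by (intro sum.neutral) (simp add: Xm)
      finally have "real n * \<tau> (dist m (mn n w)) \<le> 0" by simp
      then have "\<tau> (dist m (mn n w)) \<le> 0" using n by (simp add: mult_le_0_iff)
      then have "dist m (mn n w) = 0" using tau_pos[of "dist m (mn n w)"] by (metis not_less zero_less_dist_iff dist_eq_0_iff)
      then show ?case by simp
    qed
    then have "frechet_risk M \<tau> m c (mn n) = (\<integral>\<^sup>+w. 0 \<partial>M)"
      unfolding frechet_risk_def by (rule nn_integral_cong_AE)
    then show ?thesis by simp
  qed
  then show ?thesis by (intro exI[of _ "\<lambda>_. 0"]) (auto simp: eventually_sequentially intro!: exI[of _ 1])
next
  case False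
  then have \<sigma>: "0 < \<sigma>" using sigma_nonneg by simp
  have sf: "enn2real (sigma_f M Y m a) = \<sigma>"
    unfolding sigma_f_def using nn_integral_eq_integral[OF a_int] a_nonneg sigma_nonneg by simp
  define r0 where "r0 = r_zero M \<tau> Y m c"
  have r0_eq: "r0 = max c (2 * inv_a (16 * \<sigma>))" by (simp add: r0_def r_zero_def sf)
  \<comment> \<open>The strict inequality makes the inverse at 16 \<sigma> positive, so the
    evaluation point 4 r0 is positive even if c = 0.\<close>
  have a0: "a 0 < 16 * \<sigma>" using a_0_le_sigma \<sigma> by simp
  then have "a (inv_a (16 * \<sigma>)) \<noteq> a 0" using a_inv_a[of "16 * \<sigma>"] by simp
  then have "inv_a (16 * \<sigma>) \<noteq> 0" by auto
  then have ipos: "0 < inv_a (16 * \<sigma>)" using inv_a_nonneg[of "16 * \<sigma>"] by linarith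
  then have r: "0 < 4 * r0" "c + inv_a (16 * \<sigma>) \<le> 4 * r0" unfolding r0_eq by (auto simp: max_def)
  have kr: "0 < \<kappa> (4 * r0)" using r by (intro kappa_pos)
  note half = risk_le_excess(2,3)[OF order_refl med]
  obtain e where e: "e \<longlonglongrightarrow> 0" and ev: "\<forall>\<^sub>F n in sequentially. (\<integral>\<^sup>+w. ennreal (excess (mn n w)) \<partial>M)
     \<le> ennreal (1 / real n) * (ennreal (125 / 2 / \<kappa> (4 * r0)) * E_a2 + ennreal (e n))"
    using excess_bound_moments[OF \<epsilon> cond \<sigma> half r] by blast
  have "\<forall>\<^sub>F n in sequentially. frechet_risk M \<tau> m c (mn n) \<le>
     ennreal (256 / real n) * (sigma_f M Y m (\<lambda>x. (a x)\<^sup>2) * inverse (rdtau \<tau> (4 * r0)) + ennreal (e n))"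
    using ev eventually_ge_at_top[of 1]
  proof eventually_elim
    case (elim n)
    have inv: "inverse (rdtau \<tau> (4 * r0)) = ennreal (1 / \<kappa> (4 * r0))"
      using r kr by (simp add: rdtau_pos inverse_ennreal divide_inverse)
    \<comment> \<open>125 / 2 is rounded up to 64, which times the factor 4 of
      \<open>risk_le_excess\<close> is 256.\<close>
    have "ennreal (125 / 2 / \<kappa> (4 * r0)) * E_a2 + ennreal (e n) \<le> ennreal 64 * (E_a2 * ennreal (1 / \<kappa> (4 * r0)) + ennreal (e n))"
    proof -
      have "ennreal (125 / 2 / \<kappa> (4 * r0)) \<le> ennreal (64 * (1 / \<kappa> (4 * r0)))"
        using kr by (intro ennreal_leI) (simp add: field_simps)
      also have "... = ennreal 64 * ennreal (1 / \<kappa> (4 * r0))" using kr by (intro ennreal_mult) auto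
      finally have "ennreal (125 / 2 / \<kappa> (4 * r0)) * E_a2 \<le> ennreal 64 * ennreal (1 / \<kappa> (4 * r0)) * E_a2"
        by (rule mult_right_mono) simp
      moreover have "ennreal 1 * ennreal (e n) \<le> ennreal 64 * ennreal (e n)" by (intro mult_right_mono ennreal_leI) auto
      ultimately show ?thesis by (simp add: distrib_left mult_ac add_mono)
    qed
    then have "ennreal (1 / real n) * (ennreal (125 / 2 / \<kappa> (4 * r0)) * E_a2 + ennreal (e n))
      \<le> ennreal (1 / real n) * (ennreal 64 * (E_a2 * ennreal (1 / \<kappa> (4 * r0)) + ennreal (e n)))"
      by (rule mult_left_mono) simp
    with elim(1) have "4 * (\<integral>\<^sup>+w. ennreal (excess (mn n w)) \<partial>M)
      \<le> 4 * (ennreal (1 / real n) * (ennreal 64 * (E_a2 * ennreal (1 / \<kappa> (4 * r0)) + ennreal (e n))))"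
      by (intro mult_left_mono) (auto intro: order_trans)
    also have "... = ennreal (256 / real n) * (E_a2 * ennreal (1 / \<kappa> (4 * r0)) + ennreal (e n))"
    proof -
      have "ennreal (256 / real n) = ennreal 4 * (ennreal (1 / real n) * ennreal 64)"
        by (simp add: ennreal_mult[symmetric] del: ennreal_numeral)
      then show ?thesis by (simp add: mult.assoc)
    qed
    finally show ?case
      using risk_le_excess(1)[OF elim(2) med] by (simp add: inv sigma_f_def)
  qed
  then show ?thesis using e by (auto simp: r0_def)
qed

end

theorem corollary3p11:
  fixes M :: "'w measure"
    and \<tau> :: "real \<Rightarrow> real"
    and Y :: "'w \<Rightarrow> 'a::hadamard_space"
    and X :: "nat \<Rightarrow> 'w \<Rightarrow> 'a"
    and ref m :: 'a
    and mn :: "nat \<Rightarrow> 'w \<Rightarrow> 'a"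
    and med :: real
  assumes "prob_space M"
    and "\<tau> \<in> S0_plus"
    and "filterlim (dtau \<tau>) at_top at_top"
    and "Y \<in> borel_measurable M"
    and "\<exists>S. separable_space (top_of_set S) \<and> (AE \<omega> in M. Y \<omega> \<in> S)"
    and "(\<integral>\<^sup>+\<omega>. ennreal (dtau \<tau> (dist (Y \<omega>) ref)) \<partial>M) < \<infinity>"
    and "frechet_mean M \<tau> Y ref m"
    and "prob_space.indep_vars M (\<lambda>_. borel) X {1..}"
    and "\<And>j. j \<ge> 1 \<Longrightarrow> distr M borel (X j) = distr M borel Y"
    and "\<And>n. n \<ge> 1 \<Longrightarrow> empirical_frechet_mean M \<tau> X n (mn n)"
    and "is_median M (\<lambda>\<omega>. dist (Y \<omega>) m) med"
  shows
    "(cond_i M \<tau> Y m \<longrightarrow>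
       (\<exists>e :: nat \<Rightarrow> real. e \<longlonglongrightarrow> 0 \<and> (\<forall>\<^sub>F n in sequentially.
          frechet_risk M \<tau> m med (mn n) \<le>
            ennreal (256 / real n) *
              (sigma_f M Y m (\<lambda>x. (dtau \<tau> x)\<^sup>2) * S_n1 M \<tau> Y X m n + ennreal (e n)))))
   \<and> (\<forall>\<epsilon>>0. cond_ii M \<tau> Y X m \<epsilon> \<longrightarrow>
       (\<exists>e :: nat \<Rightarrow> real. e \<longlonglongrightarrow> 0 \<and> (\<forall>\<^sub>F n in sequentially.
          frechet_risk M \<tau> m med (mn n) \<le>
            ennreal (256 / real n) *
              (sigma_f M Y m (\<lambda>x. (dtau \<tau> x)\<^sup>2) * inverse (rdtau \<tau> (4 * r_zero M \<tau> Y m med)) + ennreal (e n)))))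
   \<and> ((cond_i M \<tau> Y m \<and>
          (SUP n\<in>{1..}. \<integral>\<^sup>+\<omega>. ennreal (h_fun \<tau> (2 * sigma_hat X m (dtau \<tau>) n \<omega>)) \<partial>M) < \<infinity>)
        \<or> (\<exists>\<epsilon>>0. cond_ii M \<tau> Y X m \<epsilon>) \<longrightarrow>
       (\<forall>\<^sub>F n in sequentially. integrable M (\<lambda>\<omega>. \<tau> (dist m (mn n \<omega>)))) \<and>
       (\<lambda>n. the_inv_into {0..} \<tau> (\<integral>\<omega>. \<tau> (dist m (mn n \<omega>)) \<partial>M)) \<in> O(\<lambda>n. real n powr (- 1 / 2)) \<and>
       (\<forall>\<^sub>F n in sequentially. integrable M (\<lambda>\<omega>. dist m (mn n \<omega>))) \<and>
       (\<lambda>n. \<integral>\<omega>. dist m (mn n \<omega>) \<partial>M) \<in> O(\<lambda>n. real n powr (- 1 / 2)))"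
proof -
  interpret prob_space M by fact
  interpret transform \<tau> using assms(2,3) by unfold_locales
  obtain S where S: "separable_space (top_of_set S)" "AE w in M. Y w \<in> S" using assms(5) by blast
  \<comment> \<open>A countable dense subset is turned into a sequence; it is nonempty because the
    total mass is 1.\<close>
  then obtain C where C: "countable C" "C \<subseteq> S" "top_of_set S closure_of C = S"
    by (auto simp: separable_space_def)
  have SC: "S \<subseteq> closure C"
    using C(2,3) by (auto simp: closure_of_subtopology Int_absorb1)
  have "C \<noteq> {}"
  proof
    assume "C = {}"
    then have "S = {}" using SC by simp
    then have "AE w in M. False" using S(2) by simp
    then show False by simp
  qed
  define s where "s = from_nat_into C"
  have "range s = C" using \<open>C \<noteq> {}\<close> C(1) by (simp add: s_def range_from_nat_into)
  then have dense: "AE w in M. Y w \<in> closure (range s)"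
    using S(2) SC by (auto elim!: eventually_mono)
  interpret separable_sample \<tau> M Y X s
    using assms(4,8,9) dense by unfold_locales auto
  have ref_int: "integrable M (\<lambda>w. a (dist (Y w) ref))"
    using assms(6) by (intro integrableI_nonneg) (auto simp: a_nonneg)
  \<comment> \<open>Subadditivity of \<open>a\<close> moves the moment condition from the reference
    point to m.\<close>
  have m_int: "integrable M (\<lambda>w. a (dist (Y w) m))"
  proof (rule Bochner_Integration.integrable_bound)
    show "integrable M (\<lambda>w. a (dist (Y w) ref) + a (dist ref m))" using ref_int by auto
    have "a (dist y m) \<le> a (dist y ref) + a (dist ref m)" for y
      using a_mono[OF dist_triangle[of y m ref]] a_subadd[of "dist y ref" "dist ref m"] by simp
    then show "AE w in M. norm (a (dist (Y w) m)) \<le> norm (a (dist (Y w) ref) + a (dist ref m))"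
      using a_nonneg by (intro AE_I2) (simp add: add_nonneg_nonneg)
  qed measurable
  \<comment> \<open>Replacing the reference point by m changes the objective by a constant
    only.\<close>
  have m_min: "0 \<le> (\<integral>w. \<tau> (dist (Y w) q) - \<tau> (dist (Y w) m) \<partial>M)" for q
  proof -
    have "(\<integral>w. \<tau> (dist (Y w) q) - \<tau> (dist (Y w) m) \<partial>M)
      = (\<integral>w. (\<tau> (dist (Y w) q) - \<tau> (dist (Y w) ref)) - (\<tau> (dist (Y w) m) - \<tau> (dist (Y w) ref)) \<partial>M)"
      by simp
    also have "... = (\<integral>w. \<tau> (dist (Y w) q) - \<tau> (dist (Y w) ref) \<partial>M) - (\<integral>w. \<tau> (dist (Y w) m) - \<tau> (dist (Y w) ref) \<partial>M)"
      by (rule Bochner_Integration.integral_diff) (rule tau_diff_integrable[OF ref_int])+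
    finally show ?thesis using assms(7) by (auto simp: frechet_mean_def is_arg_min_def not_less)
  qed
  have "\<exists>F. n \<ge> 1 \<longrightarrow> F \<in> measurable (PiM {1..n} (\<lambda>_. borel)) borel \<and> (\<forall>w\<in>space M. mn n w = F (\<lambda>j\<in>{1..n}. X j w))" for n
    using assms(10)[of n] unfolding empirical_frechet_mean_def by blast
  then obtain F where F: "\<And>n. n \<ge> 1 \<Longrightarrow> F n \<in> measurable (PiM {1..n} (\<lambda>_. borel)) borel"
    "\<And>n w. n \<ge> 1 \<Longrightarrow> w \<in> space M \<Longrightarrow> mn n w = F n (\<lambda>j\<in>{1..n}. X j w)" by metis
  have mn_min: "AE w in M. \<forall>z. (\<Sum>j=1..n. \<tau> (dist (X j w) (mn n w))) \<le> (\<Sum>j=1..n. \<tau> (dist (X j w) z))"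
    if "n \<ge> 1" for n
    using assms(10)[OF that] by (auto simp: empirical_frechet_mean_def is_arg_min_def not_less)
  interpret frechet_sample \<tau> M Y X s m mn F
    using m_int m_min F mn_min by unfold_locales auto
  note half = risk_le_excess(2,3)[OF order_refl assms(11)]
  \<comment> \<open>The rates in (iii) rest on two finite quantities, which either alternative of
    the hypothesis provides.\<close>
  have "(cond_i M \<tau> Y m \<and> (SUP n\<in>{1..}. E_h n) < \<infinity>) \<or> (\<exists>\<epsilon>>0. cond_ii M \<tau> Y X m \<epsilon>) \<Longrightarrow>
      E_a2h 1 < \<infinity> \<and> (SUP n\<in>{1..}. E_h n) < \<infinity>"
    using cond_ii_moments by (auto simp: cond_i_def)
  then show ?thesis
    using frechet_risk_bound[OF _ assms(11)] frechet_risk_bound_moments[OF _ _ assms(11)] frechet_mean_rates[OF half] by blast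
qed

end
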